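(* Let $G$ be a locally compact totally disconnected group, $A$ a closed central subgroup and $\mathbb{F}$ a field. If the Hecke algebra $\mathcal{H}$ exists (i.e. $G$ has a compact open subgroup $K$ such that $\mathbb{F}$ is $K$-ordinary), then the category $\mathcal{M}_A(G)$ is equivalent to $\mathcal{M}_A(\mathcal{H})$.
   Context: $\mathbb{F}$ is a discrete field of characteristic $p\ge0$. The order of a profinite group $K$ is the supernatural number $\mathrm{lcm}|K/U|$ ($U$ open normal); $\mathbb{F}$ is $K$-ordinary if $p\nmid|K|$ (always if $p=0$). In that case the left Haar measure $\mu=\mu_K$ with $\mu_K(K)=1$ can be considered with values in $\mathbb{F}$, and the Hecke algebra $\mathcal{H}=\mathcal{H}(G,\mathbb{F},\mu_K)$ is the space of compactly supported locally constant functions $G\to\mathbb{F}$ with product $\Psi\star\Theta(\mathbf{x})=\int_G\Psi(\mathbf{y})\Theta(\mathbf{y}^{-1}\mathbf{x})\mu_K(d\mathbf{y})$. A representation of $G$ over $\mathbb{F}$ is smooth if every vector is fixed by some compact open subgroup; $\mathcal{M}(G)$ is the category of smooth representations; $\mathcal{M}_A(G)$ is its full subcategory of representations that are semisimple as $\mathbb{F}A$-modules. An $\mathcal{H}$-module $M$ is smooth if $\mathcal{H}*M=M$; $\mathcal{M}(\mathcal{H})$ is the category of smooth $\mathcal{H}$-modules. The functor $\mathcal{F}:\mathcal{M}(G)\to\mathcal{M}(\mathcal{H})$ sends $(\pi,V)$ to $(\varpi,V)$ with $\varpi(\Theta)v=\int_G\Theta(\mathbf{g})\pi(\mathbf{g})v\,\mu(d\mathbf{g})$.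 $\mathcal{M}_A(\mathcal{H})$ is the full subcategory of $\mathcal{M}(\mathcal{H})$ of objects isomorphic to $\mathcal{F}((\pi,V))$ with $(\pi,V)\in\mathcal{M}_A(G)$. *)

theory Defs
  imports
    "HOL-Algebra.Module"
    "HOL-Algebra.Coset"
    "HOL-Computational_Algebra.Primes"
    "HOL-Library.Extended_Nat"
    "HOL-Analysis.Abstract_Topological_Spaces"
begin

section \<open>Categories\<close>

text \<open>The source and target are arguments of the composition, because a morphism is later
  an extensional function, which does not determine its codomain.\<close>

record ('o, 'm) cat =
  Obj :: "'o set"
  Hom :: "'o \<Rightarrow> 'o \<Rightarrow> 'm set"
  Ident :: "'o \<Rightarrow> 'm"
  Comp :: "'o \<Rightarrow> 'o \<Rightarrow> 'o \<Rightarrow> 'm \<Rightarrow> 'm \<Rightarrow> 'm"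

locale category =
  fixes C :: "('o, 'm) cat"
  assumes Ident_in_Hom: "X \<in> Obj C \<Longrightarrow> Ident C X \<in> Hom C X X"
    and Comp_in_Hom:
      "\<lbrakk>X \<in> Obj C; Y \<in> Obj C; Z \<in> Obj C; f \<in> Hom C X Y; g \<in> Hom C Y Z\<rbrakk>
        \<Longrightarrow> Comp C X Y Z g f \<in> Hom C X Z"
    and Comp_Ident_left:
      "\<lbrakk>X \<in> Obj C; Y \<in> Obj C; f \<in> Hom C X Y\<rbrakk> \<Longrightarrow> Comp C X Y Y (Ident C Y) f = f"
    and Comp_Ident_right:
      "\<lbrakk>X \<in> Obj C; Y \<in> Obj C; f \<in> Hom C X Y\<rbrakk> \<Longrightarrow> Comp C X X Y f (Ident C X) = f"
    and Comp_assoc: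
      "\<lbrakk>W \<in> Obj C; X \<in> Obj C; Y \<in> Obj C; Z \<in> Obj C;
        f \<in> Hom C W X; g \<in> Hom C X Y; h \<in> Hom C Y Z\<rbrakk>
        \<Longrightarrow> Comp C W X Z (Comp C X Y Z h g) f = Comp C W Y Z h (Comp C W X Y g f)"

definition full_subcat :: "('o, 'm) cat \<Rightarrow> ('o \<Rightarrow> bool) \<Rightarrow> ('o, 'm) cat" where
  "full_subcat C P = C\<lparr>Obj := {X \<in> Obj C. P X}\<rparr>"

definition inverse_morphisms :: "('o, 'm) cat \<Rightarrow> 'o \<Rightarrow> 'o \<Rightarrow> 'm \<Rightarrow> 'm \<Rightarrow> bool" where
  "inverse_morphisms C X Y f g \<longleftrightarrow>
     f \<in> Hom C X Y \<and> g \<in> Hom C Y X \<and>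
     Comp C X Y X g f = Ident C X \<and> Comp C Y X Y f g = Ident C Y"

definition isomorphism :: "('o, 'm) cat \<Rightarrow> 'o \<Rightarrow> 'o \<Rightarrow> 'm \<Rightarrow> bool" where
  "isomorphism C X Y f \<longleftrightarrow> (\<exists>g. inverse_morphisms C X Y f g)"

definition isomorphic :: "('o, 'm) cat \<Rightarrow> 'o \<Rightarrow> 'o \<Rightarrow> bool" where
  "isomorphic C X Y \<longleftrightarrow> (\<exists>f. isomorphism C X Y f)"

record ('o1, 'm1, 'o2, 'm2) fctor =
  OMap :: "'o1 \<Rightarrow> 'o2"
  HMap :: "'o1 \<Rightarrow> 'o1 \<Rightarrow> 'm1 \<Rightarrow> 'm2"

locale functor_between =
  source: category C + target: category D
  for C :: "('o1, 'm1) cat" and D :: "('o2, 'm2) cat" +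
  fixes \<Phi> :: "('o1, 'm1, 'o2, 'm2) fctor"
  assumes OMap_in_Obj: "X \<in> Obj C \<Longrightarrow> OMap \<Phi> X \<in> Obj D"
    and HMap_in_Hom:
      "\<lbrakk>X \<in> Obj C; Y \<in> Obj C; f \<in> Hom C X Y\<rbrakk>
        \<Longrightarrow> HMap \<Phi> X Y f \<in> Hom D (OMap \<Phi> X) (OMap \<Phi> Y)"
    and HMap_Ident: "X \<in> Obj C \<Longrightarrow> HMap \<Phi> X X (Ident C X) = Ident D (OMap \<Phi> X)"
    and HMap_Comp:
      "\<lbrakk>X \<in> Obj C; Y \<in> Obj C; Z \<in> Obj C; f \<in> Hom C X Y; g \<in> Hom C Y Z\<rbrakk>
        \<Longrightarrow> HMap \<Phi> X Z (Comp C X Y Z g f) =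
            Comp D (OMap \<Phi> X) (OMap \<Phi> Y) (OMap \<Phi> Z) (HMap \<Phi> Y Z g) (HMap \<Phi> X Y f)"

definition id_functor :: "('o, 'm, 'o, 'm) fctor" where
  "id_functor = \<lparr>OMap = (\<lambda>X. X), HMap = (\<lambda>X Y f. f)\<rparr>"

definition comp_functor ::
  "('o2, 'm2, 'o3, 'm3) fctor \<Rightarrow> ('o1, 'm1, 'o2, 'm2) fctor \<Rightarrow> ('o1, 'm1, 'o3, 'm3) fctor" where
  "comp_functor \<Psi> \<Phi> =
     \<lparr>OMap = (\<lambda>X. OMap \<Psi> (OMap \<Phi> X)),
      HMap = (\<lambda>X Y f. HMap \<Psi> (OMap \<Phi> X) (OMap \<Phi> Y) (HMap \<Phi> X Y f))\<rparr>"

definition natural_isomorphism ::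
  "('o1, 'm1) cat \<Rightarrow> ('o2, 'm2) cat \<Rightarrow> ('o1, 'm1, 'o2, 'm2) fctor \<Rightarrow> ('o1, 'm1, 'o2, 'm2) fctor
     \<Rightarrow> ('o1 \<Rightarrow> 'm2) \<Rightarrow> bool" where
  "natural_isomorphism C D \<Phi> \<Psi> \<eta> \<longleftrightarrow>
     (\<forall>X\<in>Obj C. isomorphism D (OMap \<Phi> X) (OMap \<Psi> X) (\<eta> X)) \<and>
     (\<forall>X\<in>Obj C. \<forall>Y\<in>Obj C. \<forall>f\<in>Hom C X Y.
        Comp D (OMap \<Phi> X) (OMap \<Phi> Y) (OMap \<Psi> Y) (\<eta> Y) (HMap \<Phi> X Y f) =
        Comp D (OMap \<Phi> X) (OMap \<Psi> X) (OMap \<Psi> Y) (HMap \<Psi> X Y f) (\<eta> X))"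

definition equivalent_categories :: "('o1, 'm1) cat \<Rightarrow> ('o2, 'm2) cat \<Rightarrow> bool" where
  "equivalent_categories C D \<longleftrightarrow>
     (\<exists>\<Phi> \<Psi>. functor_between C D \<Phi> \<and> functor_between D C \<Psi> \<and>
        (\<exists>\<eta>. natural_isomorphism C C id_functor (comp_functor \<Psi> \<Phi>) \<eta>) \<and>
        (\<exists>\<epsilon>. natural_isomorphism D D (comp_functor \<Phi> \<Psi>) id_functor \<epsilon>))"


section \<open>Topological groups and ordinary fields\<close>

definition topological_group :: "('g, 'a) monoid_scheme \<Rightarrow> 'g topology \<Rightarrow> bool" where
  "topological_group G T \<longleftrightarrow>
     Group.group G \<and> topspace T = carrier G \<and>
     continuous_map (prod_topology T T) T (\<lambda>(x, y). x \<otimes>\<^bsub>G\<^esub> y) \<and>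
     continuous_map T T (\<lambda>x. inv\<^bsub>G\<^esub> x)"

text \<open>Points of a totally disconnected group are closed (they are connected components),
  so such a group is automatically Hausdorff.\<close>

definition totally_disconnected_space :: "'g topology \<Rightarrow> bool" where
  "totally_disconnected_space T \<longleftrightarrow> (\<forall>S. connectedin T S \<longrightarrow> (\<exists>a. S \<subseteq> {a}))"

definition central_subgroup :: "'g set \<Rightarrow> ('g, 'a) monoid_scheme \<Rightarrow> bool" where
  "central_subgroup A G \<longleftrightarrow>
     subgroup A G \<and> (\<forall>a\<in>A. \<forall>g\<in>carrier G. a \<otimes>\<^bsub>G\<^esub> g = g \<otimes>\<^bsub>G\<^esub> a)"

definition compact_open_subgroup :: "('g, 'a) monoid_scheme \<Rightarrow> 'g topology \<Rightarrow> 'g set \<Rightarrow> bool" where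
  "compact_open_subgroup G T U \<longleftrightarrow> subgroup U G \<and> compactin T U \<and> openin T U"

text \<open>A supernatural number is given by its exponents at the primes;
  the least common multiple is the pointwise supremum.\<close>

type_synonym supernat = "nat \<Rightarrow> enat"

definition supernat_of_nat :: "nat \<Rightarrow> supernat" where
  "supernat_of_nat n = (\<lambda>q. if prime q then enat (multiplicity q n) else 0)"

definition supernat_dvd :: "supernat \<Rightarrow> supernat \<Rightarrow> bool" where
  "supernat_dvd a b \<longleftrightarrow> (\<forall>q. prime q \<longrightarrow> a q \<le> b q)"

definition supernat_Lcm :: "supernat set \<Rightarrow> supernat" where
  "supernat_Lcm S = (\<lambda>q. SUP a\<in>S. a q)"

definition profinite_order :: "('g, 'a) monoid_scheme \<Rightarrow> 'g topology \<Rightarrow> supernat" where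
  "profinite_order K T =
     supernat_Lcm {supernat_of_nat (order (K Mod U)) | U. normal U K \<and> openin T U}"

definition field_char :: "('f, 'b) ring_scheme \<Rightarrow> nat" where
  "field_char F =
     (if \<exists>n::nat. n > 0 \<and> add_pow F n \<one>\<^bsub>F\<^esub> = \<zero>\<^bsub>F\<^esub>
      then LEAST n::nat. n > 0 \<and> add_pow F n \<one>\<^bsub>F\<^esub> = \<zero>\<^bsub>F\<^esub>
      else 0)"

definition ordinary :: "('f, 'b) ring_scheme \<Rightarrow> ('g, 'a) monoid_scheme \<Rightarrow> 'g topology \<Rightarrow> bool" where
  "ordinary F K T \<longleftrightarrow>
     field_char F = 0 \<or> \<not> supernat_dvd (supernat_of_nat (field_char F)) (profinite_order K T)"


section \<open>Haar measure with values in a field, and integration\<close>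

definition compact_opens :: "'g topology \<Rightarrow> 'g set set" where
  "compact_opens T = {C. compactin T C \<and> openin T C}"

definition left_haar_measure ::
  "('g, 'a) monoid_scheme \<Rightarrow> 'g topology \<Rightarrow> ('f, 'b) ring_scheme \<Rightarrow> ('g set \<Rightarrow> 'f) \<Rightarrow> bool" where
  "left_haar_measure G T F \<mu> \<longleftrightarrow>
     \<mu> \<in> compact_opens T \<rightarrow>\<^sub>E carrier F \<and>
     (\<forall>C\<in>compact_opens T. \<forall>D\<in>compact_opens T. C \<inter> D = {} \<longrightarrow> \<mu> (C \<union> D) = \<mu> C \<oplus>\<^bsub>F\<^esub> \<mu> D) \<and>
     (\<forall>g\<in>carrier G. \<forall>C\<in>compact_opens T. \<mu> (g <#\<^bsub>G\<^esub> C) = \<mu> C)"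

text \<open>If \<open>F\<close> is \<open>K\<close>-ordinary, the normalised measure exists uniquely: it sends a compact open
  \<open>C\<close> with \<open>CU = C\<close>, \<open>U\<close> an open normal subgroup of \<open>K\<close>, to the number of left cosets of \<open>U\<close>
  in \<open>C\<close> divided by the index of \<open>U\<close> in \<open>K\<close>.\<close>

definition normalised_haar ::
  "('g, 'a) monoid_scheme \<Rightarrow> 'g topology \<Rightarrow> ('f, 'b) ring_scheme \<Rightarrow> 'g set \<Rightarrow> 'g set \<Rightarrow> 'f" where
  "normalised_haar G T F K = (THE \<mu>. left_haar_measure G T F \<mu> \<and> \<mu> K = \<one>\<^bsub>F\<^esub>)"

definition locally_constant :: "'g topology \<Rightarrow> ('g \<Rightarrow> 'v) \<Rightarrow> bool" where
  "locally_constant T f \<longleftrightarrow> (\<forall>x\<in>topspace T. \<exists>U. openin T U \<and> x \<in> U \<and> (\<forall>y\<in>U. f y = f x))"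

definition compactly_supported :: "'g topology \<Rightarrow> 'v \<Rightarrow> ('g \<Rightarrow> 'v) \<Rightarrow> bool" where
  "compactly_supported T z f \<longleftrightarrow> compactin T (T closure_of {x \<in> topspace T. f x \<noteq> z})"

text \<open>A compactly supported locally constant function with values in an \<open>F\<close>-module has finite
  image and compact open fibres over nonzero values, so its integral is this finite sum.\<close>

definition haar_integral ::
  "('g, 'a) monoid_scheme \<Rightarrow> ('f, 'v, 'c) module_scheme \<Rightarrow> ('g set \<Rightarrow> 'f) \<Rightarrow> ('g \<Rightarrow> 'v) \<Rightarrow> 'v" where
  "haar_integral G M \<mu> f =
     (\<Oplus>\<^bsub>M\<^esub>v \<in> f ` carrier G - {\<zero>\<^bsub>M\<^esub>}. \<mu> {g \<in> carrier G. f g = v} \<odot>\<^bsub>M\<^esub> v)"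

definition regular_module :: "('f, 'b) ring_scheme \<Rightarrow> ('f, 'f) module" where
  "regular_module F =
     \<lparr>carrier = carrier F, monoid.mult = monoid.mult F, one = one F, zero = zero F, add = add F,
      smult = monoid.mult F\<rparr>"


section \<open>Objects with an action by linear maps\<close>

text \<open>An \<open>F\<close>-module together with a family of operators. With \<open>'s\<close> the type of group elements
  these are representations, with \<open>'s\<close> the type of functions on the group they are modules
  over the Hecke algebra. The ring fields \<^const>\<open>monoid.mult\<close> and \<^const>\<open>one\<close> carry no
  meaning.\<close>

record ('s, 'f, 'v) acted = "('f, 'v) module" +
  act :: "'s \<Rightarrow> 'v \<Rightarrow> 'v"

definition linear_map ::
  "('f, 'b) ring_scheme \<Rightarrow> ('f, 'v, 'c) module_scheme \<Rightarrow> ('f, 'w, 'd) module_scheme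
     \<Rightarrow> ('v \<Rightarrow> 'w) \<Rightarrow> bool" where
  "linear_map F V W f \<longleftrightarrow>
     f \<in> carrier V \<rightarrow> carrier W \<and>
     (\<forall>x\<in>carrier V. \<forall>y\<in>carrier V. f (x \<oplus>\<^bsub>V\<^esub> y) = f x \<oplus>\<^bsub>W\<^esub> f y) \<and>
     (\<forall>c\<in>carrier F. \<forall>x\<in>carrier V. f (c \<odot>\<^bsub>V\<^esub> x) = c \<odot>\<^bsub>W\<^esub> f x)"

definition equivariant_maps ::
  "'s set \<Rightarrow> ('f, 'b) ring_scheme \<Rightarrow> ('s, 'f, 'v) acted \<Rightarrow> ('s, 'f, 'v) acted \<Rightarrow> ('v \<Rightarrow> 'v) set" where
  "equivariant_maps S F V W =
     {f \<in> extensional (carrier V). linear_map F V W f \<and>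
        (\<forall>s\<in>S. \<forall>x\<in>carrier V. f (act V s x) = act W s (f x))}"

definition acted_cat ::
  "'s set \<Rightarrow> ('f, 'b) ring_scheme \<Rightarrow> (('s, 'f, 'v) acted \<Rightarrow> bool)
     \<Rightarrow> (('s, 'f, 'v) acted, 'v \<Rightarrow> 'v) cat" where
  "acted_cat S F P =
     \<lparr>Obj = {V. P V},
      Hom = equivariant_maps S F,
      Ident = (\<lambda>V. \<lambda>x\<in>carrier V. x),
      Comp = (\<lambda>U V W g f. compose (carrier U) g f)\<rparr>"

definition submodule_span ::
  "('f, 'b) ring_scheme \<Rightarrow> ('f, 'v, 'c) module_scheme \<Rightarrow> 'v set \<Rightarrow> 'v set" where
  "submodule_span F M S = \<Inter>{W. Module.submodule W F M \<and> S \<subseteq> W}"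


section \<open>Smooth representations\<close>

definition representation ::
  "('g, 'a) monoid_scheme \<Rightarrow> ('f, 'b) ring_scheme \<Rightarrow> ('g, 'f, 'v) acted \<Rightarrow> bool" where
  "representation G F V \<longleftrightarrow>
     Module.module F V \<and>
     (\<forall>g\<in>carrier G. linear_map F V V (act V g)) \<and>
     (\<forall>v\<in>carrier V. act V \<one>\<^bsub>G\<^esub> v = v) \<and>
     (\<forall>g\<in>carrier G. \<forall>h\<in>carrier G. \<forall>v\<in>carrier V. act V (g \<otimes>\<^bsub>G\<^esub> h) v = act V g (act V h v))"

definition smooth_representation ::
  "('g, 'a) monoid_scheme \<Rightarrow> 'g topology \<Rightarrow> ('f, 'b) ring_scheme \<Rightarrow> ('g, 'f, 'v) acted \<Rightarrow> bool" where
  "smooth_representation G T F V \<longleftrightarrow>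
     representation G F V \<and>
     (\<forall>v\<in>carrier V. \<exists>U. compact_open_subgroup G T U \<and> (\<forall>g\<in>U. act V g v = v))"

definition smooth_reps ::
  "('g, 'a) monoid_scheme \<Rightarrow> 'g topology \<Rightarrow> ('f, 'b) ring_scheme
     \<Rightarrow> (('g, 'f, 'v) acted, 'v \<Rightarrow> 'v) cat" where
  "smooth_reps G T F = acted_cat (carrier G) F (smooth_representation G T F)"

text \<open>Submodules over the group algebra \<open>FA\<close>, i.e. \<open>A\<close>-stable subspaces.\<close>

definition stable_submodule ::
  "'g set \<Rightarrow> ('f, 'b) ring_scheme \<Rightarrow> ('g, 'f, 'v) acted \<Rightarrow> 'v set \<Rightarrow> bool" where
  "stable_submodule A F V W \<longleftrightarrow>
     Module.submodule W F V \<and> (\<forall>a\<in>A. \<forall>w\<in>W. act V a w \<in> W)"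

definition simple_submodule ::
  "'g set \<Rightarrow> ('f, 'b) ring_scheme \<Rightarrow> ('g, 'f, 'v) acted \<Rightarrow> 'v set \<Rightarrow> bool" where
  "simple_submodule A F V S \<longleftrightarrow>
     stable_submodule A F V S \<and> S \<noteq> {\<zero>\<^bsub>V\<^esub>} \<and>
     (\<forall>W. stable_submodule A F V W \<and> W \<subseteq> S \<longrightarrow> W = {\<zero>\<^bsub>V\<^esub>} \<or> W = S)"

text \<open>Semisimple means being the sum of the simple submodules. The \<open>F\<close>-span of their union
  is that sum.\<close>

definition semisimple ::
  "'g set \<Rightarrow> ('f, 'b) ring_scheme \<Rightarrow> ('g, 'f, 'v) acted \<Rightarrow> bool" where
  "semisimple A F V \<longleftrightarrow> submodule_span F V (\<Union>{S. simple_submodule A F V S}) = carrier V"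

definition semisimple_smooth_reps ::
  "('g, 'a) monoid_scheme \<Rightarrow> 'g topology \<Rightarrow> ('f, 'b) ring_scheme \<Rightarrow> 'g set
     \<Rightarrow> (('g, 'f, 'v) acted, 'v \<Rightarrow> 'v) cat" where
  "semisimple_smooth_reps G T F A = full_subcat (smooth_reps G T F) (semisimple A F)"


section \<open>The Hecke algebra and its smooth modules\<close>

definition convolution ::
  "('g, 'a) monoid_scheme \<Rightarrow> ('f, 'b) ring_scheme \<Rightarrow> ('g set \<Rightarrow> 'f) \<Rightarrow> ('g \<Rightarrow> 'f) \<Rightarrow> ('g \<Rightarrow> 'f)
     \<Rightarrow> 'g \<Rightarrow> 'f" where
  "convolution G F \<mu> \<Psi> \<Theta> =
     (\<lambda>x\<in>carrier G. haar_integral G (regular_module F) \<mu>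
        (\<lambda>y. \<Psi> y \<otimes>\<^bsub>F\<^esub> \<Theta> (inv\<^bsub>G\<^esub> y \<otimes>\<^bsub>G\<^esub> x)))"

text \<open>The algebra is not unital in general; the record field \<^const>\<open>one\<close> is never used.\<close>

definition hecke_algebra ::
  "('g, 'a) monoid_scheme \<Rightarrow> 'g topology \<Rightarrow> ('f, 'b) ring_scheme \<Rightarrow> ('g set \<Rightarrow> 'f)
     \<Rightarrow> ('f, 'g \<Rightarrow> 'f) module" where
  "hecke_algebra G T F \<mu> =
     \<lparr>carrier = {\<Theta> \<in> carrier G \<rightarrow>\<^sub>E carrier F.
        locally_constant T \<Theta> \<and> compactly_supported T \<zero>\<^bsub>F\<^esub> \<Theta>},
      monoid.mult = convolution G F \<mu>,
      one = undefined,
      zero = (\<lambda>x\<in>carrier G. \<zero>\<^bsub>F\<^esub>),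
      add = (\<lambda>\<Psi> \<Theta>. \<lambda>x\<in>carrier G. \<Psi> x \<oplus>\<^bsub>F\<^esub> \<Theta> x),
      smult = (\<lambda>c \<Theta>. \<lambda>x\<in>carrier G. c \<otimes>\<^bsub>F\<^esub> \<Theta> x)\<rparr>"

text \<open>Left modules over a possibly non-unital associative \<open>F\<close>-algebra \<open>H\<close>.\<close>

definition algebra_module ::
  "('f, 'b) ring_scheme \<Rightarrow> ('f, 's) module \<Rightarrow> ('s, 'f, 'v) acted \<Rightarrow> bool" where
  "algebra_module F H M \<longleftrightarrow>
     Module.module F M \<and>
     (\<forall>h\<in>carrier H. linear_map F M M (act M h)) \<and>
     (\<forall>h\<in>carrier H. \<forall>k\<in>carrier H. \<forall>m\<in>carrier M.
        act M (h \<oplus>\<^bsub>H\<^esub> k) m = act M h m \<oplus>\<^bsub>M\<^esub> act M k m) \<and>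
     (\<forall>c\<in>carrier F. \<forall>h\<in>carrier H. \<forall>m\<in>carrier M. act M (c \<odot>\<^bsub>H\<^esub> h) m = c \<odot>\<^bsub>M\<^esub> act M h m) \<and>
     (\<forall>h\<in>carrier H. \<forall>k\<in>carrier H. \<forall>m\<in>carrier M. act M (h \<otimes>\<^bsub>H\<^esub> k) m = act M h (act M k m))"

definition smooth_module ::
  "('f, 'b) ring_scheme \<Rightarrow> ('f, 's) module \<Rightarrow> ('s, 'f, 'v) acted \<Rightarrow> bool" where
  "smooth_module F H M \<longleftrightarrow>
     algebra_module F H M \<and>
     submodule_span F M {act M h m | h m. h \<in> carrier H \<and> m \<in> carrier M} = carrier M"

definition smooth_modules ::
  "('f, 'b) ring_scheme \<Rightarrow> ('f, 's) module \<Rightarrow> (('s, 'f, 'v) acted, 'v \<Rightarrow> 'v) cat" where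
  "smooth_modules F H = acted_cat (carrier H) F (smooth_module F H)"

text \<open>The object part of the functor from smooth representations to smooth modules.\<close>

definition integrated_rep ::
  "('g, 'a) monoid_scheme \<Rightarrow> ('g set \<Rightarrow> 'f) \<Rightarrow> ('g, 'f, 'v) acted \<Rightarrow> ('g \<Rightarrow> 'f, 'f, 'v) acted" where
  "integrated_rep G \<mu> V =
     \<lparr>carrier = carrier V, monoid.mult = monoid.mult V, one = one V, zero = zero V, add = add V,
      smult = smult V,
      act = (\<lambda>\<Theta> v. haar_integral G V \<mu> (\<lambda>g. \<Theta> g \<odot>\<^bsub>V\<^esub> act V g v))\<rparr>"

definition semisimple_smooth_modules ::
  "('g, 'a) monoid_scheme \<Rightarrow> 'g topology \<Rightarrow> ('f, 'b) ring_scheme \<Rightarrow> ('g set \<Rightarrow> 'f) \<Rightarrow> 'g set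
     \<Rightarrow> (('g \<Rightarrow> 'f, 'f, 'v) acted, 'v \<Rightarrow> 'v) cat" where
  "semisimple_smooth_modules G T F \<mu> A =
     full_subcat (smooth_modules F (hecke_algebra G T F \<mu>))
       (\<lambda>M. \<exists>V \<in> Obj (semisimple_smooth_reps G T F A).
          isomorphic (smooth_modules F (hecke_algebra G T F \<mu>)) M (integrated_rep G \<mu> V))"

end

theory Submission
  imports Defs
begin

text \<open>
  The group \<open>K\<close> is profinite, so its open normal subgroups \<open>U\<close> form a basis of neighbourhoods of \<open>1\<close>, and
  ordinariness says that their indices in \<open>K\<close> are invertible in \<open>F\<close>. Counting cosets of \<open>U\<close> gives the Haar
  measure, and the integral of a right \<open>U\<close>-invariant function is a finite sum over cosets. Let
  \<open>\<delta>\<close> be the indicator of \<open>gU\<close> divided by \<open>\<mu> U\<close>. Convolving \<open>\<delta>\<close> with a left \<open>U\<close>-invariant \<open>\<Psi>\<close>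
  translates \<open>\<Psi>\<close> by \<open>g\<close>, and on a \<open>U\<close>-fixed vector \<open>\<delta>\<close> acts as \<open>g\<close>. Hence the action of \<open>G\<close> can be
  recovered from that of the Hecke algebra: in a smooth module every vector is fixed by the idempotent of
  some \<open>U\<close>, and \<open>g\<close> is made to act on it as \<open>\<delta>\<close>. Integration and this construction do not change
  the underlying space or the maps, they are mutually inverse up to values outside \<open>G\<close>, the
  Hecke algebra and the space, and semisimplicity over \<open>A\<close> is invariant under isomorphism.
\<close>

section \<open>Modules and linear maps\<close>

text \<open>The measure is only left invariant and G need not be unimodular, so sides matter.
  Integrals become sums over left cosets xU, and the integrand must be invariant under U on the
  right; for a convolution this asks for right invariance of the first factor and left invariance of
  the second. Both come from local constancy and compact support, the left one only after
  conjugation, because a small U is normal in K but in general not in G. Every statement involves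
  finitely many functions and vectors, each with its own subgroup. Small groups are closed under
  intersection, so one U can serve all of them; in return, whatever is defined by choosing a U must
  be shown independent of it. This happens twice: for the measure of a set and for the operator
  attached to g. An object of the module category is only isomorphic to the module of a semisimple
  representation, so on the way back semisimplicity has to be carried through that
  isomorphism.\<close>

lemma linear_mapD:
  assumes "linear_map F V W f" "x \<in> carrier V"
  shows "f x \<in> carrier W"
    and "y \<in> carrier V \<Longrightarrow> f (x \<oplus>\<^bsub>V\<^esub> y) = f x \<oplus>\<^bsub>W\<^esub> f y"
    and "c \<in> carrier F \<Longrightarrow> f (c \<odot>\<^bsub>V\<^esub> x) = c \<odot>\<^bsub>W\<^esub> f x"
  using assms by (auto simp: linear_map_def)

text \<open>For records that share the linear structure and differ in the action, as
  \<open>integrated_rep\<close> and \<open>derived_rep\<close> do from their arguments.\<close>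

lemma module_cong:
  assumes "Module.module F V" "carrier W = carrier V" "zero W = zero V" "add W = add V"
    "smult W = smult V"
  shows "Module.module F W"
proof -
  interpret V: Module.module F V by fact
  show ?thesis
  proof (intro moduleI abelian_groupI V.R.is_cring)
    show "\<exists>y\<in>carrier W. y \<oplus>\<^bsub>W\<^esub> x = \<zero>\<^bsub>W\<^esub>" if "x \<in> carrier W" for x
      using that assms by (intro bexI[of _ "\<ominus>\<^bsub>V\<^esub> x"]) (auto simp: V.M.l_neg)
  qed (auto simp: assms V.M.a_assoc V.M.a_comm V.M.a_lcomm V.smult_l_distr V.smult_r_distr V.smult_assoc1)
qed

lemma (in Module.module) finsum_smult_rdistr:
  "finite A \<Longrightarrow> f \<in> A \<rightarrow> carrier R \<Longrightarrow> x \<in> carrier M \<Longrightarrow>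
    (\<Oplus>i\<in>A. f i) \<odot>\<^bsub>M\<^esub> x = (\<Oplus>\<^bsub>M\<^esub>i\<in>A. f i \<odot>\<^bsub>M\<^esub> x)"
proof (induction rule: finite_induct)
  case (insert a A)
  then have "f a \<in> carrier R" "f \<in> A \<rightarrow> carrier R"
    by auto
  moreover from this have "(\<lambda>i. f i \<odot>\<^bsub>M\<^esub> x) \<in> A \<rightarrow> carrier M"
    using insert.prems(2) by auto
  ultimately show ?case
    using insert by (simp add: smult_l_distr)
qed simp

lemma linear_map_zero:
  assumes "Module.module F V" "Module.module F W" "linear_map F V W f"
  shows "f \<zero>\<^bsub>V\<^esub> = \<zero>\<^bsub>W\<^esub>"
proof -
  interpret V: Module.module F V by fact
  interpret W: Module.module F W by fact
  have "f \<zero>\<^bsub>V\<^esub> \<in> carrier W" "f (\<zero>\<^bsub>V\<^esub> \<oplus>\<^bsub>V\<^esub> \<zero>\<^bsub>V\<^esub>) = f \<zero>\<^bsub>V\<^esub> \<oplus>\<^bsub>W\<^esub> f \<zero>\<^bsub>V\<^esub>"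
    using assms(3) V.M.zero_closed unfolding linear_map_def by blast+
  then show ?thesis
    by (metis V.M.l_zero V.M.zero_closed W.M.add.l_cancel_one')
qed

lemma linear_map_finsum:
  assumes "Module.module F V" "Module.module F W" "linear_map F V W f" "g \<in> A \<rightarrow> carrier V"
  shows "f (\<Oplus>\<^bsub>V\<^esub>a\<in>A. g a) = (\<Oplus>\<^bsub>W\<^esub>a\<in>A. f (g a))"
proof -
  interpret V: Module.module F V by fact
  interpret W: Module.module F W by fact
  have f: "f x \<in> carrier W" "f (x \<oplus>\<^bsub>V\<^esub> y) = f x \<oplus>\<^bsub>W\<^esub> f y" if "x \<in> carrier V" "y \<in> carrier V" for x y
    using assms(3) that by (auto simp: linear_map_def)
  show ?thesis
    using assms(4)
  proof (induction A rule: infinite_finite_induct)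
    case (insert a A)
    then have "g a \<in> carrier V" "g \<in> A \<rightarrow> carrier V"
      by auto
    moreover from this have "(\<lambda>a. f (g a)) \<in> A \<rightarrow> carrier W"
      using f(1) by auto
    ultimately show ?case
      using insert f by simp
  qed (simp_all add: linear_map_zero[OF assms(1-3)])
qed

lemma regular_module_simps [simp]:
  "carrier (regular_module F) = carrier F" "zero (regular_module F) = zero F"
  "add (regular_module F) = add F" "smult (regular_module F) = monoid.mult F"
  by (simp_all add: regular_module_def)

lemma finsum_regular_module [simp]: "finsum (regular_module F) f A = finsum F f A"
  by (simp add: finsum_def finprod_def)

text \<open>With scalars viewed as vectors, the integral that defines convolution is an instance of
  the integral of vector-valued functions.\<close>

lemma module_regular_module:
  assumes "cring F"
  shows "Module.module F (regular_module F)"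
proof -
  interpret F: cring F by fact
  show ?thesis
  proof (intro moduleI assms abelian_groupI)
    show "\<exists>y\<in>carrier (regular_module F). y \<oplus>\<^bsub>regular_module F\<^esub> x = \<zero>\<^bsub>regular_module F\<^esub>"
      if "x \<in> carrier (regular_module F)" for x
      using that by (intro bexI[of _ "\<ominus>\<^bsub>F\<^esub> x"]) (auto simp: F.l_neg)
  qed (auto simp: F.a_assoc F.a_comm F.a_lcomm F.l_distr F.r_distr F.m_assoc)
qed

text \<open>The carrier is itself one of the submodules in the intersection, so only one inclusion
  has content.\<close>

lemma submodule_span_eq_carrier_iff:
  assumes "Module.module F M" "S \<subseteq> carrier M"
  shows "submodule_span F M S = carrier M \<longleftrightarrow>
    (\<forall>W. Module.submodule W F M \<and> S \<subseteq> W \<longrightarrow> carrier M \<subseteq> W)"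
proof -
  have "Module.submodule (carrier M) F M"
    using assms(1) by (rule module.carrier_is_submodule)
  then have "submodule_span F M S \<subseteq> carrier M"
    using assms(2) by (auto simp: submodule_span_def)
  then show ?thesis
    unfolding submodule_span_def by blast
qed

lemma linear_map_uminus:
  assumes V: "Module.module F V" and W: "Module.module F W" and f: "linear_map F V W f"
    and x: "x \<in> carrier V"
  shows "f (\<ominus>\<^bsub>V\<^esub> x) = \<ominus>\<^bsub>W\<^esub> f x"
proof -
  interpret V: Module.module F V by fact
  interpret W: Module.module F W by fact
  have c: "f y \<in> carrier W" if "y \<in> carrier V" for y
    using f that by (auto simp: linear_map_def)
  have "f (\<ominus>\<^bsub>V\<^esub> x \<oplus>\<^bsub>V\<^esub> x) = f (\<ominus>\<^bsub>V\<^esub> x) \<oplus>\<^bsub>W\<^esub> f x"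
    using f x by (simp add: linear_map_def)
  then show ?thesis
    using linear_map_zero[OF V W f] x c by (simp add: V.M.l_neg W.M.minus_equality)
qed

lemma submodule_image:
  assumes V: "Module.module F V" and W: "Module.module F W" and f: "linear_map F V W f"
    and N: "Module.submodule N F V"
  shows "Module.submodule (f ` N) F W"
proof (rule module.submoduleI[OF W])
  interpret V: Module.module F V by fact
  interpret W: Module.module F W by fact
  note E = V.submoduleE[OF N]
  have lin: "f x \<in> carrier W" "f (x \<oplus>\<^bsub>V\<^esub> y) = f x \<oplus>\<^bsub>W\<^esub> f y" if "x \<in> N" "y \<in> N" for x y
    using linear_mapD(1,2)[OF f] that E(1) by blast+
  have sc: "f (c \<odot>\<^bsub>V\<^esub> x) = c \<odot>\<^bsub>W\<^esub> f x" if "x \<in> N" "c \<in> carrier F" for x c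
    using linear_mapD(3)[OF f] that E(1) by blast
  show "f ` N \<subseteq> carrier W"
    using lin by blast
  have "\<zero>\<^bsub>V\<^esub> \<in> N"
    using subgroup.one_closed[OF submodule.axioms(1)[OF N]] by simp
  then show "\<zero>\<^bsub>W\<^esub> \<in> f ` N"
    using linear_map_zero[OF V W f] by (metis imageI)
  show "\<ominus>\<^bsub>W\<^esub> a \<in> f ` N" if "a \<in> f ` N" for a
    using that E(1,3) linear_map_uminus[OF V W f] by (metis (no_types, lifting) image_iff subsetD)
  show "a \<oplus>\<^bsub>W\<^esub> b \<in> f ` N" if "a \<in> f ` N" "b \<in> f ` N" for a b
    using that E(5) lin(2) by (metis (no_types, lifting) image_iff)
  show "a \<odot>\<^bsub>W\<^esub> x \<in> f ` N" if "a \<in> carrier F" "x \<in> f ` N" for a x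
    using that E(4) sc by (metis (no_types, lifting) image_iff)
qed

section \<open>Equivalences between categories of spaces with an action\<close>

lemma linear_map_compose:
  assumes "Module.module F U" "linear_map F U V f" "linear_map F V W g"
  shows "linear_map F U W (compose (carrier U) g f)"
proof -
  interpret U: Module.module F U by fact
  show ?thesis
    using assms(2,3) unfolding linear_map_def by (auto simp: compose_eq Pi_iff)
qed

lemma equivariant_maps_compose:
  assumes "Module.module F U" "\<And>s. s \<in> S \<Longrightarrow> linear_map F U U (act U s)"
    and "f \<in> equivariant_maps S F U V" "g \<in> equivariant_maps S F V W"
  shows "compose (carrier U) g f \<in> equivariant_maps S F U W"
proof -
  have "act U s x \<in> carrier U" if "s \<in> S" "x \<in> carrier U" for s x
    using linear_mapD(1)[OF assms(2)] that by blast
  moreover have "f x \<in> carrier V" if "x \<in> carrier U" for x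
    using assms(3) that by (auto simp: equivariant_maps_def linear_map_def)
  ultimately show ?thesis
    using assms(3,4) linear_map_compose[OF assms(1), of V f W g]
    by (auto simp: equivariant_maps_def compose_eq)
qed

text \<open>Equality of records would be too strong for the unit and the counit:
  \<open>derived_act\<close> is controlled only at elements of G and at vectors of the space, and an
  integrated action only at elements of the Hecke algebra. The relation keeps what morphisms can
  detect.\<close>

definition same_action ::
  "'s set \<Rightarrow> ('s, 'f, 'v) acted \<Rightarrow> ('s, 'f, 'v) acted \<Rightarrow> bool" where
  "same_action S V W \<longleftrightarrow> carrier V = carrier W \<and> zero V = zero W \<and> add V = add W \<and> smult V = smult W \<and>
     (\<forall>s\<in>S. \<forall>x\<in>carrier V. act V s x = act W s x)"

lemma same_action_refl: "same_action S V V"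
  by (simp add: same_action_def)

lemma same_action_sym: "same_action S V W \<Longrightarrow> same_action S W V"
  by (auto simp: same_action_def)

lemma id_equivariant:
  assumes "Module.module F V" "\<And>s. s \<in> S \<Longrightarrow> linear_map F V V (act V s)" "same_action S V W"
  shows "(\<lambda>x\<in>carrier V. x) \<in> equivariant_maps S F V W"
proof -
  interpret V: Module.module F V by fact
  interpret W: Module.module F W
    by (rule module_cong[OF assms(1)]) (use assms(3) in \<open>auto simp: same_action_def\<close>)
  have "act V s x \<in> carrier V" if "s \<in> S" "x \<in> carrier V" for s x
    using linear_mapD(1)[OF assms(2)] that by blast
  then show ?thesis
    using assms(3) by (auto simp: equivariant_maps_def linear_map_def same_action_def)
qed

lemma equivariant_maps_ext: "f \<in> equivariant_maps S F V W \<Longrightarrow> f \<in> extensional (carrier V)"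
  by (simp add: equivariant_maps_def)

lemma equivariant_maps_closed: "f \<in> equivariant_maps S F V W \<Longrightarrow> x \<in> carrier V \<Longrightarrow> f x \<in> carrier W"
  by (auto simp: equivariant_maps_def linear_map_def)

lemma compose_id_left:
  "f \<in> equivariant_maps S F V W \<Longrightarrow> compose (carrier V) (\<lambda>x\<in>carrier W. x) f = f"
  by (rule extensionalityI[of _ "carrier V"])
    (auto simp: compose_eq equivariant_maps_closed equivariant_maps_ext)

lemma compose_id_right:
  "f \<in> equivariant_maps S F V W \<Longrightarrow> compose (carrier V) f (\<lambda>x\<in>carrier V. x) = f"
  by (rule extensionalityI[of _ "carrier V"]) (auto simp: compose_eq equivariant_maps_ext)

lemma acted_subcat_simps [simp]:
  "Obj (full_subcat (acted_cat S F P) Q) = {V. P V \<and> Q V}"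
  "Hom (full_subcat (acted_cat S F P) Q) = equivariant_maps S F"
  "Ident (full_subcat (acted_cat S F P) Q) = (\<lambda>V. \<lambda>x\<in>carrier V. x)"
  "Comp (full_subcat (acted_cat S F P) Q) = (\<lambda>U V W g f. compose (carrier U) g f)"
  by (auto simp: full_subcat_def acted_cat_def)

lemma category_acted_cat:
  assumes "\<And>V. P V \<Longrightarrow> Module.module F V \<and> (\<forall>s\<in>S. linear_map F V V (act V s))"
  shows "category (full_subcat (acted_cat S F P) Q)"
proof
  fix W X Y Z f g h
  assume "W \<in> Obj (full_subcat (acted_cat S F P) Q)"
    and "f \<in> Hom (full_subcat (acted_cat S F P) Q) W X"
    and "g \<in> Hom (full_subcat (acted_cat S F P) Q) X Y"
    and "h \<in> Hom (full_subcat (acted_cat S F P) Q) Y Z"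
  \<comment> \<open>The composite of h and g is restricted to the carrier of X, so associativity
    depends on f landing there.\<close>
  then have "f \<in> carrier W \<rightarrow> carrier X"
    by (auto simp: equivariant_maps_closed)
  then show "Comp (full_subcat (acted_cat S F P) Q) W X Z
      (Comp (full_subcat (acted_cat S F P) Q) X Y Z h g) f =
      Comp (full_subcat (acted_cat S F P) Q) W Y Z h (Comp (full_subcat (acted_cat S F P) Q) W X Y g f)"
    using compose_assoc[of f "carrier W" "carrier X" h g] by simp
qed (use assms in \<open>auto simp: id_equivariant same_action_refl compose_id_left compose_id_right
    intro!: equivariant_maps_compose\<close>)

lemma functor_between_acted_cats:
  assumes "\<And>V. P V \<Longrightarrow> Module.module F V \<and> (\<forall>s\<in>S. linear_map F V V (act V s))"
    and "\<And>V. P' V \<Longrightarrow> Module.module F V \<and> (\<forall>s\<in>S'. linear_map F V V (act V s))"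
    and "\<And>V. P V \<Longrightarrow> Q V \<Longrightarrow> P' (\<phi> V) \<and> Q' (\<phi> V)"
    and "\<And>V. carrier (\<phi> V) = carrier V"
    and "\<And>V W f. P V \<Longrightarrow> P W \<Longrightarrow> f \<in> equivariant_maps S F V W \<Longrightarrow> f \<in> equivariant_maps S' F (\<phi> V) (\<phi> W)"
  shows "functor_between (full_subcat (acted_cat S F P) Q) (full_subcat (acted_cat S' F P') Q')
    \<lparr>OMap = \<phi>, HMap = (\<lambda>V W f. f)\<rparr>"
  by (intro functor_between.intro functor_between_axioms.intro category_acted_cat) (use assms in auto)

text \<open>The carriers agree, so the restricted identity is its own inverse.\<close>

lemma isomorphism_same_action:
  assumes P: "\<And>V. P V \<Longrightarrow> Module.module F V \<and> (\<forall>s\<in>S. linear_map F V V (act V s))"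
    and VW: "P V" "P W" "same_action S V W"
  shows "isomorphism (full_subcat (acted_cat S F P) Q) V W (\<lambda>x\<in>carrier V. x)"
proof -
  have c: "carrier W = carrier V"
    using VW(3) by (simp add: same_action_def)
  have "compose (carrier V) (\<lambda>x\<in>carrier V. x) (\<lambda>x\<in>carrier V. x) = (\<lambda>x\<in>carrier V. x)"
    by (auto simp: compose_def)
  then show ?thesis
    using id_equivariant[of F V S W] id_equivariant[of F W S V] P[OF VW(1)] P[OF VW(2)]
      VW(3) same_action_sym[OF VW(3)] c
    unfolding isomorphism_def inverse_morphisms_def
    by (intro exI[of _ "\<lambda>x\<in>carrier V. x"]) simp
qed

text \<open>Both functors keep carriers and maps. Unit and counit can therefore be restricted
  identities, and naturality reduces to \<open>compose_id_left\<close> and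
  \<open>compose_id_right\<close>; what remains is the comparison of the actions.\<close>

lemma equivalent_acted_cats:
  fixes \<phi> :: "('s, 'f, 'v) acted \<Rightarrow> ('t, 'f, 'v) acted" and \<psi> :: "('t, 'f, 'v) acted \<Rightarrow> ('s, 'f, 'v) acted"
  assumes P: "\<And>V. P V \<Longrightarrow> Module.module F V \<and> (\<forall>s\<in>S. linear_map F V V (act V s))"
    and P': "\<And>V. P' V \<Longrightarrow> Module.module F V \<and> (\<forall>s\<in>S'. linear_map F V V (act V s))"
    and \<phi>: "\<And>V. P V \<Longrightarrow> Q V \<Longrightarrow> P' (\<phi> V) \<and> Q' (\<phi> V)" "\<And>V. carrier (\<phi> V) = carrier V"
      "\<And>V W f. P V \<Longrightarrow> P W \<Longrightarrow> f \<in> equivariant_maps S F V W \<Longrightarrow> f \<in> equivariant_maps S' F (\<phi> V) (\<phi> W)"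
    and \<psi>: "\<And>V. P' V \<Longrightarrow> Q' V \<Longrightarrow> P (\<psi> V) \<and> Q (\<psi> V)" "\<And>V. carrier (\<psi> V) = carrier V"
      "\<And>V W f. P' V \<Longrightarrow> P' W \<Longrightarrow> f \<in> equivariant_maps S' F V W \<Longrightarrow> f \<in> equivariant_maps S F (\<psi> V) (\<psi> W)"
    and unit: "\<And>V. P V \<Longrightarrow> same_action S V (\<psi> (\<phi> V))"
    and counit: "\<And>V. P' V \<Longrightarrow> same_action S' (\<phi> (\<psi> V)) V"
  shows "equivalent_categories (full_subcat (acted_cat S F P) Q) (full_subcat (acted_cat S' F P') Q')"
proof -
  let ?C = "full_subcat (acted_cat S F P) Q" and ?D = "full_subcat (acted_cat S' F P') Q'"
  let ?\<Phi> = "\<lparr>OMap = \<phi>, HMap = (\<lambda>V W f. f)\<rparr>" and ?\<Psi> = "\<lparr>OMap = \<psi>, HMap = (\<lambda>V W f. f)\<rparr>"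
  have "functor_between ?C ?D ?\<Phi>"
    by (rule functor_between_acted_cats) (use P P' \<phi> in auto)
  moreover have "functor_between ?D ?C ?\<Psi>"
    by (rule functor_between_acted_cats) (use P P' \<psi> in auto)
  moreover have "natural_isomorphism ?C ?C id_functor (comp_functor ?\<Psi> ?\<Phi>) (\<lambda>V. \<lambda>x\<in>carrier V. x)"
    unfolding natural_isomorphism_def
  proof (intro conjI ballI)
    show "isomorphism ?C (OMap id_functor V) (OMap (comp_functor ?\<Psi> ?\<Phi>) V) (\<lambda>x\<in>carrier V. x)"
      if "V \<in> Obj ?C" for V
      using that isomorphism_same_action[OF P] \<phi>(1) \<psi>(1) unit
      by (simp add: id_functor_def comp_functor_def)
  qed (auto simp: id_functor_def comp_functor_def \<phi>(2) \<psi>(2) compose_id_left compose_id_right)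
  moreover have "natural_isomorphism ?D ?D (comp_functor ?\<Phi> ?\<Psi>) id_functor (\<lambda>V. \<lambda>x\<in>carrier V. x)"
    unfolding natural_isomorphism_def
  proof (intro conjI ballI)
    show "isomorphism ?D (OMap (comp_functor ?\<Phi> ?\<Psi>) V) (OMap id_functor V) (\<lambda>x\<in>carrier V. x)"
      if "V \<in> Obj ?D" for V
      using that isomorphism_same_action[where V = "\<phi> (\<psi> V)" and W = V, OF P'] \<phi>(1) \<psi>(1) counit
      by (simp add: id_functor_def comp_functor_def \<phi>(2) \<psi>(2))
  qed (auto simp: id_functor_def comp_functor_def \<phi>(2) \<psi>(2) compose_id_left compose_id_right)
  ultimately show ?thesis
    unfolding equivalent_categories_def by blast
qed

section \<open>Semisimplicity under equivariant isomorphism\<close>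

lemma stable_submodule_image:
  assumes V: "Module.module F V" and W: "Module.module F W" and f: "f \<in> equivariant_maps S F V W"
    and A: "A \<subseteq> S" and N: "stable_submodule A F V N"
  shows "stable_submodule A F W (f ` N)"
proof -
  have lin: "linear_map F V W f" and eq: "\<And>s x. s \<in> S \<Longrightarrow> x \<in> carrier V \<Longrightarrow> f (act V s x) = act W s (f x)"
    using f by (auto simp: equivariant_maps_def)
  have N': "Module.submodule N F V" and NA: "\<And>a x. a \<in> A \<Longrightarrow> x \<in> N \<Longrightarrow> act V a x \<in> N"
    using N by (auto simp: stable_submodule_def)
  have "N \<subseteq> carrier V"
    using module.submoduleE(1)[OF V N'] .
  then have "act W a (f x) \<in> f ` N" if "a \<in> A" "x \<in> N" for a x
    using eq[of a x] NA[OF that] that A by (metis imageI subsetD)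
  then show ?thesis
    using submodule_image[OF V W lin N'] by (auto simp: stable_submodule_def)
qed

text \<open>An equivariant isomorphism permutes the simple submodules.\<close>

lemma semisimple_transfer:
  assumes V: "Module.module F V" and W: "Module.module F W"
    and f: "f \<in> equivariant_maps S F V W" and g: "g \<in> equivariant_maps S F W V"
    and gf: "\<And>x. x \<in> carrier V \<Longrightarrow> g (f x) = x" and fg: "\<And>x. x \<in> carrier W \<Longrightarrow> f (g x) = x"
    and A: "A \<subseteq> S" and ss: "semisimple A F W"
  shows "semisimple A F V"
proof -
  have sub: "N \<subseteq> carrier V" if "stable_submodule A F V N" for N
    using that module.submoduleE(1)[OF V] by (auto simp: stable_submodule_def)
  have subW: "N \<subseteq> carrier W" if "stable_submodule A F W N" for N
    using that module.submoduleE(1)[OF W] by (auto simp: stable_submodule_def)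
  have fgN: "f ` g ` N = N" if "N \<subseteq> carrier W" for N
    using that fg by (force simp: image_image)
  have gfN: "g ` f ` N = N" if "N \<subseteq> carrier V" for N
    using that gf by (force simp: image_image)
  have f0: "f ` {\<zero>\<^bsub>V\<^esub>} = {\<zero>\<^bsub>W\<^esub>}" and g0: "g ` {\<zero>\<^bsub>W\<^esub>} = {\<zero>\<^bsub>V\<^esub>}"
    using f g linear_map_zero V W by (auto simp: equivariant_maps_def)
  have simple: "simple_submodule A F V (g ` N)" if N: "simple_submodule A F W N" for N
  proof -
    have N': "stable_submodule A F W N" "N \<noteq> {\<zero>\<^bsub>W\<^esub>}"
        "\<And>M. stable_submodule A F W M \<Longrightarrow> M \<subseteq> N \<Longrightarrow> M = {\<zero>\<^bsub>W\<^esub>} \<or> M = N"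
      using N by (auto simp: simple_submodule_def)
    have "stable_submodule A F V (g ` N)"
      by (rule stable_submodule_image[OF W V g A N'(1)])
    moreover have "g ` N \<noteq> {\<zero>\<^bsub>V\<^esub>}"
      using fgN[OF subW[OF N'(1)]] f0 N'(2) by metis
    moreover have "M = {\<zero>\<^bsub>V\<^esub>} \<or> M = g ` N" if M: "stable_submodule A F V M" "M \<subseteq> g ` N" for M
    proof -
      have "f ` M \<subseteq> N"
        using M(2) fgN[OF subW[OF N'(1)]] by blast
      then have "f ` M = {\<zero>\<^bsub>W\<^esub>} \<or> f ` M = N"
        using N'(3)[OF stable_submodule_image[OF V W f A M(1)]] by blast
      then show ?thesis
        using gfN[OF sub[OF M(1)]] g0 by metis
    qed
    ultimately show ?thesis
      by (auto simp: simple_submodule_def)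
  qed
  have 1: "\<Union>{N. simple_submodule A F W N} \<subseteq> carrier W" "\<Union>{N. simple_submodule A F V N} \<subseteq> carrier V"
    using sub subW unfolding simple_submodule_def by blast+
  \<comment> \<open>A submodule M that contains the simple submodules of V is pushed to W. There its
    image contains all simple submodules, hence is everything by semisimplicity of W, and g brings
    this back to V.\<close>
  have "carrier V \<subseteq> M" if M: "Module.submodule M F V" "\<Union>{N. simple_submodule A F V N} \<subseteq> M" for M
  proof -
    have "N \<subseteq> f ` M" if N: "simple_submodule A F W N" for N
    proof -
      have "g ` N \<subseteq> M"
        using simple[OF N] M(2) by blast
      moreover have "N \<subseteq> carrier W"
        using N subW unfolding simple_submodule_def by blast
      ultimately show ?thesis
        using fgN by (metis image_mono)
    qed
    then have "\<Union>{N. simple_submodule A F W N} \<subseteq> f ` M"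
      by blast
    moreover have "Module.submodule (f ` M) F W"
      using f M(1) by (intro submodule_image[OF V W]) (auto simp: equivariant_maps_def)
    ultimately have "carrier W \<subseteq> f ` M"
      using ss submodule_span_eq_carrier_iff[OF W 1(1)] by (auto simp: semisimple_def)
    then have "g ` carrier W \<subseteq> M"
      using gfN[OF module.submoduleE(1)[OF V M(1)]] by blast
    moreover have "carrier V \<subseteq> g ` carrier W"
      using gf equivariant_maps_closed[OF f] by (metis image_eqI subsetI)
    ultimately show ?thesis
      by blast
  qed
  then show ?thesis
    unfolding semisimple_def submodule_span_eq_carrier_iff[OF V 1(2)] by blast
qed

section \<open>Open normal subgroups of the profinite group\<close>

no_notation subset_mset (infix "<#" 50)

text \<open>In a compact Hausdorff space two closed sets that no connected set joins are separated
  by a partition into two open sets. Here connected sets have at most one point, so the theorem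
  applies to \<open>{x}\<close> and the complement of W.\<close>

lemma compact_Hausdorff_td_clopen_basis:
  assumes "compact_space X" "Hausdorff_space X" "totally_disconnected_space X"
    and "openin X W" "x \<in> W"
  obtains C where "openin X C" "closedin X C" "x \<in> C" "C \<subseteq> W"
proof -
  have x: "x \<in> topspace X"
    using assms openin_subset by blast
  have "separated_between X {x} (topspace X - W)"
  proof (rule cut_wire_fence_theorem)
    show "closedin X {x}"
      using assms(2) x by (simp add: Hausdorff_imp_t1_space closedin_t1_singleton)
    fix C assume "connectedin X C"
    then obtain a where "C \<subseteq> {a}"
      using assms(3) unfolding totally_disconnected_space_def by blast
    with assms(5) show "disjnt C {x} \<or> disjnt C (topspace X - W)"
      by (auto simp: disjnt_iff)
  qed (use assms in auto)
  then obtain U V where UV: "openin X U" "openin X V" "U \<union> V = topspace X" "disjnt U V"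
      "x \<in> U" "topspace X - W \<subseteq> V"
    unfolding separated_between_def by auto
  then have "U = topspace X - V"
    using openin_subset by (fastforce simp: disjnt_iff)
  then have "closedin X U"
    using UV by blast
  with UV that[of U] show ?thesis
    by (fastforce simp: disjnt_iff dest: openin_subset)
qed

section \<open>Totally disconnected groups and their small subgroups\<close>

locale td_group = group G for G :: "('g, 'a) monoid_scheme" (structure) +
  fixes T :: "'g topology" and K :: "'g set"
  assumes topgroup: "topological_group G T"
    and td: "totally_disconnected_space T"
    and K: "compact_open_subgroup G T K"
begin

lemma topspace_carrier [simp]: "topspace T = carrier G"
  using topgroup by (simp add: topological_group_def)

lemma continuous_mult:
  assumes "continuous_map X T f" "continuous_map X T h"
  shows "continuous_map X T (\<lambda>x. f x \<otimes> h x)"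
proof -
  have "continuous_map X (prod_topology T T) (\<lambda>x. (f x, h x))"
    using assms by (rule continuous_map_pairedI)
  then have "continuous_map X T ((\<lambda>(x, y). x \<otimes> y) \<circ> (\<lambda>x. (f x, h x)))"
    using topgroup continuous_map_compose unfolding topological_group_def by blast
  then show ?thesis
    by (simp add: o_def)
qed

lemma continuous_inv:
  assumes "continuous_map X T f"
  shows "continuous_map X T (\<lambda>x. inv (f x))"
  using continuous_map_compose[OF assms, of T "\<lambda>x. inv x"] topgroup
  by (simp add: o_def topological_group_def)

lemma mult_inv_cancel [simp]:
  assumes "x \<in> carrier G" "y \<in> carrier G"
  shows "x \<otimes> (inv x \<otimes> y) = y" "inv x \<otimes> (x \<otimes> y) = y"
  using assms by (simp_all add: m_assoc[symmetric])

lemma openin_sub: "openin T W \<Longrightarrow> W \<subseteq> carrier G"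
  using openin_subset by fastforce

lemma subgroup_K: "subgroup K G" and compact_K: "compactin T K" and open_K: "openin T K"
  using K by (auto simp: compact_open_subgroup_def)

lemma K_sub: "K \<subseteq> carrier G"
  by (simp add: subgroup.subset subgroup_K)

lemma mem_lcoset_iff:
  assumes "U \<subseteq> carrier G" "x \<in> carrier G"
  shows "y \<in> x <# U \<longleftrightarrow> y \<in> carrier G \<and> inv x \<otimes> y \<in> U"
proof
  assume "y \<in> x <# U"
  then obtain u where "u \<in> U" "y = x \<otimes> u"
    by (auto simp: l_coset_def)
  with assms show "y \<in> carrier G \<and> inv x \<otimes> y \<in> U"
    by (auto simp: m_assoc[symmetric])
next
  assume "y \<in> carrier G \<and> inv x \<otimes> y \<in> U"
  moreover then have "y = x \<otimes> (inv x \<otimes> y)"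
    using assms by simp
  ultimately show "y \<in> x <# U"
    unfolding l_coset_def by blast
qed

lemma openin_lcoset:
  assumes "openin T U" "x \<in> carrier G"
  shows "openin T (x <# U)"
proof -
  have "x <# U = {y \<in> topspace T. inv x \<otimes> y \<in> U}"
    using mem_lcoset_iff assms openin_sub by auto
  moreover have "continuous_map T T (\<lambda>y. inv x \<otimes> y)"
    using assms by (intro continuous_mult) auto
  ultimately show ?thesis
    using assms openin_continuous_map_preimage by fastforce
qed

lemma compactin_lcoset:
  assumes "compactin T C" "x \<in> carrier G"
  shows "compactin T (x <# C)"
proof -
  have "continuous_map T T (\<lambda>y. x \<otimes> y)"
    using assms by (intro continuous_mult) auto
  then have "compactin T ((\<lambda>y. x \<otimes> y) ` C)"
    using assms image_compactin by blast
  moreover have "(\<lambda>y. x \<otimes> y) ` C = x <# C"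
    by (auto simp: l_coset_def)
  ultimately show ?thesis
    by simp
qed

text \<open>The connected component of the unit is closed and is a single point, so the unit is
  closed. The diagonal is its preimage under (x, y) \<mapsto> inv x \<otimes> y.\<close>

lemma Hausdorff: "Hausdorff_space T"
proof -
  have 1: "closedin T {\<one>}"
  proof -
    obtain a where "connected_component_of_set T \<one> \<subseteq> {a}"
      using td connectedin_connected_component_of unfolding totally_disconnected_space_def by metis
    moreover have "\<one> \<in> connected_component_of_set T \<one>"
      using connected_component_of_refl by force
    ultimately have "connected_component_of_set T \<one> = {\<one>}"
      by auto
    then show ?thesis
      using closedin_connected_component_of by metis
  qed
  have "continuous_map (prod_topology T T) T (\<lambda>p. inv (fst p) \<otimes> snd p)"
    by (intro continuous_mult continuous_inv continuous_map_fst continuous_map_snd)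
  then have "closedin (prod_topology T T)
      {p \<in> topspace (prod_topology T T). inv (fst p) \<otimes> snd p \<in> {\<one>}}"
    using 1 closedin_continuous_map_preimage by blast
  moreover have "{p \<in> topspace (prod_topology T T). inv (fst p) \<otimes> snd p \<in> {\<one>}} =
      (\<lambda>x. (x, x)) ` topspace T"
    using inv_equality inv_inv by (fastforce simp: image_iff)
  ultimately show ?thesis
    by (simp add: Hausdorff_space_closedin_diagonal)
qed

text \<open>H is the union of the open translates xV with x in H.\<close>

lemma open_subgroupI:
  assumes "subgroup H G" "openin T V" "\<one> \<in> V" "V \<subseteq> H"
  shows "openin T H"
proof (subst openin_subopen, intro ballI)
  fix x assume x: "x \<in> H"
  then have xG: "x \<in> carrier G"
    using assms(1) subgroup.mem_carrier by metis
  have "x <# V \<subseteq> H"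
    using x assms by (auto simp: l_coset_def subgroup.m_closed)
  moreover have "x \<in> x <# V"
    using assms(3) xG by (force simp: l_coset_def)
  ultimately show "\<exists>U. openin T U \<and> x \<in> U \<and> U \<subseteq> H"
    using openin_lcoset assms(2) xG by blast
qed

text \<open>Exactly the subgroups whose indices in K enter the order of K, so that ordinariness says
  something about them. Normality in K is all that can be asked for; conjugation by other elements
  of G is handled in \<open>ex_conj_small\<close>.\<close>

definition small :: "'g set \<Rightarrow> bool" where
  "small U \<longleftrightarrow> normal U (G\<lparr>carrier := K\<rparr>) \<and> openin T U"

lemma group_K: "Group.group (G\<lparr>carrier := K\<rparr>)"
  using subgroup_K by (rule subgroup.subgroup_is_group) (rule is_group)

lemma small_sub_K: "small U \<Longrightarrow> U \<subseteq> K"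
  unfolding small_def using normal_imp_subgroup subgroup.subset by fastforce

lemma small_sub: "small U \<Longrightarrow> U \<subseteq> carrier G"
  using small_sub_K K_sub by blast

lemma small_subgroup: "small U \<Longrightarrow> subgroup U G"
  unfolding small_def using incl_subgroup[OF subgroup_K] normal_imp_subgroup by blast

lemma small_open: "small U \<Longrightarrow> openin T U"
  by (simp add: small_def)

text \<open>The complement is a union of left cosets, and these are open.\<close>

lemma open_subgroup_closed:
  assumes "subgroup U G" "openin T U"
  shows "closedin T U"
proof -
  have "carrier G - U = (\<Union>x\<in>carrier G - U. x <# U)"
  proof -
    have "x <# U \<subseteq> carrier G - U" if "x \<in> carrier G - U" for x
    proof
      fix y assume "y \<in> x <# U"
      then obtain u where u: "u \<in> U" "y = x \<otimes> u"
        by (auto simp: l_coset_def)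
      have uG: "u \<in> carrier G"
        using u assms(1) subgroup.mem_carrier by metis
      have "y \<notin> U"
      proof
        assume "y \<in> U"
        then have "y \<otimes> inv u \<in> U"
          using u assms(1) by (simp add: subgroup.m_closed subgroup.m_inv_closed)
        then show False
          using that u uG by (simp add: m_assoc)
      qed
      then show "y \<in> carrier G - U"
        using that u uG by simp
    qed
    moreover have "x \<in> x <# U" if "x \<in> carrier G" for x
      using that subgroup.one_closed[OF assms(1)] by (force simp: l_coset_def)
    ultimately show ?thesis
      by blast
  qed
  then have "openin T (carrier G - U)"
    using openin_lcoset[OF assms(2)] by (metis (no_types, lifting) DiffD1 openin_Union imageE)
  then show ?thesis
    using subgroup.subset[OF assms(1)] by (simp add: closedin_def)
qed

lemma small_compact: "small U \<Longrightarrow> compactin T U"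
  using closed_compactin[OF compact_K small_sub_K open_subgroup_closed] small_subgroup small_open
  by blast

lemma small_compact_open: "small U \<Longrightarrow> compact_open_subgroup G T U"
  by (simp add: compact_open_subgroup_def small_compact small_open small_subgroup)

lemma small_normal: "small U \<Longrightarrow> k \<in> K \<Longrightarrow> u \<in> U \<Longrightarrow> k \<otimes> u \<otimes> inv k \<in> U"
  unfolding small_def
  using normal.inv_op_closed2[of U "G\<lparr>carrier := K\<rparr>" k u] m_inv_consistent[OF subgroup_K] by simp

lemma smallI:
  assumes "subgroup U G" "U \<subseteq> K" "openin T U" "\<And>k u. k \<in> K \<Longrightarrow> u \<in> U \<Longrightarrow> k \<otimes> u \<otimes> inv k \<in> U"
  shows "small U"
  unfolding small_def
proof
  show "U \<lhd> G\<lparr>carrier := K\<rparr>"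
    using assms subgroup_incl[OF assms(1) subgroup_K] m_inv_consistent[OF subgroup_K]
    by (auto simp: group.normal_inv_iff[OF group_K])
qed (rule assms)

lemma small_K: "small K"
  using subgroup_K open_K by (intro smallI) (auto simp: subgroup.m_closed subgroup.m_inv_closed)

lemma small_Int: "small U \<Longrightarrow> small V \<Longrightarrow> small (U \<inter> V)"
  by (intro smallI subgroups_Inter_pair)
    (auto simp: small_subgroup small_open small_normal dest: small_sub_K)

lemma small_one: "small U \<Longrightarrow> \<one> \<in> U"
  by (simp add: small_subgroup subgroup.one_closed)

lemma small_mult: "small U \<Longrightarrow> u \<in> U \<Longrightarrow> v \<in> U \<Longrightarrow> u \<otimes> v \<in> U"
  by (simp add: small_subgroup subgroup.m_closed)

lemma small_inv: "small U \<Longrightarrow> u \<in> U \<Longrightarrow> inv u \<in> U"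
  by (simp add: small_subgroup subgroup.m_inv_closed)

lemma small_mem: "small U \<Longrightarrow> u \<in> U \<Longrightarrow> u \<in> carrier G"
  using small_sub by blast

text \<open>The group \<open>N\<close> is the two-sided stabiliser in \<open>K\<close> of a clopen neighbourhood \<open>C\<close> of the unit;
  the tube lemma makes it open.\<close>

lemma small_basis:
  assumes W: "openin T W" "\<one> \<in> W"
  obtains U where "small U" "U \<subseteq> W"
proof -
  have "\<one> \<in> K"
    using subgroup_K by (simp add: subgroup.one_closed)
  moreover have "totally_disconnected_space (subtopology T K)"
    using td by (simp add: totally_disconnected_space_def connectedin_subtopology)
  moreover have "compact_space (subtopology T K)"
    by (simp add: compact_K compact_space_subtopology)
  moreover have "openin (subtopology T K) (K \<inter> W)"
    using W by (simp add: openin_subtopology_Int2)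
  ultimately obtain C where C: "openin (subtopology T K) C" "closedin (subtopology T K) C"
      "\<one> \<in> C" "C \<subseteq> K \<inter> W"
    using W(2) compact_Hausdorff_td_clopen_basis[of "subtopology T K" "K \<inter> W" \<one>]
      Hausdorff_space_subtopology[OF Hausdorff] by (metis IntI)
  have oC: "openin T C"
    using C(1) open_K openin_trans_full by blast
  have cC: "closedin T C"
    using C(2) closedin_trans_full open_subgroup_closed[OF subgroup_K open_K] by blast
  \<comment> \<open>Both x and y range over K so that additional factors can be absorbed into them:
    this yields closure under products and inverses and under conjugation by K. The choice x = y =
    \<one> shows that N lies in C.\<close>
  define N where "N = {g \<in> K. \<forall>x\<in>K. \<forall>y\<in>K. x \<otimes> g \<otimes> y \<in> C \<longleftrightarrow> x \<otimes> y \<in> C}"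
  have KG: "x \<in> carrier G" if "x \<in> K" for x
    using that K_sub by blast
  note Kc = subgroup.m_closed[OF subgroup_K] subgroup.m_inv_closed[OF subgroup_K]
    subgroup.one_closed[OF subgroup_K]
  have NK: "N \<subseteq> K"
    by (auto simp: N_def)
  have ND: "x \<otimes> g \<otimes> y \<in> C \<longleftrightarrow> x \<otimes> y \<in> C" if "g \<in> N" "x \<in> K" "y \<in> K" for x g y
    using that by (auto simp: N_def)
  have sub: "subgroup N G"
  proof (rule subgroupI)
    show "N \<subseteq> carrier G"
      using NK K_sub by blast
    show "N \<noteq> {}"
      using Kc(3) KG by (auto simp: N_def)
  next
    fix g assume g: "g \<in> N"
    then have gK: "g \<in> K" using NK by blast
    have "x \<otimes> inv g \<otimes> y \<in> C \<longleftrightarrow> x \<otimes> y \<in> C" if "x \<in> K" "y \<in> K" for x y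
    proof -
      have "x \<otimes> g \<otimes> (inv g \<otimes> y) = x \<otimes> y"
        using that gK KG by (simp add: m_assoc)
      moreover have "x \<otimes> (inv g \<otimes> y) = x \<otimes> inv g \<otimes> y"
        using that gK KG by (simp add: m_assoc)
      ultimately show ?thesis
        using ND[OF g, of x "inv g \<otimes> y"] that gK Kc by metis
    qed
    then show "inv g \<in> N"
      using gK Kc by (auto simp: N_def)
  next
    fix g h assume gh: "g \<in> N" "h \<in> N"
    then have ghK: "g \<in> K" "h \<in> K" using NK by blast+
    have "x \<otimes> (g \<otimes> h) \<otimes> y \<in> C \<longleftrightarrow> x \<otimes> y \<in> C" if "x \<in> K" "y \<in> K" for x y
    proof -
      have "x \<otimes> (g \<otimes> h) \<otimes> y = x \<otimes> g \<otimes> (h \<otimes> y)" "x \<otimes> (h \<otimes> y) = x \<otimes> h \<otimes> y"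
        using that ghK KG by (simp_all add: m_assoc)
      then show ?thesis
        using ND[OF gh(1), of x "h \<otimes> y"] ND[OF gh(2), of x y] that ghK Kc by metis
    qed
    then show "g \<otimes> h \<in> N"
      using ghK Kc by (auto simp: N_def)
  qed
  have norm: "k \<otimes> g \<otimes> inv k \<in> N" if "k \<in> K" "g \<in> N" for k g
  proof -
    have gK: "g \<in> K" using that NK by blast
    have "x \<otimes> (k \<otimes> g \<otimes> inv k) \<otimes> y \<in> C \<longleftrightarrow> x \<otimes> y \<in> C" if "x \<in> K" "y \<in> K" for x y
    proof -
      have "x \<otimes> (k \<otimes> g \<otimes> inv k) \<otimes> y = x \<otimes> k \<otimes> g \<otimes> (inv k \<otimes> y)" "x \<otimes> k \<otimes> (inv k \<otimes> y) = x \<otimes> y"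
        using that gK \<open>k \<in> K\<close> KG by (simp_all add: m_assoc)
      then show ?thesis
        using ND[OF \<open>g \<in> N\<close>, of "x \<otimes> k" "inv k \<otimes> y"] that \<open>k \<in> K\<close> Kc by metis
    qed
    then show ?thesis
      using gK \<open>k \<in> K\<close> Kc by (auto simp: N_def)
  qed
  have open_N: "openin T N"
  proof -
    let ?P = "prod_topology (prod_topology T T) T"
    let ?f = "\<lambda>p. fst (fst p) \<otimes> snd p \<otimes> snd (fst p)"
    let ?h = "\<lambda>p. fst (fst p) \<otimes> snd (fst p)"
    have c: "continuous_map ?P T (\<lambda>p. fst (fst p))" "continuous_map ?P T (\<lambda>p. snd (fst p))"
      using continuous_map_compose[OF continuous_map_fst continuous_map_fst, of T T T]
        continuous_map_compose[OF continuous_map_fst continuous_map_snd, of T T T]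
      by (simp_all add: o_def)
    have f: "continuous_map ?P T ?f"
      using c by (intro continuous_mult continuous_map_snd)
    have h: "continuous_map ?P T ?h"
      using c by (intro continuous_mult)
    have oC': "openin T (carrier G - C)"
      using cC by (metis closedin_def topspace_carrier)
    \<comment> \<open>Since C is clopen, the triples for which the two memberships agree form an
      open set \<open>?W\<close>. It contains the slice over K \<times> K at the unit, and
      compactness of K \<times> K thickens this slice to a neighbourhood V of the unit.\<close>
    have "openin ?P (({p \<in> topspace ?P. ?f p \<in> C} \<inter> {p \<in> topspace ?P. ?h p \<in> C}) \<union>
        ({p \<in> topspace ?P. ?f p \<in> carrier G - C} \<inter> {p \<in> topspace ?P. ?h p \<in> carrier G - C}))"
      (is "openin ?P ?W")
      by (intro openin_Un openin_Int openin_continuous_map_preimage[OF f]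
            openin_continuous_map_preimage[OF h] oC oC')
    moreover have "compactin (prod_topology T T) (K \<times> K)"
      using compact_K by (simp add: compactin_Times)
    moreover have "(K \<times> K) \<times> {\<one>} \<subseteq> ?W"
      using KG Kc oC openin_sub by auto
    ultimately obtain A V where V: "openin T V" "K \<times> K \<subseteq> A" "\<one> \<in> V" "A \<times> V \<subseteq> ?W"
      using tube_lemma_left[of "prod_topology T T" T ?W "K \<times> K" \<one>] by auto
    have "V \<inter> K \<subseteq> N"
    proof
      fix g assume g: "g \<in> V \<inter> K"
      have "((x, y), g) \<in> ?W" if "x \<in> K" "y \<in> K" for x y
        using V that g by blast
      then have "x \<otimes> g \<otimes> y \<in> C \<longleftrightarrow> x \<otimes> y \<in> C" if "x \<in> K" "y \<in> K" for x y
        using that by fastforce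
      then show "g \<in> N"
        using g by (auto simp: N_def)
    qed
    then show ?thesis
      using open_subgroupI[OF sub, of "V \<inter> K"] V Kc open_K by blast
  qed
  have "small N"
    by (rule smallI[OF sub NK open_N norm])
  moreover have "N \<subseteq> W"
  proof
    fix g assume g: "g \<in> N"
    then have "g \<in> carrier G" using NK K_sub by blast
    with ND[OF g, of \<one> \<one>] Kc have "g \<in> C"
      using C(3) by simp
    then show "g \<in> W"
      using C(4) by blast
  qed
  ultimately show ?thesis
    using that by blast
qed

section \<open>Compact open sets as finite unions of left cosets\<close>

definition saturated :: "'g set \<Rightarrow> 'g set \<Rightarrow> bool" where
  "saturated U C \<longleftrightarrow> (\<forall>x\<in>C. \<forall>u\<in>U. x \<otimes> u \<in> C)"

text \<open>For C in G and a small U these are the cosets that meet C. If C is saturated they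
  partition C, and then their number measures it.\<close>

definition lcosets_in :: "'g set \<Rightarrow> 'g set \<Rightarrow> 'g set set" where
  "lcosets_in U C = (\<lambda>x. x <# U) ` C"

definition num_cosets :: "'g set \<Rightarrow> 'g set \<Rightarrow> nat" where
  "num_cosets U C = card (lcosets_in U C)"

lemma compact_opens_sub: "C \<in> compact_opens T \<Longrightarrow> C \<subseteq> carrier G"
  by (auto simp: compact_opens_def dest: openin_sub)

lemma small_mem_compact_opens: "small U \<Longrightarrow> U \<in> compact_opens T"
  by (simp add: compact_opens_def small_compact small_open)

lemma compact_opens_lcoset: "C \<in> compact_opens T \<Longrightarrow> x \<in> carrier G \<Longrightarrow> x <# C \<in> compact_opens T"
  by (simp add: compact_opens_def openin_lcoset compactin_lcoset)

lemma compact_opens_Un: "C \<in> compact_opens T \<Longrightarrow> D \<in> compact_opens T \<Longrightarrow> C \<union> D \<in> compact_opens T"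
  by (auto simp: compact_opens_def compactin_Un)

lemma compact_opens_empty: "{} \<in> compact_opens T"
  by (simp add: compact_opens_def)

lemma lcoset_self: "small U \<Longrightarrow> x \<in> carrier G \<Longrightarrow> x \<in> x <# U"
  using small_one by (force simp: l_coset_def)

lemma lcoset_eq_iff:
  assumes "small U" "x \<in> carrier G" "y \<in> carrier G"
  shows "x <# U = y <# U \<longleftrightarrow> inv x \<otimes> y \<in> U"
  using assms mem_lcoset_iff[OF small_sub[OF assms(1)] assms(2)] lcoset_self
    l_repr_independence[OF _ assms(2) small_subgroup[OF assms(1)]] by metis

lemma lcoset_disjoint:
  assumes "small U" "x \<in> carrier G" "y \<in> carrier G" "x <# U \<noteq> y <# U"
  shows "(x <# U) \<inter> (y <# U) = {}"
  using assms l_repr_independence small_subgroup by blast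

lemma saturated_lcoset:
  assumes "small U" "V \<subseteq> U" "x \<in> carrier G"
  shows "saturated V (x <# U)"
  unfolding saturated_def
proof (intro ballI)
  fix y v assume "y \<in> x <# U" "v \<in> V"
  then obtain u where "u \<in> U" "y = x \<otimes> u" "v \<in> U"
    using assms by (auto simp: l_coset_def)
  then have "y \<otimes> v = x \<otimes> (u \<otimes> v)" "u \<otimes> v \<in> U"
    using assms small_mem small_mult by (auto simp: m_assoc)
  then show "y \<otimes> v \<in> x <# U"
    by (auto simp: l_coset_def)
qed

lemma saturated_Un: "saturated U C \<Longrightarrow> saturated U D \<Longrightarrow> saturated U (C \<union> D)"
  by (auto simp: saturated_def)

lemma saturated_mono: "saturated U C \<Longrightarrow> V \<subseteq> U \<Longrightarrow> saturated V C"
  by (auto simp: saturated_def)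

lemma saturated_translate:
  assumes "saturated U C" "C \<subseteq> carrier G" "U \<subseteq> carrier G" "g \<in> carrier G"
  shows "saturated U (g <# C)"
  unfolding saturated_def
proof (intro ballI)
  fix y u assume "y \<in> g <# C" and u: "u \<in> U"
  then obtain c where c: "c \<in> C" "y = g \<otimes> c"
    by (auto simp: l_coset_def)
  then have "y \<otimes> u = g \<otimes> (c \<otimes> u)"
    using assms u by (simp add: m_assoc subsetD)
  moreover have "c \<otimes> u \<in> C"
    using c u assms by (auto simp: saturated_def)
  ultimately show "y \<otimes> u \<in> g <# C"
    by (auto simp: l_coset_def)
qed

lemma Union_lcosets_in:
  assumes "small U" "saturated U C" "C \<subseteq> carrier G"
  shows "\<Union> (lcosets_in U C) = C"
proof
  show "\<Union> (lcosets_in U C) \<subseteq> C"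
    using assms by (auto simp: lcosets_in_def l_coset_def saturated_def)
  show "C \<subseteq> \<Union> (lcosets_in U C)"
    using assms lcoset_self by (auto simp: lcosets_in_def)
qed

lemma compact_finite_subcover:
  assumes "compactin T C" "\<And>x. x \<in> C \<Longrightarrow> small (W x)"
  obtains X where "finite X" "X \<subseteq> C" "C \<subseteq> (\<Union>x\<in>X. x <# W x)"
proof -
  have C: "C \<subseteq> carrier G"
    using assms(1) compactin_subset_topspace by fastforce
  have "\<exists>\<F>. finite \<F> \<and> \<F> \<subseteq> (\<lambda>x. x <# W x) ` C \<and> C \<subseteq> \<Union>\<F>"
  proof (rule compactinD[OF assms(1)])
    show "openin T U" if "U \<in> (\<lambda>x. x <# W x) ` C" for U
      using that C assms(2) openin_lcoset small_open by auto
    show "C \<subseteq> \<Union> ((\<lambda>x. x <# W x) ` C)"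
      using C assms(2) lcoset_self by blast
  qed
  then obtain \<F> where F: "finite \<F>" "\<F> \<subseteq> (\<lambda>x. x <# W x) ` C" "C \<subseteq> \<Union>\<F>"
    by blast
  then obtain X where "X \<subseteq> C" "finite X" "\<F> = (\<lambda>x. x <# W x) ` X"
    by (meson finite_subset_image)
  with F that show ?thesis
    by blast
qed

lemma small_finite_INT:
  assumes "finite X" "\<And>x. x \<in> X \<Longrightarrow> small (W x)"
  obtains U where "small U" "\<And>x. x \<in> X \<Longrightarrow> U \<subseteq> W x"
proof -
  have "\<exists>U. small U \<and> (\<forall>x\<in>X. U \<subseteq> W x)"
    using assms
  proof (induction rule: finite_induct)
    case empty
    then show ?case using small_K by auto
  next
    case (insert x X)
    then obtain U where "small U" "\<forall>x\<in>X. U \<subseteq> W x"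
      by auto
    then show ?case
      using insert.prems small_Int[of U "W x"] by (intro exI[of _ "U \<inter> W x"]) auto
  qed
  then show ?thesis
    using that by blast
qed

lemma small_basis_at:
  assumes "openin T V" "x \<in> V"
  obtains U where "small U" "x <# U \<subseteq> V"
proof -
  have x: "x \<in> carrier G"
    using assms openin_sub by blast
  have "openin T (inv x <# V)"
    using assms x openin_lcoset by simp
  moreover have "\<one> \<in> inv x <# V"
    using assms x by (force simp: l_coset_def)
  ultimately obtain U where U: "small U" "U \<subseteq> inv x <# V"
    using small_basis by blast
  have "x <# U \<subseteq> V"
  proof
    fix y assume "y \<in> x <# U"
    then obtain u where "u \<in> U" "y = x \<otimes> u"
      by (auto simp: l_coset_def)
    moreover from this U obtain v where "v \<in> V" "u = inv x \<otimes> v"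
      by (auto simp: l_coset_def)
    ultimately show "y \<in> V"
      using assms openin_sub x by (metis mult_inv_cancel(1) subsetD)
  qed
  with U that show ?thesis
    by blast
qed

text \<open>A Lebesgue number argument: finitely many cosets z W(z) on which f is constant cover C.
  Let U be contained in all these W(z). If x lies in z W(z), so does x \<otimes> u, even when x
  \<otimes> u leaves C.\<close>

lemma locally_constant_uniform:
  assumes C: "compactin T C"
    and f: "\<And>x. x \<in> C \<Longrightarrow> \<exists>V. openin T V \<and> x \<in> V \<and> (\<forall>y\<in>V. f y = f x)"
  obtains U where "small U" "\<And>x u. x \<in> C \<Longrightarrow> u \<in> U \<Longrightarrow> f (x \<otimes> u) = f x"
proof -
  have "\<exists>W. small W \<and> (\<forall>y \<in> x <# W. f y = f x)" if "x \<in> C" for x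
    using f[OF that] small_basis_at by (metis subsetD)
  then obtain W where W: "\<And>x. x \<in> C \<Longrightarrow> small (W x)"
      "\<And>x y. x \<in> C \<Longrightarrow> y \<in> x <# W x \<Longrightarrow> f y = f x"
    by metis
  obtain X where X: "finite X" "X \<subseteq> C" "C \<subseteq> (\<Union>x\<in>X. x <# W x)"
    using compact_finite_subcover[OF C, of W] W(1) by blast
  obtain U where U: "small U" "\<And>x. x \<in> X \<Longrightarrow> U \<subseteq> W x"
    using small_finite_INT[OF X(1), of W] W(1) X(2) by blast
  have "f (x \<otimes> u) = f x" if xu: "x \<in> C" "u \<in> U" for x u
  proof -
    obtain z where z: "z \<in> X" "x \<in> z <# W z"
      using X(3) xu(1) by blast
    have "z \<in> carrier G" "small (W z)"
      using z X(2) W(1) C compactin_subset_topspace by fastforce+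
    then have "x \<otimes> u \<in> z <# W z"
      using saturated_lcoset[of "W z" U z] U(2)[OF z(1)] z(2) xu(2) by (auto simp: saturated_def)
    then show ?thesis
      using W(2) z X(2) by (metis subsetD)
  qed
  with U(1) that show ?thesis
    by blast
qed

text \<open>Because C is open, membership in C is locally constant at the points of C, so the
  uniform statement applies to this predicate.\<close>

lemma compact_open_saturated:
  assumes "C \<in> compact_opens T"
  obtains U where "small U" "saturated U C"
proof -
  have "\<exists>V. openin T V \<and> x \<in> V \<and> (\<forall>y\<in>V. (y \<in> C) = (x \<in> C))" if "x \<in> C" for x
    using assms that by (intro exI[of _ C]) (auto simp: compact_opens_def)
  then obtain U where "small U" "\<And>x u. x \<in> C \<Longrightarrow> u \<in> U \<Longrightarrow> (x \<otimes> u \<in> C) = (x \<in> C)"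
    using assms locally_constant_uniform[of C "\<lambda>x. x \<in> C"] by (auto simp: compact_opens_def)
  then show ?thesis
    using that by (auto simp: saturated_def)
qed

lemma finite_lcosets_in:
  assumes "small U" "compactin T C"
  shows "finite (lcosets_in U C)"
proof -
  have C: "C \<subseteq> carrier G"
    using assms(2) compactin_subset_topspace by fastforce
  obtain X where X: "finite X" "X \<subseteq> C" "C \<subseteq> (\<Union>x\<in>X. x <# U)"
    using compact_finite_subcover[OF assms(2), of "\<lambda>_. U"] assms(1) by blast
  have "lcosets_in U C \<subseteq> (\<lambda>x. x <# U) ` X"
  proof
    fix S assume "S \<in> lcosets_in U C"
    then obtain c x where "c \<in> C" "S = c <# U" "x \<in> X" "c \<in> x <# U"
      using X by (auto simp: lcosets_in_def)
    then show "S \<in> (\<lambda>x. x <# U) ` X"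
      using l_repr_independence[of c x U] small_subgroup[OF assms(1)] X(2) C by blast
  qed
  with X(1) show ?thesis
    using finite_surj by blast
qed

lemma num_cosets_Un:
  assumes "small U" "C \<in> compact_opens T" "D \<in> compact_opens T" "C \<inter> D = {}"
    "saturated U C" "saturated U D"
  shows "num_cosets U (C \<union> D) = num_cosets U C + num_cosets U D"
proof -
  have "lcosets_in U C \<inter> lcosets_in U D = {}"
  proof (rule ccontr)
    assume "lcosets_in U C \<inter> lcosets_in U D \<noteq> {}"
    then obtain S where S: "S \<in> lcosets_in U C" "S \<in> lcosets_in U D"
      by blast
    then have "S \<subseteq> C" "S \<subseteq> D"
      using assms Union_lcosets_in compact_opens_sub by blast+
    moreover have "S \<noteq> {}"
      using S(1) lcoset_self[OF assms(1)] compact_opens_sub[OF assms(2)]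
      by (auto simp: lcosets_in_def)
    ultimately show False
      using assms(4) by blast
  qed
  moreover have "lcosets_in U (C \<union> D) = lcosets_in U C \<union> lcosets_in U D"
    by (auto simp: lcosets_in_def)
  ultimately show ?thesis
    using assms finite_lcosets_in by (simp add: num_cosets_def card_Un_disjoint compact_opens_def)
qed

text \<open>Left translation permutes left cosets, with translation by \<open>inv g\<close> as
  inverse. This is the source of left invariance of the measure.\<close>

lemma num_cosets_translate:
  assumes "small U" "C \<subseteq> carrier G" "g \<in> carrier G"
  shows "num_cosets U (g <# C) = num_cosets U C"
proof -
  have "lcosets_in U (g <# C) = (\<lambda>S. g <# S) ` lcosets_in U C"
  proof -
    have "g <# C = (\<lambda>x. g \<otimes> x) ` C"
      by (auto simp: l_coset_def)
    moreover have "(g \<otimes> x) <# U = g <# (x <# U)" if "x \<in> C" for x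
      using assms(2,3) that by (intro lcos_m_assoc[symmetric] small_sub[OF assms(1)]) auto
    ultimately show ?thesis
      by (simp add: lcosets_in_def image_image)
  qed
  moreover have "inj_on (\<lambda>S. g <# S) (lcosets_in U C)"
  proof (rule inj_on_inverseI[where g = "\<lambda>S. inv g <# S"])
    fix S assume "S \<in> lcosets_in U C"
    then obtain x where "x \<in> carrier G" "S = x <# U"
      using assms(2) by (auto simp: lcosets_in_def)
    then have "S \<subseteq> carrier G"
      using l_coset_subset_G small_sub[OF assms(1)] by simp
    then show "inv g <# (g <# S) = S"
      using lcos_m_assoc[of S "inv g" g] lcos_mult_one[of S] assms(3) by simp
  qed
  ultimately show ?thesis
    by (simp add: num_cosets_def card_image)
qed

lemma num_cosets_pos: "small U \<Longrightarrow> num_cosets U K > 0"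
  using finite_lcosets_in[OF _ compact_K] small_one[OF small_K]
  by (auto simp: num_cosets_def card_gt_0_iff lcosets_in_def)

text \<open>The quotient group consists of right cosets; normality in K turns them into the left
  cosets that are counted here.\<close>

lemma order_Mod:
  assumes "small U"
  shows "order (G\<lparr>carrier := K\<rparr> Mod U) = num_cosets U K"
proof -
  have "U \<lhd> G\<lparr>carrier := K\<rparr>"
    using assms by (simp add: small_def)
  then have "rcosets\<^bsub>G\<lparr>carrier := K\<rparr>\<^esub> U = lcosets_in U K"
    using normal.coset_eq[of U "G\<lparr>carrier := K\<rparr>"] by (auto simp: RCOSETS_def lcosets_in_def)
  then show ?thesis
    by (simp add: order_def FactGroup_def num_cosets_def)
qed

end

section \<open>The Haar measure\<close>

locale ordinary_td_group = td_group G T K + F: field F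
  for G :: "('g, 'a) monoid_scheme" (structure) and T K and F :: "('f, 'b) ring_scheme" +
  assumes ordinary: "ordinary F (G\<lparr>carrier := K\<rparr>) (subtopology T K)"
begin

lemma field_inv:
  assumes "a \<in> carrier F" "a \<noteq> \<zero>\<^bsub>F\<^esub>"
  shows "inv\<^bsub>F\<^esub> a \<in> carrier F" "a \<otimes>\<^bsub>F\<^esub> inv\<^bsub>F\<^esub> a = \<one>\<^bsub>F\<^esub>"
  using assms F.field_Units by auto

lemma field_inv_unique:
  assumes "a \<in> carrier F" "b \<in> carrier F" "a \<otimes>\<^bsub>F\<^esub> b = \<one>\<^bsub>F\<^esub>"
  shows "b = inv\<^bsub>F\<^esub> a" "a \<noteq> \<zero>\<^bsub>F\<^esub>" "b \<noteq> \<zero>\<^bsub>F\<^esub>"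
  using assms F.comm_inv_char by (metis, auto)

text \<open>If the index n vanished in F, the characteristic would be positive and would divide n,
  the order of a quotient of K by an open normal subgroup. It would then divide the supernatural
  order of K, against ordinariness.\<close>

lemma index_nonzero:
  assumes U: "small U"
  shows "add_pow F (num_cosets U K) \<one>\<^bsub>F\<^esub> \<noteq> \<zero>\<^bsub>F\<^esub>"
proof
  define n where "n = num_cosets U K"
  define p where "p = field_char F"
  assume "add_pow F (num_cosets U K) \<one>\<^bsub>F\<^esub> = \<zero>\<^bsub>F\<^esub>"
  then have n: "n > 0" "add_pow F n \<one>\<^bsub>F\<^esub> = \<zero>\<^bsub>F\<^esub>"
    using num_cosets_pos[OF U] by (auto simp: n_def)
  then have p_eq: "p = (LEAST n::nat. n > 0 \<and> add_pow F n \<one>\<^bsub>F\<^esub> = \<zero>\<^bsub>F\<^esub>)"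
    unfolding p_def field_char_def by (intro if_P) blast
  have p: "p > 0" "add_pow F p \<one>\<^bsub>F\<^esub> = \<zero>\<^bsub>F\<^esub>"
    using LeastI[of "\<lambda>n::nat. n > 0 \<and> add_pow F n \<one>\<^bsub>F\<^esub> = \<zero>\<^bsub>F\<^esub>" n] n p_eq by auto
  \<comment> \<open>Division with remainder: \<open>n mod p\<close> copies of one also add up to
    zero, and minimality of p forces the remainder to be 0.\<close>
  have "add_pow F n \<one>\<^bsub>F\<^esub> =
      add_pow F (p * (n div p)) \<one>\<^bsub>F\<^esub> \<oplus>\<^bsub>F\<^esub> add_pow F (n mod p) \<one>\<^bsub>F\<^esub>"
    by (simp add: F.add.nat_pow_mult)
  moreover have "add_pow F (p * (n div p)) \<one>\<^bsub>F\<^esub> = \<zero>\<^bsub>F\<^esub>"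
    using F.add.nat_pow_pow[of "\<one>\<^bsub>F\<^esub>" "n div p" p] p by simp
  ultimately have "add_pow F (n mod p) \<one>\<^bsub>F\<^esub> = \<zero>\<^bsub>F\<^esub>"
    using n by simp
  then have "n mod p = 0"
    using p p_eq not_less_Least mod_less_divisor by (metis (mono_tags, lifting) gr0I)
  then have dvd: "p dvd n"
    by auto
  have "supernat_dvd (supernat_of_nat p) (profinite_order (G\<lparr>carrier := K\<rparr>) (subtopology T K))"
    unfolding supernat_dvd_def
  proof (intro allI impI)
    fix q :: nat assume q: "prime q"
    have "supernat_of_nat p q \<le> supernat_of_nat n q"
      using q dvd n by (simp add: supernat_of_nat_def dvd_imp_multiplicity_le)
    also have "\<dots> \<le> profinite_order (G\<lparr>carrier := K\<rparr>) (subtopology T K) q"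
      unfolding profinite_order_def supernat_Lcm_def
    proof (rule SUP_upper)
      have "openin (subtopology T K) U"
        using U small_sub_K small_open open_K by (simp add: openin_open_subtopology)
      then show "supernat_of_nat n \<in> {supernat_of_nat (order (G\<lparr>carrier := K\<rparr> Mod U)) |U.
          U \<lhd> G\<lparr>carrier := K\<rparr> \<and> openin (subtopology T K) U}"
        using U unfolding n_def order_Mod[OF U, symmetric] small_def by blast
    qed
    finally show "supernat_of_nat p q \<le> profinite_order (G\<lparr>carrier := K\<rparr>) (subtopology T K) q" .
  qed
  then show False
    using ordinary p by (auto simp: ordinary_def p_def)
qed

text \<open>The restriction to V-saturated sets allows for two uses. \<open>coset_measure V\<close>
  is shown to be additive only on such sets, while for V = {} the restriction is vacuous and Haar
  measures are covered.\<close>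

definition invariant_content :: "'g set \<Rightarrow> ('g set \<Rightarrow> 'f) \<Rightarrow> bool" where
  "invariant_content V \<nu> \<longleftrightarrow>
     (\<forall>C\<in>compact_opens T. saturated V C \<longrightarrow> \<nu> C \<in> carrier F) \<and>
     (\<forall>C\<in>compact_opens T. \<forall>D\<in>compact_opens T. saturated V C \<and> saturated V D \<and> C \<inter> D = {} \<longrightarrow>
        \<nu> (C \<union> D) = \<nu> C \<oplus>\<^bsub>F\<^esub> \<nu> D) \<and>
     (\<forall>g\<in>carrier G. \<forall>C\<in>compact_opens T. saturated V C \<longrightarrow> \<nu> (g <# C) = \<nu> C)"

text \<open>A U-saturated C is a disjoint union of translates of U, and each of them has content
  \<open>\<nu> U\<close>. From V \<subseteq> U it follows that all these pieces are
  V-saturated.\<close>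

lemma additive_count:
  assumes U: "small U" and V: "V \<subseteq> U"
    and nu: "invariant_content V \<nu>"
    and C: "C \<in> compact_opens T" "saturated U C"
  shows "\<nu> C = add_pow F (num_cosets U C) (\<nu> U)"
proof -
  have closed: "\<nu> C \<in> carrier F" if "C \<in> compact_opens T" "saturated V C" for C
    using nu that by (simp add: invariant_content_def)
  have add: "\<nu> (C \<union> D) = \<nu> C \<oplus>\<^bsub>F\<^esub> \<nu> D"
    if "C \<in> compact_opens T" "saturated V C" "D \<in> compact_opens T" "saturated V D" "C \<inter> D = {}" for C D
    using nu that by (simp add: invariant_content_def)
  have left: "\<nu> (g <# C) = \<nu> C" if "g \<in> carrier G" "C \<in> compact_opens T" "saturated V C" for g C
    using nu that by (simp add: invariant_content_def)
  have U': "U \<in> compact_opens T" "saturated V U"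
    using U V small_mem_compact_opens small_mult by (auto simp: saturated_def subsetD)
  have nu_empty: "\<nu> {} = \<zero>\<^bsub>F\<^esub>"
  proof -
    have "\<nu> {} \<in> carrier F" "\<nu> {} \<oplus>\<^bsub>F\<^esub> \<nu> {} = \<nu> {}"
      using closed[of "{}"] add[of "{}" "{}"] by (auto simp: compact_opens_empty saturated_def)
    then show ?thesis
      using F.add.l_cancel_one by metis
  qed
  \<comment> \<open>The induction carries compact openness and saturation of the partial unions
    along, since additivity is assumed only for such sets.\<close>
  have *: "\<Union>\<S> \<in> compact_opens T \<and> saturated V (\<Union>\<S>) \<and> \<nu> (\<Union>\<S>) = add_pow F (card \<S>) (\<nu> U)"
    if "finite \<S>" "\<S> \<subseteq> lcosets_in U (carrier G)" for \<S>
    using that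
  proof (induction rule: finite_induct)
    case empty
    then show ?case
      by (simp add: compact_opens_empty saturated_def nu_empty)
  next
    case (insert S \<S>)
    then obtain x where x: "x \<in> carrier G" "S = x <# U"
      by (auto simp: lcosets_in_def)
    have S: "S \<in> compact_opens T" "saturated V S" "\<nu> S = \<nu> U"
      using x U U' V left compact_opens_lcoset saturated_lcoset by auto
    have "S \<inter> \<Union>\<S> = {}"
    proof -
      have "S \<inter> R = {}" if R: "R \<in> \<S>" for R
      proof -
        obtain y where "y \<in> carrier G" "R = y <# U"
          using R insert.prems by (auto simp: lcosets_in_def)
        moreover have "S \<noteq> R"
          using R insert.hyps by blast
        ultimately show ?thesis
          using lcoset_disjoint[OF U x(1)] x(2) by blast
      qed
      then show ?thesis
        by blast
    qed
    then have "\<nu> (S \<union> \<Union>\<S>) = \<nu> U \<oplus>\<^bsub>F\<^esub> add_pow F (card \<S>) (\<nu> U)"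
      using add[of S "\<Union>\<S>"] S insert by simp
    also have "\<dots> = add_pow F (Suc (card \<S>)) (\<nu> U)"
      using closed[OF U'] by (simp add: F.a_comm)
    finally show ?case
      using insert S by (auto simp: compact_opens_Un saturated_Un)
  qed
  have "lcosets_in U C \<subseteq> lcosets_in U (carrier G)"
    using compact_opens_sub[OF C(1)] by (auto simp: lcosets_in_def)
  then show ?thesis
    using *[of "lcosets_in U C"] finite_lcosets_in[OF U] C Union_lcosets_in[OF U C(2)]
      compact_opens_sub[OF C(1)] by (simp add: num_cosets_def compact_opens_def)
qed

text \<open>The index of U in C divided by the index of U in K, with the division carried out in F;
  for small U this is legitimate by \<open>index_nonzero\<close>.\<close>

definition coset_measure :: "'g set \<Rightarrow> 'g set \<Rightarrow> 'f" where
  "coset_measure U C = add_pow F (num_cosets U C) (inv\<^bsub>F\<^esub> (add_pow F (num_cosets U K) \<one>\<^bsub>F\<^esub>))"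

lemma coset_measure_closed: "small U \<Longrightarrow> coset_measure U C \<in> carrier F"
  using field_inv index_nonzero by (simp add: coset_measure_def)

lemma saturated_K: "small U \<Longrightarrow> saturated U K"
  using small_mult[OF small_K] small_sub_K by (auto simp: saturated_def subsetD)

text \<open>Counting the cosets of U in K, which has content one, forces \<open>\<nu> U\<close> to
  be the inverse of the index; counting in C then forces \<open>\<nu> C\<close>.\<close>

lemma coset_measure_unique:
  assumes U: "small U" and V: "V \<subseteq> U"
    and nu: "invariant_content V \<nu>"
    and one: "\<nu> K = \<one>\<^bsub>F\<^esub>"
    and C: "C \<in> compact_opens T" "saturated U C"
  shows "\<nu> C = coset_measure U C" "\<nu> U \<noteq> \<zero>\<^bsub>F\<^esub>"
proof -
  have U': "U \<in> compact_opens T" "saturated V U"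
    using U V small_mem_compact_opens small_mult by (auto simp: saturated_def subsetD)
  have closed: "\<nu> U \<in> carrier F"
    using nu U' by (simp add: invariant_content_def)
  have "add_pow F (num_cosets U K) (\<nu> U) = \<one>\<^bsub>F\<^esub>"
    using additive_count[OF U V nu, of K] one saturated_K[OF U]
      small_mem_compact_opens[OF small_K] by simp
  then have eq: "add_pow F (num_cosets U K) \<one>\<^bsub>F\<^esub> \<otimes>\<^bsub>F\<^esub> \<nu> U = \<one>\<^bsub>F\<^esub>"
    using closed by (simp add: F.add_pow_ldistr)
  show "\<nu> U \<noteq> \<zero>\<^bsub>F\<^esub>"
    using field_inv_unique(3)[OF _ _ eq] closed by simp
  have "\<nu> U = inv\<^bsub>F\<^esub> (add_pow F (num_cosets U K) \<one>\<^bsub>F\<^esub>)"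
    using field_inv_unique(1)[OF _ _ eq] closed by simp
  then show "\<nu> C = coset_measure U C"
    using additive_count[OF U V nu C] by (simp add: coset_measure_def)
qed

lemma coset_measure_K: "small U \<Longrightarrow> coset_measure U K = \<one>\<^bsub>F\<^esub>"
  using F.add_pow_ldistr[of "\<one>\<^bsub>F\<^esub>" "inv\<^bsub>F\<^esub> (add_pow F (num_cosets U K) \<one>\<^bsub>F\<^esub>)" "num_cosets U K"]
    field_inv index_nonzero by (simp add: coset_measure_def)

lemma coset_measure_Un:
  assumes "small U" "C \<in> compact_opens T" "saturated U C" "D \<in> compact_opens T" "saturated U D"
    "C \<inter> D = {}"
  shows "coset_measure U (C \<union> D) = coset_measure U C \<oplus>\<^bsub>F\<^esub> coset_measure U D"
  using assms num_cosets_Un[of U C D] field_inv index_nonzero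
  by (simp add: coset_measure_def F.add.nat_pow_mult)

text \<open>Uniqueness for U is applied to \<open>coset_measure V\<close> itself, in place of a
  computation with the index of V in U.\<close>

lemma coset_measure_refine:
  assumes "small U" "small V" "V \<subseteq> U" "C \<in> compact_opens T" "saturated U C"
  shows "coset_measure V C = coset_measure U C"
proof (rule coset_measure_unique(1)[OF assms(1,3) _ _ assms(4,5)])
  have "coset_measure V (g <# D) = coset_measure V D" if "g \<in> carrier G" "D \<in> compact_opens T" for g D
    using that assms(2) num_cosets_translate compact_opens_sub by (simp add: coset_measure_def)
  then show "invariant_content V (coset_measure V)"
    using assms(2) coset_measure_closed coset_measure_Un by (simp add: invariant_content_def)
qed (rule coset_measure_K[OF assms(2)])

lemma coset_measure_indep:
  assumes "small U" "small V" "C \<in> compact_opens T" "saturated U C" "saturated V C"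
  shows "coset_measure U C = coset_measure V C"
  using coset_measure_refine[OF assms(1) small_Int[OF assms(1,2)] _ assms(3,4)]
    coset_measure_refine[OF assms(2) small_Int[OF assms(1,2)] _ assms(3,5)] by simp

lemma haar_eq_coset_measure:
  assumes "left_haar_measure G T F \<nu>" "\<nu> K = \<one>\<^bsub>F\<^esub>" "small U" "C \<in> compact_opens T" "saturated U C"
  shows "\<nu> C = coset_measure U C" "\<nu> U \<noteq> \<zero>\<^bsub>F\<^esub>"
proof -
  have "invariant_content {} \<nu>"
    using assms(1) unfolding left_haar_measure_def invariant_content_def by auto
  then show "\<nu> C = coset_measure U C" "\<nu> U \<noteq> \<zero>\<^bsub>F\<^esub>"
    using coset_measure_unique[of U "{}" \<nu> C] assms by auto
qed

text \<open>Each C is measured through some U that saturates it. The value does not depend on U, so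
  any two sets can be measured through a common one, where additivity is a statement about
  counting.\<close>

lemma ex_haar: "\<exists>\<nu>. left_haar_measure G T F \<nu> \<and> \<nu> K = \<one>\<^bsub>F\<^esub>"
proof -
  define \<nu> where "\<nu> = (\<lambda>C\<in>compact_opens T. coset_measure (SOME U. small U \<and> saturated U C) C)"
  have nu: "\<nu> C = coset_measure U C" if "small U" "C \<in> compact_opens T" "saturated U C" for U C
  proof -
    define V where "V = (SOME U. small U \<and> saturated U C)"
    have "small V \<and> saturated V C"
      unfolding V_def by (rule someI[of _ U]) (use that in auto)
    moreover have "\<nu> C = coset_measure V C"
      using that(2) by (simp add: \<nu>_def V_def)
    ultimately show ?thesis
      using that coset_measure_indep[of V U C] by simp
  qed
  have "\<nu> (C \<union> D) = \<nu> C \<oplus>\<^bsub>F\<^esub> \<nu> D"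
    if CD: "C \<in> compact_opens T" "D \<in> compact_opens T" "C \<inter> D = {}" for C D
  proof -
    obtain U V where UV: "small U" "saturated U C" "small V" "saturated V D"
      using compact_open_saturated CD by metis
    have UV': "small (U \<inter> V)" "saturated (U \<inter> V) C" "saturated (U \<inter> V) D"
      using UV small_Int by (auto intro: saturated_mono)
    then show ?thesis
      using nu[of "U \<inter> V"] CD coset_measure_Un compact_opens_Un saturated_Un by simp
  qed
  moreover have "\<nu> (g <# C) = \<nu> C" if "g \<in> carrier G" and C: "C \<in> compact_opens T" for g C
  proof -
    obtain U where U: "small U" "saturated U C"
      using compact_open_saturated[OF C] .
    then have "saturated U (g <# C)"
      using that compact_opens_sub small_sub by (intro saturated_translate) auto
    then show ?thesis
      using U nu that compact_opens_lcoset num_cosets_translate compact_opens_sub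
      by (simp add: coset_measure_def)
  qed
  moreover have "\<nu> \<in> compact_opens T \<rightarrow>\<^sub>E carrier F"
  proof (rule PiE_I)
    fix C assume C: "C \<in> compact_opens T"
    obtain U where "small U" "saturated U C"
      using compact_open_saturated[OF C] .
    then show "\<nu> C \<in> carrier F"
      using C nu coset_measure_closed by simp
  qed (simp add: \<nu>_def)
  moreover have "\<nu> K = \<one>\<^bsub>F\<^esub>"
    using nu[OF small_K _ saturated_K] small_K small_mem_compact_opens coset_measure_K by simp
  ultimately show ?thesis
    unfolding left_haar_measure_def by blast
qed

text \<open>The definite description is meaningful: every compact open set is saturated for some
  small U, and there the value is forced.\<close>

lemma normalised_haar:
  "left_haar_measure G T F (normalised_haar G T F K)" "normalised_haar G T F K K = \<one>\<^bsub>F\<^esub>"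
proof -
  have "\<exists>!\<nu>. left_haar_measure G T F \<nu> \<and> \<nu> K = \<one>\<^bsub>F\<^esub>"
  proof (rule ex_ex1I[OF ex_haar])
    fix \<nu> \<nu>' assume *: "left_haar_measure G T F \<nu> \<and> \<nu> K = \<one>\<^bsub>F\<^esub>"
      "left_haar_measure G T F \<nu>' \<and> \<nu>' K = \<one>\<^bsub>F\<^esub>"
    show "\<nu> = \<nu>'"
    proof (rule PiE_ext)
      show "\<nu> \<in> compact_opens T \<rightarrow>\<^sub>E carrier F" "\<nu>' \<in> compact_opens T \<rightarrow>\<^sub>E carrier F"
        using * by (auto simp: left_haar_measure_def)
      fix C assume C: "C \<in> compact_opens T"
      obtain U where "small U" "saturated U C"
        using compact_open_saturated[OF C] .
      then show "\<nu> C = \<nu>' C"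
        using * haar_eq_coset_measure(1) C by metis
    qed
  qed
  from theI'[OF this] show "left_haar_measure G T F (normalised_haar G T F K)"
    "normalised_haar G T F K K = \<one>\<^bsub>F\<^esub>"
    by (simp_all add: normalised_haar_def)
qed

end

section \<open>Integration over cosets and convolution\<close>

context ordinary_td_group begin

abbreviation haar :: "'g set \<Rightarrow> 'f" where
  "haar \<equiv> normalised_haar G T F K"

abbreviation Hecke :: "('f, 'g \<Rightarrow> 'f) module" where
  "Hecke \<equiv> hecke_algebra G T F haar"

lemma haar_closed: "C \<in> compact_opens T \<Longrightarrow> haar C \<in> carrier F"
  using normalised_haar(1) by (auto simp: left_haar_measure_def)

lemma haar_small_closed [simp]: "small U \<Longrightarrow> haar U \<in> carrier F"
  by (simp add: haar_closed small_mem_compact_opens)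

lemma haar_Un:
  "C \<in> compact_opens T \<Longrightarrow> D \<in> compact_opens T \<Longrightarrow> C \<inter> D = {} \<Longrightarrow> haar (C \<union> D) = haar C \<oplus>\<^bsub>F\<^esub> haar D"
  using normalised_haar(1) by (simp add: left_haar_measure_def)

lemma haar_translate: "g \<in> carrier G \<Longrightarrow> C \<in> compact_opens T \<Longrightarrow> haar (g <# C) = haar C"
  using normalised_haar(1) by (simp add: left_haar_measure_def)

lemma haar_empty: "haar {} = \<zero>\<^bsub>F\<^esub>"
  using haar_Un[of "{}" "{}"] haar_closed[of "{}"] compact_opens_empty F.add.l_cancel_one by simp

lemma haar_small_nonzero: "small U \<Longrightarrow> haar U \<noteq> \<zero>\<^bsub>F\<^esub>"
  using haar_eq_coset_measure(2)[OF normalised_haar _ _ saturated_K] small_K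
    small_mem_compact_opens by blast

lemma haar_inv [simp]:
  assumes "small U"
  shows "inv\<^bsub>F\<^esub> (haar U) \<in> carrier F" "haar U \<otimes>\<^bsub>F\<^esub> inv\<^bsub>F\<^esub> (haar U) = \<one>\<^bsub>F\<^esub>"
  using field_inv haar_small_nonzero assms by auto

section \<open>Integrals as finite sums over coset representatives\<close>

definition transversal :: "'g set \<Rightarrow> 'g set \<Rightarrow> bool" where
  "transversal U X \<longleftrightarrow> finite X \<and> X \<subseteq> carrier G \<and> (\<forall>x\<in>X. \<forall>y\<in>X. inv x \<otimes> y \<in> U \<longrightarrow> x = y)"

text \<open>Kept apart from \<open>transversal\<close>, which only demands finitely many pairwise
  inequivalent representatives: U may have infinite index in G, and one system of representatives
  has to serve several supports.\<close>

definition covers :: "'g set \<Rightarrow> 'g set \<Rightarrow> 'g set \<Rightarrow> bool" where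
  "covers U X S \<longleftrightarrow> (\<forall>g\<in>carrier G \<inter> S. \<exists>x\<in>X. inv x \<otimes> g \<in> U)"

definition right_invariant :: "'g set \<Rightarrow> ('g \<Rightarrow> 'v) \<Rightarrow> bool" where
  "right_invariant U f \<longleftrightarrow> (\<forall>x\<in>carrier G. \<forall>u\<in>U. f (x \<otimes> u) = f x)"

definition left_invariant :: "'g set \<Rightarrow> ('g \<Rightarrow> 'v) \<Rightarrow> bool" where
  "left_invariant U f \<longleftrightarrow> (\<forall>x\<in>carrier G. \<forall>u\<in>U. f (u \<otimes> x) = f x)"

lemma right_invariantD: "right_invariant U f \<Longrightarrow> x \<in> carrier G \<Longrightarrow> u \<in> U \<Longrightarrow> f (x \<otimes> u) = f x"
  by (simp add: right_invariant_def)

lemma right_invariant_coset: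
  assumes "right_invariant U f" "x \<in> carrier G" "g \<in> carrier G" "inv x \<otimes> g \<in> U"
  shows "f g = f x"
  using right_invariantD[OF assms(1,2,4)] assms(2,3) by simp

lemma transversal_subset: "transversal U X \<Longrightarrow> Y \<subseteq> X \<Longrightarrow> transversal U Y"
  unfolding transversal_def by (meson finite_subset subset_trans subsetD)

text \<open>Phrased as a sum of equal terms so that \<open>finsum_smult_rdistr\<close> can
  distribute it over a vector.\<close>

lemma haar_transversal:
  assumes U: "small U" and X: "transversal U X"
  shows "haar (\<Union>x\<in>X. x <# U) = (\<Oplus>\<^bsub>F\<^esub>x\<in>X. haar U)"
proof -
  have "(\<Union>x\<in>X. x <# U) \<in> compact_opens T \<and> haar (\<Union>x\<in>X. x <# U) = (\<Oplus>\<^bsub>F\<^esub>x\<in>X. haar U)"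
    if "finite X" "transversal U X" for X
    using that
  proof (induction rule: finite_induct)
    case empty
    then show ?case
      by (simp add: compact_opens_empty haar_empty)
  next
    case (insert x X)
    then have X: "transversal U X"
      using transversal_subset by blast
    have x: "x \<in> carrier G"
      using insert.prems by (simp add: transversal_def)
    have "(x <# U) \<inter> (y <# U) = {}" if y: "y \<in> X" for y
    proof -
      have "inv x \<otimes> y \<notin> U" "y \<in> carrier G"
        using insert y unfolding transversal_def by blast+
      then show ?thesis
        using lcoset_disjoint[OF U x] lcoset_eq_iff[OF U x] by blast
    qed
    then have "(x <# U) \<inter> (\<Union>x\<in>X. x <# U) = {}"
      by blast
    then show ?case
      using insert.IH[OF X] insert.hyps U x haar_Un haar_translate compact_opens_lcoset
        compact_opens_Un small_mem_compact_opens by (simp add: Pi_def)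
  qed
  then show ?thesis
    using X by (simp add: transversal_def)
qed

text \<open>The fibre of f over a nonzero value v is the disjoint union of the cosets xU with x in X
  and f x = v, so summing over values becomes summing over X. Representatives with f x zero
  contribute nothing, which is why X may reach beyond the support. Any two admissible pairs U and X
  thus give the same sum.\<close>

lemma haar_integral_eq_sum:
  assumes M: "Module.module F M" and f: "f \<in> carrier G \<rightarrow> carrier M"
    and U: "small U" "right_invariant U f"
    and X: "transversal U X" "covers U X {g. f g \<noteq> \<zero>\<^bsub>M\<^esub>}"
  shows "haar_integral G M haar f = (\<Oplus>\<^bsub>M\<^esub>x\<in>X. haar U \<odot>\<^bsub>M\<^esub> f x)"
proof -
  interpret M: Module.module F M by fact
  define A where "A v = {x \<in> X. f x = v}" for v
  define I where "I = f ` carrier G - {\<zero>\<^bsub>M\<^esub>}"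
  have XG: "X \<subseteq> carrier G" and finX: "finite X"
    using X(1) by (auto simp: transversal_def)
  note fcoset = right_invariant_coset[OF U(2)]
  have fibre: "{g \<in> carrier G. f g = v} = (\<Union>x\<in>A v. x <# U)" if v: "v \<in> I" for v
  proof
    show "{g \<in> carrier G. f g = v} \<subseteq> (\<Union>x\<in>A v. x <# U)"
    proof
      fix g assume g: "g \<in> {g \<in> carrier G. f g = v}"
      then obtain x where x: "x \<in> X" "inv x \<otimes> g \<in> U"
        using X(2) v by (auto simp: covers_def I_def)
      then have "x \<in> A v"
        using g fcoset[of x g] XG by (auto simp: A_def)
      moreover have "g \<in> x <# U"
        using x g XG mem_lcoset_iff[OF small_sub[OF U(1)]] by auto
      ultimately show "g \<in> (\<Union>x\<in>A v. x <# U)"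
        by blast
    qed
    show "(\<Union>x\<in>A v. x <# U) \<subseteq> {g \<in> carrier G. f g = v}"
    proof
      fix g assume "g \<in> (\<Union>x\<in>A v. x <# U)"
      then obtain x where x: "x \<in> X" "f x = v" "g \<in> x <# U"
        by (auto simp: A_def)
      moreover have "x \<in> carrier G"
        using x XG by blast
      ultimately show "g \<in> {g \<in> carrier G. f g = v}"
        using mem_lcoset_iff[OF small_sub[OF U(1)]] fcoset[of x g] by auto
    qed
  qed
  have IM: "I \<subseteq> carrier M"
    using f by (auto simp: I_def)
  have *: "haar {g \<in> carrier G. f g = v} \<odot>\<^bsub>M\<^esub> v = (\<Oplus>\<^bsub>M\<^esub>x\<in>A v. haar U \<odot>\<^bsub>M\<^esub> f x)" if v: "v \<in> I" for v
  proof -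
    have A: "transversal U (A v)"
      using X(1) by (rule transversal_subset) (auto simp: A_def)
    then have "haar {g \<in> carrier G. f g = v} \<odot>\<^bsub>M\<^esub> v = (\<Oplus>\<^bsub>M\<^esub>x\<in>A v. haar U \<odot>\<^bsub>M\<^esub> v)"
      using fibre[OF v] haar_transversal[OF U(1) A] v IM U(1) M.finsum_smult_rdistr[of "A v" "\<lambda>_. haar U" v]
      by (auto simp: transversal_def)
    also have "\<dots> = (\<Oplus>\<^bsub>M\<^esub>x\<in>A v. haar U \<odot>\<^bsub>M\<^esub> f x)"
      using v IM U(1) by (intro M.M.finsum_cong') (auto simp: A_def)
    finally show ?thesis .
  qed
  have fX: "f x \<in> carrier M" if "x \<in> X" for x
    using f XG that by auto
  have "I \<subseteq> f ` X"
  proof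
    fix v assume v: "v \<in> I"
    then obtain g where g: "g \<in> carrier G" "f g = v" "v \<noteq> \<zero>\<^bsub>M\<^esub>"
      by (auto simp: I_def)
    then obtain x where "x \<in> X" "inv x \<otimes> g \<in> U"
      using X(2) by (auto simp: covers_def)
    then show "v \<in> f ` X"
      using fcoset[of x g] g XG by auto
  qed
  then have finI: "finite I"
    using finX finite_surj by blast
  have "haar_integral G M haar f = (\<Oplus>\<^bsub>M\<^esub>v\<in>I. (\<Oplus>\<^bsub>M\<^esub>x\<in>A v. haar U \<odot>\<^bsub>M\<^esub> f x))"
    unfolding haar_integral_def I_def[symmetric]
    using * fX U(1) by (intro M.M.finsum_cong') (auto simp: A_def intro!: M.M.finsum_closed)
  also have "\<dots> = (\<Oplus>\<^bsub>M\<^esub>x\<in>\<Union>(A ` I). haar U \<odot>\<^bsub>M\<^esub> f x)"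
  proof (rule M.M.add.finprod_UN_disjoint[symmetric, OF finI])
    show "pairwise (\<lambda>i j. disjnt (A i) (A j)) I"
      by (auto simp: pairwise_def disjnt_def A_def)
  qed (use finX fX U(1) in \<open>auto simp: A_def\<close>)
  also have "\<dots> = (\<Oplus>\<^bsub>M\<^esub>x\<in>X. haar U \<odot>\<^bsub>M\<^esub> f x)"
  proof (rule M.M.add.finprod_mono_neutral_cong_left[OF finX])
    show "haar U \<odot>\<^bsub>M\<^esub> f x = \<zero>\<^bsub>M\<^esub>" if "x \<in> X - \<Union>(A ` I)" for x
      using that XG U(1) by (auto simp: A_def I_def)
  qed (use fX U(1) in \<open>auto simp: A_def\<close>)
  finally show ?thesis .
qed

section \<open>The Hecke algebra as a space of functions\<close>

lemma hecke_simps [simp]: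
  "zero Hecke = (\<lambda>x\<in>carrier G. \<zero>\<^bsub>F\<^esub>)"
  "add Hecke \<Psi> \<Theta> = (\<lambda>x\<in>carrier G. \<Psi> x \<oplus>\<^bsub>F\<^esub> \<Theta> x)"
  "smult Hecke c \<Theta> = (\<lambda>x\<in>carrier G. c \<otimes>\<^bsub>F\<^esub> \<Theta> x)"
  "monoid.mult Hecke = convolution G F haar"
  by (simp_all add: hecke_algebra_def)

text \<open>On the compact closure S of the support one small U works at all points. Outside S the
  function is zero, and if x \<otimes> u falls into S, going back by \<open>inv u\<close> shows that
  the values at x and x \<otimes> u agree; so the invariance holds on all of G. Conversely, compact
  sets are closed in a Hausdorff space, so the closure of the support stays in any compact set
  containing the support.\<close>

lemma hecke_carrier_iff:
  "\<Theta> \<in> carrier Hecke \<longleftrightarrow> \<Theta> \<in> carrier G \<rightarrow>\<^sub>E carrier F \<and>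
    (\<exists>U. small U \<and> right_invariant U \<Theta>) \<and>
    (\<exists>S. compactin T S \<and> {x \<in> carrier G. \<Theta> x \<noteq> \<zero>\<^bsub>F\<^esub>} \<subseteq> S)"
proof
  assume "\<Theta> \<in> carrier Hecke"
  then have *: "\<Theta> \<in> carrier G \<rightarrow>\<^sub>E carrier F" "locally_constant T \<Theta>" "compactly_supported T \<zero>\<^bsub>F\<^esub> \<Theta>"
    by (auto simp: hecke_algebra_def)
  define S where "S = T closure_of {x \<in> carrier G. \<Theta> x \<noteq> \<zero>\<^bsub>F\<^esub>}"
  have S: "compactin T S" "{x \<in> carrier G. \<Theta> x \<noteq> \<zero>\<^bsub>F\<^esub>} \<subseteq> S"
    using *(3) by (auto simp: S_def compactly_supported_def intro: closure_of_subset[THEN subsetD])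
  have SG: "S \<subseteq> carrier G"
    using S(1) compactin_subset_topspace by fastforce
  obtain U where U: "small U" "\<And>x u. x \<in> S \<Longrightarrow> u \<in> U \<Longrightarrow> \<Theta> (x \<otimes> u) = \<Theta> x"
    using locally_constant_uniform[OF S(1), of \<Theta>] *(2) SG
    by (auto simp: locally_constant_def subset_iff)
  have "right_invariant U \<Theta>"
    unfolding right_invariant_def
  proof (intro ballI)
    fix x u assume x: "x \<in> carrier G" and u: "u \<in> U"
    then have uG: "u \<in> carrier G"
      using U(1) small_mem by blast
    show "\<Theta> (x \<otimes> u) = \<Theta> x"
    proof (cases "x \<otimes> u \<in> S")
      case True
      then have "\<Theta> (x \<otimes> u \<otimes> inv u) = \<Theta> (x \<otimes> u)"
        using U u small_inv by blast
      then show ?thesis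
        using x uG by (simp add: m_assoc)
    next
      case False
      then have "\<Theta> (x \<otimes> u) = \<zero>\<^bsub>F\<^esub>"
        using S(2) x uG by blast
      moreover have "x \<in> S \<Longrightarrow> \<Theta> (x \<otimes> u) = \<Theta> x"
        using U(2) u by blast
      moreover have "x \<notin> S \<Longrightarrow> \<Theta> x = \<zero>\<^bsub>F\<^esub>"
        using S(2) x by blast
      ultimately show ?thesis
        by metis
    qed
  qed
  with * U S show "\<Theta> \<in> carrier G \<rightarrow>\<^sub>E carrier F \<and> (\<exists>U. small U \<and> right_invariant U \<Theta>) \<and>
      (\<exists>S. compactin T S \<and> {x \<in> carrier G. \<Theta> x \<noteq> \<zero>\<^bsub>F\<^esub>} \<subseteq> S)"
    by blast
next
  assume "\<Theta> \<in> carrier G \<rightarrow>\<^sub>E carrier F \<and> (\<exists>U. small U \<and> right_invariant U \<Theta>) \<and>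
      (\<exists>S. compactin T S \<and> {x \<in> carrier G. \<Theta> x \<noteq> \<zero>\<^bsub>F\<^esub>} \<subseteq> S)"
  then obtain U S where *: "\<Theta> \<in> carrier G \<rightarrow>\<^sub>E carrier F" "small U" "right_invariant U \<Theta>"
      "compactin T S" "{x \<in> carrier G. \<Theta> x \<noteq> \<zero>\<^bsub>F\<^esub>} \<subseteq> S"
    by blast
  have "locally_constant T \<Theta>"
    unfolding locally_constant_def
  proof
    fix x assume x: "x \<in> topspace T"
    then have "\<forall>y\<in>x <# U. \<Theta> y = \<Theta> x"
      using *(3) by (auto simp: l_coset_def right_invariant_def)
    moreover have "openin T (x <# U)" "x \<in> x <# U"
      using x openin_lcoset[OF small_open[OF *(2)]] lcoset_self[OF *(2)] by simp_all
    ultimately show "\<exists>V. openin T V \<and> x \<in> V \<and> (\<forall>y\<in>V. \<Theta> y = \<Theta> x)"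
      by blast
  qed
  moreover have "compactly_supported T \<zero>\<^bsub>F\<^esub> \<Theta>"
    unfolding compactly_supported_def
  proof (rule closed_compactin[OF *(4)])
    have "closedin T S"
      using *(4) Hausdorff compactin_imp_closedin by blast
    then show "T closure_of {x \<in> topspace T. \<Theta> x \<noteq> \<zero>\<^bsub>F\<^esub>} \<subseteq> S"
      using *(5) by (intro closure_of_minimal) auto
  qed simp
  ultimately show "\<Theta> \<in> carrier Hecke"
    using *(1) by (simp add: hecke_algebra_def)
qed

lemma hecke_value [simp]: "\<Theta> \<in> carrier Hecke \<Longrightarrow> x \<in> carrier G \<Longrightarrow> \<Theta> x \<in> carrier F"
  by (auto simp: hecke_carrier_iff)

lemma hecke_ext:
  assumes "\<Theta> \<in> carrier Hecke" "\<Psi> \<in> carrier Hecke" "\<And>x. x \<in> carrier G \<Longrightarrow> \<Theta> x = \<Psi> x"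
  shows "\<Theta> = \<Psi>"
  using assms by (intro PiE_ext[of _ "carrier G" "\<lambda>_. carrier F"]) (auto simp: hecke_carrier_iff)

lemma ex_transversal:
  assumes U: "small U" and S: "compactin T S"
  obtains X where "transversal U X" "covers U X S"
proof -
  have SG: "S \<subseteq> carrier G"
    using S compactin_subset_topspace by fastforce
  obtain Y where Y: "finite Y" "Y \<subseteq> S" "S \<subseteq> (\<Union>x\<in>Y. x <# U)"
    by (rule compact_finite_subcover[OF S, of "\<lambda>_. U", OF U])
  obtain X where X: "X \<subseteq> Y" "inj_on (\<lambda>x. x <# U) X" "(\<lambda>x. x <# U) ` Y = (\<lambda>x. x <# U) ` X"
    using subset_image_inj[of "(\<lambda>x. x <# U) ` Y" "\<lambda>x. x <# U" Y] by (metis subset_refl)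
  have "X \<subseteq> carrier G"
    using X(1) Y(2) SG by blast
  then have "transversal U X"
    using X Y(1) lcoset_eq_iff[OF U] finite_subset
    by (auto simp: transversal_def inj_on_def subset_iff)
  moreover have "covers U X S"
    unfolding covers_def
  proof
    fix g assume "g \<in> carrier G \<inter> S"
    then have "g \<in> (\<Union>x\<in>X. x <# U)"
      using Y(3) X(3) by blast
    then show "\<exists>x\<in>X. inv x \<otimes> g \<in> U"
      using mem_lcoset_iff[OF small_sub[OF U]] \<open>X \<subseteq> carrier G\<close> by blast
  qed
  ultimately show ?thesis
    using that by blast
qed

lemma covers_mono: "covers U X S \<Longrightarrow> carrier G \<inter> S' \<subseteq> S \<Longrightarrow> covers U X S'"
  by (auto simp: covers_def)

lemma right_invariant_mono: "right_invariant U f \<Longrightarrow> V \<subseteq> U \<Longrightarrow> right_invariant V f"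
  by (auto simp: right_invariant_def)

lemma left_invariant_mono: "left_invariant U f \<Longrightarrow> V \<subseteq> U \<Longrightarrow> left_invariant V f"
  by (auto simp: left_invariant_def)

text \<open>An element x outside K need not normalise U; continuity of conjugation at the unit takes
  the place of normality.\<close>

lemma ex_conj_small:
  assumes "small U" "x \<in> carrier G"
  obtains V where "small V" "\<And>v. v \<in> V \<Longrightarrow> inv x \<otimes> v \<otimes> x \<in> U"
proof -
  have "continuous_map T T (\<lambda>v. inv x \<otimes> v \<otimes> x)"
    using assms by (intro continuous_mult) auto
  then have "openin T {v \<in> topspace T. inv x \<otimes> v \<otimes> x \<in> U}"
    using small_open[OF assms(1)] openin_continuous_map_preimage by blast
  moreover have "\<one> \<in> {v \<in> topspace T. inv x \<otimes> v \<otimes> x \<in> U}"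
    using assms small_one by simp
  ultimately obtain V where "small V" "V \<subseteq> {v \<in> topspace T. inv x \<otimes> v \<otimes> x \<in> U}"
    using small_basis by blast
  then show ?thesis
    using that by blast
qed

text \<open>The support is covered by finitely many cosets xV, and for g in xV the identity u g = x
  (inv x u x) (inv x g) shows that u g stays in xV as soon as
  \<open>inv x \<otimes> u \<otimes> x\<close> lies in V. Finitely many such conditions on u define
  a neighbourhood of the unit.\<close>

lemma hecke_left_invariant:
  assumes "\<Theta> \<in> carrier Hecke"
  obtains U where "small U" "left_invariant U \<Theta>"
proof -
  obtain V S where V: "small V" "right_invariant V \<Theta>" and S: "compactin T S"
      "{x \<in> carrier G. \<Theta> x \<noteq> \<zero>\<^bsub>F\<^esub>} \<subseteq> S"
    using assms by (auto simp: hecke_carrier_iff)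
  obtain X where X: "transversal V X" "covers V X S"
    using ex_transversal[OF V(1) S(1)] .
  have XG: "x \<in> carrier G" if "x \<in> X" for x
    using X(1) that by (auto simp: transversal_def)
  have "\<exists>W. small W \<and> (\<forall>w\<in>W. inv x \<otimes> w \<otimes> x \<in> V)" if "x \<in> X" for x
    using ex_conj_small[OF V(1) XG[OF that]] by metis
  then obtain W where W: "\<And>x. x \<in> X \<Longrightarrow> small (W x)"
      "\<And>x w. x \<in> X \<Longrightarrow> w \<in> W x \<Longrightarrow> inv x \<otimes> w \<otimes> x \<in> V"
    by metis
  obtain U where U: "small U" "\<And>x. x \<in> X \<Longrightarrow> U \<subseteq> W x"
    using small_finite_INT[of X W] X(1) W(1) by (auto simp: transversal_def)
  have *: "\<Theta> (u \<otimes> g) = \<Theta> g" if g: "g \<in> carrier G" "\<Theta> g \<noteq> \<zero>\<^bsub>F\<^esub>" and u: "u \<in> U" for u g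
  proof -
    obtain x where x: "x \<in> X" "inv x \<otimes> g \<in> V"
      using X(2) S(2) g by (auto simp: covers_def)
    have G: "x \<in> carrier G" "u \<in> carrier G"
      using XG x U(1) u small_mem by blast+
    have "(inv x \<otimes> u \<otimes> x) \<otimes> (inv x \<otimes> g) \<in> V"
      using V(1) x W(2) U(2) u small_mult by blast
    moreover have "u \<otimes> g = x \<otimes> ((inv x \<otimes> u \<otimes> x) \<otimes> (inv x \<otimes> g))"
      using G g by (simp add: m_assoc)
    ultimately have "\<Theta> (u \<otimes> g) = \<Theta> x"
      using right_invariantD[OF V(2) G(1)] by simp
    moreover have "\<Theta> g = \<Theta> x"
      using right_invariant_coset[OF V(2) G(1) g(1) x(2)] .
    ultimately show ?thesis
      by simp
  qed
  have "left_invariant U \<Theta>"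
    unfolding left_invariant_def
  proof (intro ballI)
    fix g u assume g: "g \<in> carrier G" and u: "u \<in> U"
    have uG: "u \<in> carrier G"
      using u U(1) small_mem by blast
    show "\<Theta> (u \<otimes> g) = \<Theta> g"
    \<comment> \<open>The identity so far covers points where the function is nonzero. If it
      vanishes at g but not at u \<otimes> g, it is applied at u \<otimes> g with
      \<open>inv u\<close>.\<close>
    proof (cases "\<Theta> (u \<otimes> g) = \<zero>\<^bsub>F\<^esub>")
      case True
      then show ?thesis
        using *[OF g _ u] by (cases "\<Theta> g = \<zero>\<^bsub>F\<^esub>") simp_all
    next
      case False
      then have "\<Theta> (inv u \<otimes> (u \<otimes> g)) = \<Theta> (u \<otimes> g)"
        using *[of "u \<otimes> g" "inv u"] g uG small_inv[OF U(1) u] by simp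
      then show ?thesis
        using g uG by simp
    qed
  qed
  with U(1) that show ?thesis
    by blast
qed

lemma hecke_add_closed:
  assumes "\<Theta> \<in> carrier Hecke" "\<Psi> \<in> carrier Hecke"
  shows "\<Theta> \<oplus>\<^bsub>Hecke\<^esub> \<Psi> \<in> carrier Hecke"
proof -
  obtain U S where U: "small U" "right_invariant U \<Theta>" "compactin T S"
      "{x \<in> carrier G. \<Theta> x \<noteq> \<zero>\<^bsub>F\<^esub>} \<subseteq> S"
    using assms(1) by (auto simp: hecke_carrier_iff)
  obtain V S' where V: "small V" "right_invariant V \<Psi>" "compactin T S'"
      "{x \<in> carrier G. \<Psi> x \<noteq> \<zero>\<^bsub>F\<^esub>} \<subseteq> S'"
    using assms(2) by (auto simp: hecke_carrier_iff)
  have "right_invariant (U \<inter> V) (\<Theta> \<oplus>\<^bsub>Hecke\<^esub> \<Psi>)"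
    using U V small_mem by (auto simp: right_invariant_def)
  moreover have "compactin T (S \<union> S')"
    using U V compactin_Un by blast
  moreover have "{x \<in> carrier G. (\<Theta> \<oplus>\<^bsub>Hecke\<^esub> \<Psi>) x \<noteq> \<zero>\<^bsub>F\<^esub>} \<subseteq> S \<union> S'"
  proof
    fix x assume x: "x \<in> {x \<in> carrier G. (\<Theta> \<oplus>\<^bsub>Hecke\<^esub> \<Psi>) x \<noteq> \<zero>\<^bsub>F\<^esub>}"
    then have "\<Theta> x \<noteq> \<zero>\<^bsub>F\<^esub> \<or> \<Psi> x \<noteq> \<zero>\<^bsub>F\<^esub>"
      by auto
    with x U(4) V(4) show "x \<in> S \<union> S'"
      by blast
  qed
  moreover have "\<Theta> \<oplus>\<^bsub>Hecke\<^esub> \<Psi> \<in> carrier G \<rightarrow>\<^sub>E carrier F"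
    using assms by auto
  ultimately show ?thesis
    using small_Int[OF U(1) V(1)] unfolding hecke_carrier_iff[of "\<Theta> \<oplus>\<^bsub>Hecke\<^esub> \<Psi>"] by blast
qed

lemma hecke_smult_closed:
  assumes "c \<in> carrier F" "\<Theta> \<in> carrier Hecke"
  shows "c \<odot>\<^bsub>Hecke\<^esub> \<Theta> \<in> carrier Hecke"
proof -
  obtain U S where U: "small U" "right_invariant U \<Theta>" "compactin T S"
      "{x \<in> carrier G. \<Theta> x \<noteq> \<zero>\<^bsub>F\<^esub>} \<subseteq> S"
    using assms(2) by (auto simp: hecke_carrier_iff)
  have "right_invariant U (c \<odot>\<^bsub>Hecke\<^esub> \<Theta>)"
    using U small_mem by (auto simp: right_invariant_def)
  moreover have "{x \<in> carrier G. (c \<odot>\<^bsub>Hecke\<^esub> \<Theta>) x \<noteq> \<zero>\<^bsub>F\<^esub>} \<subseteq> S"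
    using U(4) assms(1) by auto
  moreover have "c \<odot>\<^bsub>Hecke\<^esub> \<Theta> \<in> carrier G \<rightarrow>\<^sub>E carrier F"
    using assms by auto
  ultimately show ?thesis
    using U unfolding hecke_carrier_iff[of "c \<odot>\<^bsub>Hecke\<^esub> \<Theta>"] by blast
qed

lemma hecke_zero_closed: "\<zero>\<^bsub>Hecke\<^esub> \<in> carrier Hecke"
proof -
  have "right_invariant K \<zero>\<^bsub>Hecke\<^esub>"
    using K_sub by (auto simp: right_invariant_def)
  moreover have "{x \<in> carrier G. \<zero>\<^bsub>Hecke\<^esub> x \<noteq> \<zero>\<^bsub>F\<^esub>} = {}"
    by auto
  moreover have "\<zero>\<^bsub>Hecke\<^esub> \<in> carrier G \<rightarrow>\<^sub>E carrier F"
    by auto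
  ultimately show ?thesis
    using small_K compactin_empty unfolding hecke_carrier_iff by blast
qed

lemma module_hecke: "Module.module F Hecke"
proof (intro moduleI abelian_groupI F.is_cring)
  show "\<exists>\<Psi>\<in>carrier Hecke. \<Psi> \<oplus>\<^bsub>Hecke\<^esub> \<Theta> = \<zero>\<^bsub>Hecke\<^esub>" if \<Theta>: "\<Theta> \<in> carrier Hecke" for \<Theta>
  proof
    show c: "(\<ominus>\<^bsub>F\<^esub> \<one>\<^bsub>F\<^esub>) \<odot>\<^bsub>Hecke\<^esub> \<Theta> \<in> carrier Hecke"
      using \<Theta> by (intro hecke_smult_closed) simp
    show "(\<ominus>\<^bsub>F\<^esub> \<one>\<^bsub>F\<^esub>) \<odot>\<^bsub>Hecke\<^esub> \<Theta> \<oplus>\<^bsub>Hecke\<^esub> \<Theta> = \<zero>\<^bsub>Hecke\<^esub>"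
      by (rule hecke_ext[OF hecke_add_closed[OF c \<Theta>] hecke_zero_closed])
        (use \<Theta> in \<open>simp add: F.l_minus F.l_neg\<close>)
  qed
  show "\<Theta> \<oplus>\<^bsub>Hecke\<^esub> \<Psi> = \<Psi> \<oplus>\<^bsub>Hecke\<^esub> \<Theta>" if "\<Theta> \<in> carrier Hecke" "\<Psi> \<in> carrier Hecke" for \<Theta> \<Psi>
    using that by (auto intro!: restrict_ext simp: F.a_comm)
  show "\<zero>\<^bsub>Hecke\<^esub> \<oplus>\<^bsub>Hecke\<^esub> \<Theta> = \<Theta>" if "\<Theta> \<in> carrier Hecke" for \<Theta>
    by (rule hecke_ext[OF hecke_add_closed[OF hecke_zero_closed that] that]) (use that in simp)
  show "\<one>\<^bsub>F\<^esub> \<odot>\<^bsub>Hecke\<^esub> \<Theta> = \<Theta>" if "\<Theta> \<in> carrier Hecke" for \<Theta>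
    by (rule hecke_ext[OF hecke_smult_closed[OF _ that] that]) (use that in simp_all)
  show "a \<odot>\<^bsub>Hecke\<^esub> \<Theta> \<in> carrier Hecke" if "a \<in> carrier F" "\<Theta> \<in> carrier Hecke" for a \<Theta>
    using that by (rule hecke_smult_closed)
  show "\<Theta> \<oplus>\<^bsub>Hecke\<^esub> \<Psi> \<in> carrier Hecke" if "\<Theta> \<in> carrier Hecke" "\<Psi> \<in> carrier Hecke" for \<Theta> \<Psi>
    using that by (rule hecke_add_closed)
  show "\<zero>\<^bsub>Hecke\<^esub> \<in> carrier Hecke"
    by (rule hecke_zero_closed)
qed (auto intro!: restrict_ext simp: F.a_assoc F.l_distr F.r_distr F.m_assoc)

lemma hecke_cover:
  assumes "\<Theta> \<in> carrier Hecke"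
  obtains U S where "small U" "right_invariant U \<Theta>" "compactin T S"
    "carrier G \<inter> {g. \<Theta> g \<noteq> \<zero>\<^bsub>F\<^esub>} \<subseteq> S"
proof -
  obtain U S where US: "small U" "right_invariant U \<Theta>" "compactin T S"
      "{x \<in> carrier G. \<Theta> x \<noteq> \<zero>\<^bsub>F\<^esub>} \<subseteq> S"
    using assms unfolding hecke_carrier_iff by blast
  show ?thesis
    by (rule that[OF US(1-3)]) (use US(4) in blast)
qed

text \<open>One U and one X for two functions, so that their integrals can be added term by term;
  the bound V leaves room for a subgroup that fixes given vectors.\<close>

lemma hecke_common_transversal:
  assumes "\<Theta> \<in> carrier Hecke" "\<Psi> \<in> carrier Hecke" "small V"
  obtains U X where "small U" "U \<subseteq> V" "right_invariant U \<Theta>" "right_invariant U \<Psi>"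
    "transversal U X" "covers U X {g. \<Theta> g \<noteq> \<zero>\<^bsub>F\<^esub>}" "covers U X {g. \<Psi> g \<noteq> \<zero>\<^bsub>F\<^esub>}"
proof -
  obtain U1 S1 where 1: "small U1" "right_invariant U1 \<Theta>" "compactin T S1"
      "carrier G \<inter> {g. \<Theta> g \<noteq> \<zero>\<^bsub>F\<^esub>} \<subseteq> S1"
    using hecke_cover[OF assms(1)] .
  obtain U2 S2 where 2: "small U2" "right_invariant U2 \<Psi>" "compactin T S2"
      "carrier G \<inter> {g. \<Psi> g \<noteq> \<zero>\<^bsub>F\<^esub>} \<subseteq> S2"
    using hecke_cover[OF assms(2)] .
  define U where "U = U1 \<inter> U2 \<inter> V"
  have U: "small U" "U \<subseteq> V" "U \<subseteq> U1" "U \<subseteq> U2"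
    using 1 2 assms(3) small_Int by (auto simp: U_def)
  obtain X where X: "transversal U X" "covers U X (S1 \<union> S2)"
    using ex_transversal[OF U(1) compactin_Un[OF 1(3) 2(3)]] .
  show ?thesis
    by (rule that[OF U(1,2) right_invariant_mono[OF 1(2) U(3)] right_invariant_mono[OF 2(2) U(4)] X(1)
          covers_mono[OF X(2)] covers_mono[OF X(2)]]) (use 1(4) 2(4) in auto)
qed

interpretation H: Module.module F Hecke
  by (rule module_hecke)

lemma hecke_finsum_apply:
  assumes "h \<in> X \<rightarrow> carrier Hecke" "w \<in> carrier G"
  shows "(\<Oplus>\<^bsub>Hecke\<^esub>x\<in>X. h x) w = (\<Oplus>\<^bsub>F\<^esub>x\<in>X. h x w)"
proof -
  have "linear_map F Hecke (regular_module F) (\<lambda>h. h w)"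
    using assms(2) by (auto simp: linear_map_def)
  from linear_map_finsum[OF module_hecke module_regular_module[OF F.is_cring] this assms(1)]
  show ?thesis
    by simp
qed

section \<open>Translates and normalised indicators of cosets\<close>

definition left_translate :: "'g \<Rightarrow> ('g \<Rightarrow> 'f) \<Rightarrow> 'g \<Rightarrow> 'f" where
  "left_translate g \<Theta> = (\<lambda>x\<in>carrier G. \<Theta> (inv g \<otimes> x))"

text \<open>For \<open>g = 1\<close> this is the idempotent attached to \<open>U\<close>.\<close>

definition coset_delta :: "'g \<Rightarrow> 'g set \<Rightarrow> 'g \<Rightarrow> 'f" where
  "coset_delta g U = (\<lambda>x\<in>carrier G. if inv g \<otimes> x \<in> U then inv\<^bsub>F\<^esub> (haar U) else \<zero>\<^bsub>F\<^esub>)"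

lemma left_translate_closed [simp]:
  assumes g: "g \<in> carrier G" and \<Theta>: "\<Theta> \<in> carrier Hecke"
  shows "left_translate g \<Theta> \<in> carrier Hecke"
proof -
  obtain U S where U: "small U" "right_invariant U \<Theta>" "compactin T S"
      "carrier G \<inter> {g. \<Theta> g \<noteq> \<zero>\<^bsub>F\<^esub>} \<subseteq> S"
    using hecke_cover[OF \<Theta>] .
  have "right_invariant U (left_translate g \<Theta>)"
    unfolding right_invariant_def
  proof (intro ballI)
    fix x u assume x: "x \<in> carrier G" and u: "u \<in> U"
    have uG: "u \<in> carrier G"
      using U(1) u small_mem by blast
    have "\<Theta> (inv g \<otimes> x \<otimes> u) = \<Theta> (inv g \<otimes> x)"
      using right_invariantD[OF U(2)] g x u by simp
    then show "left_translate g \<Theta> (x \<otimes> u) = left_translate g \<Theta> x"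
      using g x uG by (simp add: left_translate_def m_assoc)
  qed
  moreover have "{x \<in> carrier G. left_translate g \<Theta> x \<noteq> \<zero>\<^bsub>F\<^esub>} \<subseteq> g <# S"
  proof
    fix x assume "x \<in> {x \<in> carrier G. left_translate g \<Theta> x \<noteq> \<zero>\<^bsub>F\<^esub>}"
    then have x: "x \<in> carrier G" "inv g \<otimes> x \<in> S"
      using U(4) g by (auto simp: left_translate_def)
    then have "x = g \<otimes> (inv g \<otimes> x)"
      using g by simp
    with x(2) show "x \<in> g <# S"
      unfolding l_coset_def by blast
  qed
  moreover have "left_translate g \<Theta> \<in> carrier G \<rightarrow>\<^sub>E carrier F"
    using g \<Theta> by (auto simp: left_translate_def)
  ultimately show ?thesis
    using U(1) compactin_lcoset[OF U(3) g] unfolding hecke_carrier_iff[of "left_translate g \<Theta>"] by blast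
qed

lemma coset_delta_right_invariant:
  assumes U: "small U" and g: "g \<in> carrier G"
  shows "right_invariant U (coset_delta g U)"
  unfolding right_invariant_def
proof (intro ballI)
  fix x u assume x: "x \<in> carrier G" and u: "u \<in> U"
  have uG: "u \<in> carrier G"
    using U u small_mem by blast
  have "inv g \<otimes> x \<otimes> u \<in> U \<longleftrightarrow> inv g \<otimes> x \<in> U"
  proof
    assume "inv g \<otimes> x \<otimes> u \<in> U"
    then have "inv g \<otimes> x \<otimes> u \<otimes> inv u \<in> U"
      using U u small_mult small_inv by blast
    then show "inv g \<otimes> x \<in> U"
      using g x uG by (simp add: m_assoc)
  qed (use U u small_mult in blast)
  then show "coset_delta g U (x \<otimes> u) = coset_delta g U x"
    using g x uG by (simp add: coset_delta_def m_assoc)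
qed

lemma coset_delta_closed [simp]:
  assumes U: "small U" and g: "g \<in> carrier G"
  shows "coset_delta g U \<in> carrier Hecke"
proof -
  have "{x \<in> carrier G. coset_delta g U x \<noteq> \<zero>\<^bsub>F\<^esub>} \<subseteq> g <# U"
    using mem_lcoset_iff[OF small_sub[OF U] g] by (auto simp: coset_delta_def)
  moreover have "coset_delta g U \<in> carrier G \<rightarrow>\<^sub>E carrier F"
    using U by (auto simp: coset_delta_def)
  ultimately show ?thesis
    using U coset_delta_right_invariant[OF U g] compactin_lcoset[OF small_compact[OF U] g]
    unfolding hecke_carrier_iff[of "coset_delta g U"] by blast
qed

lemma coset_delta_left_invariant:
  assumes U: "small U"
  shows "left_invariant U (coset_delta \<one> U)"
  unfolding left_invariant_def
proof (intro ballI)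
  fix x u assume x: "x \<in> carrier G" and u: "u \<in> U"
  have uG: "u \<in> carrier G"
    using U u small_mem by blast
  have "u \<otimes> x \<in> U \<longleftrightarrow> x \<in> U"
  proof
    assume "u \<otimes> x \<in> U"
    then have "inv u \<otimes> (u \<otimes> x) \<in> U"
      using U u small_mult small_inv by blast
    then show "x \<in> U"
      using x uG by simp
  qed (use U u small_mult in blast)
  then show "coset_delta \<one> U (u \<otimes> x) = coset_delta \<one> U x"
    using x uG by (simp add: coset_delta_def)
qed

lemma left_translate_coset_delta:
  assumes "g \<in> carrier G" "h \<in> carrier G"
  shows "left_translate g (coset_delta h U) = coset_delta (g \<otimes> h) U"
  using assms by (auto simp: left_translate_def coset_delta_def inv_mult_group m_assoc intro!: restrict_ext)

lemma coset_delta_in_subgroup: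
  assumes U: "small U" and g: "g \<in> U"
  shows "coset_delta g U = coset_delta \<one> U"
proof -
  have "inv g \<otimes> x \<in> U \<longleftrightarrow> x \<in> U" if x: "x \<in> carrier G" for x
  proof
    assume "inv g \<otimes> x \<in> U"
    then have "g \<otimes> (inv g \<otimes> x) \<in> U"
      using U g small_mult by blast
    then show "x \<in> U"
      using x small_mem[OF U g] by simp
  qed (use U g small_mult small_inv in blast)
  then show ?thesis
    by (auto simp: coset_delta_def intro!: restrict_ext)
qed

text \<open>The sets xU with x in X are disjoint and cover the support, and the factor
  \<open>haar U\<close> cancels the normalisation of \<open>coset_delta\<close>. Linear statements
  about the algebra thereby reduce to these indicators.\<close>

lemma hecke_expand:
  assumes \<Theta>: "\<Theta> \<in> carrier Hecke" and U: "small U" "right_invariant U \<Theta>"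
    and X: "transversal U X" "covers U X {g. \<Theta> g \<noteq> \<zero>\<^bsub>F\<^esub>}"
  shows "(\<Oplus>\<^bsub>Hecke\<^esub>x\<in>X. (haar U \<otimes>\<^bsub>F\<^esub> \<Theta> x) \<odot>\<^bsub>Hecke\<^esub> coset_delta x U) = \<Theta>" (is "?S = _")
proof -
  have XG: "x \<in> carrier G" if "x \<in> X" for x
    using X(1) that by (auto simp: transversal_def)
  have h: "(\<lambda>x. (haar U \<otimes>\<^bsub>F\<^esub> \<Theta> x) \<odot>\<^bsub>Hecke\<^esub> coset_delta x U) \<in> X \<rightarrow> carrier Hecke"
    using XG U(1) \<Theta> by (intro Pi_I H.smult_closed coset_delta_closed) auto
  show ?thesis
  proof (rule hecke_ext[OF H.M.finsum_closed[OF h] \<Theta>])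
    fix w assume w: "w \<in> carrier G"
    have value_at: "((haar U \<otimes>\<^bsub>F\<^esub> \<Theta> x) \<odot>\<^bsub>Hecke\<^esub> coset_delta x U) w = (if inv x \<otimes> w \<in> U then \<Theta> x else \<zero>\<^bsub>F\<^esub>)"
      if "x \<in> X" for x
    proof -
      have "haar U \<otimes>\<^bsub>F\<^esub> \<Theta> x \<otimes>\<^bsub>F\<^esub> inv\<^bsub>F\<^esub> (haar U) = \<Theta> x \<otimes>\<^bsub>F\<^esub> (haar U \<otimes>\<^bsub>F\<^esub> inv\<^bsub>F\<^esub> (haar U))"
        using XG[OF that] U(1) \<Theta> by (simp add: F.m_assoc F.m_comm F.m_lcomm del: haar_inv(2))
      then show ?thesis
        using XG[OF that] w U(1) \<Theta> by (simp add: coset_delta_def)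
    qed
    have "?S w = (\<Oplus>\<^bsub>F\<^esub>x\<in>X. if inv x \<otimes> w \<in> U then \<Theta> x else \<zero>\<^bsub>F\<^esub>)"
      unfolding hecke_finsum_apply[OF h w]
      using value_at XG \<Theta> by (intro F.finsum_cong') auto
    also have "\<dots> = \<Theta> w"
    proof (cases "\<exists>x\<in>X. inv x \<otimes> w \<in> U")
      case True
      then obtain x where x: "x \<in> X" "inv x \<otimes> w \<in> U"
        by blast
      \<comment> \<open>Two representatives whose cosets contain w are equal, so a single summand
        survives.\<close>
      have iff: "inv y \<otimes> w \<in> U \<longleftrightarrow> x = y" if "y \<in> X" for y
      proof
        assume y: "inv y \<otimes> w \<in> U"
        have "inv x \<otimes> w \<otimes> inv (inv y \<otimes> w) \<in> U"
          using U(1) x(2) y small_mult small_inv by blast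
        moreover have "inv x \<otimes> w \<otimes> inv (inv y \<otimes> w) = inv x \<otimes> y"
          using w XG x(1) that by (simp add: inv_mult_group m_assoc)
        ultimately show "x = y"
          using X(1) x(1) that by (simp add: transversal_def)
      qed (use x in simp)
      have "(\<Oplus>\<^bsub>F\<^esub>y\<in>X. if inv y \<otimes> w \<in> U then \<Theta> y else \<zero>\<^bsub>F\<^esub>) = (\<Oplus>\<^bsub>F\<^esub>y\<in>X. if x = y then \<Theta> y else \<zero>\<^bsub>F\<^esub>)"
        using iff XG \<Theta> by (intro F.finsum_cong') auto
      also have "\<dots> = \<Theta> x"
        using x(1) X(1) XG \<Theta> by (intro F.finsum_singleton) (auto simp: transversal_def)
      also have "\<dots> = \<Theta> w"
        using right_invariant_coset[OF U(2) XG[OF x(1)] w x(2)] by simp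
      finally show ?thesis .
    next
      case False
      then have "\<Theta> w = \<zero>\<^bsub>F\<^esub>"
        using X(2) w by (auto simp: covers_def)
      moreover have "(\<Oplus>\<^bsub>F\<^esub>x\<in>X. if inv x \<otimes> w \<in> U then \<Theta> x else \<zero>\<^bsub>F\<^esub>) = (\<Oplus>\<^bsub>F\<^esub>x\<in>X. \<zero>\<^bsub>F\<^esub>)"
        using False by (intro F.finsum_cong') auto
      ultimately show ?thesis
        by simp
    qed
    finally show "?S w = \<Theta> w" .
  qed
qed

lemma convolution_expand:
  assumes \<Theta>: "\<Theta> \<in> carrier Hecke" and \<Psi>: "\<Psi> \<in> carrier Hecke"
    and U: "small U" "right_invariant U \<Theta>" "left_invariant U \<Psi>"
    and X: "transversal U X" "covers U X {g. \<Theta> g \<noteq> \<zero>\<^bsub>F\<^esub>}"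
  shows "\<Theta> \<otimes>\<^bsub>Hecke\<^esub> \<Psi> = (\<Oplus>\<^bsub>Hecke\<^esub>x\<in>X. (haar U \<otimes>\<^bsub>F\<^esub> \<Theta> x) \<odot>\<^bsub>Hecke\<^esub> left_translate x \<Psi>)"
    (is "_ = ?S")
proof -
  have XG: "x \<in> carrier G" if "x \<in> X" for x
    using X(1) that by (auto simp: transversal_def)
  have h: "(\<lambda>x. (haar U \<otimes>\<^bsub>F\<^esub> \<Theta> x) \<odot>\<^bsub>Hecke\<^esub> left_translate x \<Psi>) \<in> X \<rightarrow> carrier Hecke"
    using XG U(1) \<Theta> \<Psi> by (intro Pi_I H.smult_closed left_translate_closed) auto
  have S: "?S \<in> extensional (carrier G)"
    using H.M.finsum_closed[OF h] unfolding hecke_carrier_iff by (auto simp: PiE_def)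
  have "convolution G F haar \<Theta> \<Psi> = ?S"
  \<comment> \<open>Using \<open>hecke_ext\<close> would presuppose that the product lies in the
    algebra, which is a consequence of this equation; hence the comparison of extensional
    functions.\<close>
  proof (rule extensionalityI[of _ "carrier G", OF _ S])
    show "convolution G F haar \<Theta> \<Psi> \<in> extensional (carrier G)"
      by (simp add: convolution_def)
    fix w assume w: "w \<in> carrier G"
    let ?f = "\<lambda>y. \<Theta> y \<otimes>\<^bsub>F\<^esub> \<Psi> (inv y \<otimes> w)"
    have "right_invariant U ?f"
      unfolding right_invariant_def
    proof (intro ballI)
      fix y u assume y: "y \<in> carrier G" and u: "u \<in> U"
      have uG: "u \<in> carrier G"
        using U u small_mem by blast
      have "\<Psi> (inv u \<otimes> (inv y \<otimes> w)) = \<Psi> (inv y \<otimes> w)"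
        using U(3) small_inv[OF U(1) u] y w by (simp add: left_invariant_def)
      then show "?f (y \<otimes> u) = ?f y"
        using right_invariantD[OF U(2) y u] y w uG by (simp add: inv_mult_group m_assoc)
    qed
    moreover have "covers U X {y. ?f y \<noteq> \<zero>\<^bsub>regular_module F\<^esub>}"
      by (rule covers_mono[OF X(2)]) (use \<Psi> w in auto)
    moreover have "?f \<in> carrier G \<rightarrow> carrier (regular_module F)"
      using \<Theta> \<Psi> w by auto
    ultimately have "haar_integral G (regular_module F) haar ?f = (\<Oplus>\<^bsub>F\<^esub>x\<in>X. haar U \<otimes>\<^bsub>F\<^esub> ?f x)"
      using haar_integral_eq_sum[OF module_regular_module[OF F.is_cring] _ U(1) _ X(1)] by simp
    also have "\<dots> = (\<Oplus>\<^bsub>F\<^esub>x\<in>X. ((haar U \<otimes>\<^bsub>F\<^esub> \<Theta> x) \<odot>\<^bsub>Hecke\<^esub> left_translate x \<Psi>) w)"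
      using XG \<Theta> \<Psi> w U(1) by (intro F.finsum_cong') (auto simp: left_translate_def F.m_assoc)
    finally show "convolution G F haar \<Theta> \<Psi> w = ?S w"
      using w hecke_finsum_apply[OF h w] by (simp add: convolution_def del: hecke_simps)
  qed
  then show ?thesis
    by simp
qed

lemma transversal_singleton: "g \<in> carrier G \<Longrightarrow> transversal U {g}"
  by (simp add: transversal_def)

lemma covers_coset_delta: "g \<in> carrier G \<Longrightarrow> covers U {g} {x. coset_delta g U x \<noteq> \<zero>\<^bsub>F\<^esub>}"
  by (auto simp: covers_def coset_delta_def split: if_splits)

lemma haar_mult_coset_delta:
  "small U \<Longrightarrow> g \<in> carrier G \<Longrightarrow> haar U \<otimes>\<^bsub>F\<^esub> coset_delta g U g = \<one>\<^bsub>F\<^esub>"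
  by (simp add: coset_delta_def small_one)

text \<open>The case X = \<open>{g}\<close> of the expansion, with coefficient one.\<close>

lemma coset_delta_mult:
  assumes U: "small U" and g: "g \<in> carrier G" and \<Psi>: "\<Psi> \<in> carrier Hecke" "left_invariant U \<Psi>"
  shows "coset_delta g U \<otimes>\<^bsub>Hecke\<^esub> \<Psi> = left_translate g \<Psi>"
  using convolution_expand[OF coset_delta_closed[OF U g] \<Psi>(1) U coset_delta_right_invariant[OF U g] \<Psi>(2)
      transversal_singleton[OF g] covers_coset_delta[OF g]]
    haar_mult_coset_delta[OF U g] H.smult_one[OF left_translate_closed[OF g \<Psi>(1)]]
    left_translate_closed[OF g \<Psi>(1)]
  by (simp del: hecke_simps)

end

section \<open>Smooth representations and smooth modules\<close>

lemma integrated_rep_simps [simp]: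
  "carrier (integrated_rep G \<mu> V) = carrier V" "zero (integrated_rep G \<mu> V) = zero V"
  "add (integrated_rep G \<mu> V) = add V" "smult (integrated_rep G \<mu> V) = smult V"
  by (simp_all add: integrated_rep_def)

context ordinary_td_group begin

interpretation H: Module.module F Hecke
  by (rule module_hecke)

section \<open>The Hecke module of a smooth representation\<close>

context
  fixes V :: "('g, 'f, 'v) acted"
  assumes smooth: "smooth_representation G T F V"
begin

lemma smooth_rep_module: "Module.module F V"
  using smooth by (simp add: smooth_representation_def representation_def)

lemma smooth_rep_linear: "g \<in> carrier G \<Longrightarrow> linear_map F V V (act V g)"
  using smooth by (simp add: smooth_representation_def representation_def)

lemma smooth_rep_one: "v \<in> carrier V \<Longrightarrow> act V \<one> v = v"
  using smooth by (simp add: smooth_representation_def representation_def)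

lemma smooth_rep_mult:
  "g \<in> carrier G \<Longrightarrow> h \<in> carrier G \<Longrightarrow> v \<in> carrier V \<Longrightarrow> act V (g \<otimes> h) v = act V g (act V h v)"
  using smooth by (simp add: smooth_representation_def representation_def)

lemmas smooth_rep_closed = linear_mapD(1)[OF smooth_rep_linear]

interpretation V: Module.module F V
  by (rule smooth_rep_module)

lemma smooth_rep_fixed:
  assumes "v \<in> carrier V"
  obtains U where "small U" "\<forall>u\<in>U. act V u v = v"
proof -
  obtain W where W: "compact_open_subgroup G T W" "\<forall>g\<in>W. act V g v = v"
    using smooth assms by (auto simp: smooth_representation_def)
  then have "openin T W" "\<one> \<in> W"
    using subgroup.one_closed by (auto simp: compact_open_subgroup_def)
  then obtain U where "small U" "U \<subseteq> W"
    using small_basis by blast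
  with W(2) that show ?thesis
    by blast
qed

text \<open>The integrand is right U-invariant since \<open>\<Theta>\<close> is and U fixes v. Later
  identities are checked on this finite sum.\<close>

lemma integrated_act_eq:
  assumes \<Theta>: "\<Theta> \<in> carrier Hecke" and v: "v \<in> carrier V"
    and U: "small U" "right_invariant U \<Theta>" "\<forall>u\<in>U. act V u v = v"
    and X: "transversal U X" "covers U X {g. \<Theta> g \<noteq> \<zero>\<^bsub>F\<^esub>}"
  shows "act (integrated_rep G haar V) \<Theta> v = (\<Oplus>\<^bsub>V\<^esub>x\<in>X. (haar U \<otimes>\<^bsub>F\<^esub> \<Theta> x) \<odot>\<^bsub>V\<^esub> act V x v)"
proof -
  let ?f = "\<lambda>g. \<Theta> g \<odot>\<^bsub>V\<^esub> act V g v"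
  have XG: "x \<in> carrier G" if "x \<in> X" for x
    using X(1) that by (auto simp: transversal_def)
  have "right_invariant U ?f"
    unfolding right_invariant_def
  proof (intro ballI)
    fix x u assume x: "x \<in> carrier G" and u: "u \<in> U"
    have "act V (x \<otimes> u) v = act V x v"
      using smooth_rep_mult[OF x small_mem[OF U(1) u] v] bspec[OF U(3) u] by simp
    then show "?f (x \<otimes> u) = ?f x"
      using right_invariantD[OF U(2) x u] by simp
  qed
  moreover have "covers U X {g. ?f g \<noteq> \<zero>\<^bsub>V\<^esub>}"
    by (rule covers_mono[OF X(2)]) (use v smooth_rep_closed in auto)
  moreover have "?f \<in> carrier G \<rightarrow> carrier V"
    using \<Theta> v smooth_rep_closed by auto
  ultimately have "haar_integral G V haar ?f = (\<Oplus>\<^bsub>V\<^esub>x\<in>X. haar U \<odot>\<^bsub>V\<^esub> ?f x)"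
    using haar_integral_eq_sum[OF smooth_rep_module _ U(1) _ X(1)] by blast
  also have "\<dots> = (\<Oplus>\<^bsub>V\<^esub>x\<in>X. (haar U \<otimes>\<^bsub>F\<^esub> \<Theta> x) \<odot>\<^bsub>V\<^esub> act V x v)"
    using XG \<Theta> v U(1) smooth_rep_closed
    by (intro V.M.finsum_cong') (auto simp: V.smult_assoc1)
  finally show ?thesis
    by (simp add: integrated_rep_def)
qed

text \<open>The integrand is supported on the single coset gU and is constant there because U fixes
  v.\<close>

lemma integrated_coset_delta:
  assumes v: "v \<in> carrier V" and U: "small U" "\<forall>u\<in>U. act V u v = v" and g: "g \<in> carrier G"
  shows "act (integrated_rep G haar V) (coset_delta g U) v = act V g v"
proof -
  have "act (integrated_rep G haar V) (coset_delta g U) v =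
      (\<Oplus>\<^bsub>V\<^esub>x\<in>{g}. (haar U \<otimes>\<^bsub>F\<^esub> coset_delta g U x) \<odot>\<^bsub>V\<^esub> act V x v)"
    using coset_delta_closed v U(1) coset_delta_right_invariant[OF U(1) g] U(2)
      transversal_singleton[OF g] covers_coset_delta[OF g]
    by (rule integrated_act_eq) (use U g in auto)
  then show ?thesis
    using smooth_rep_closed[OF g v] haar_mult_coset_delta[OF U(1) g] by simp
qed

lemma integrated_data:
  assumes "\<Theta> \<in> carrier Hecke" "\<Psi> \<in> carrier Hecke" "v \<in> carrier V" "w \<in> carrier V"
  obtains U X where "small U" "right_invariant U \<Theta>" "right_invariant U \<Psi>"
    "\<forall>u\<in>U. act V u v = v" "\<forall>u\<in>U. act V u w = w"
    "transversal U X" "covers U X {g. \<Theta> g \<noteq> \<zero>\<^bsub>F\<^esub>}" "covers U X {g. \<Psi> g \<noteq> \<zero>\<^bsub>F\<^esub>}"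
proof -
  obtain U1 where 1: "small U1" "\<forall>u\<in>U1. act V u v = v"
    using smooth_rep_fixed[OF assms(3)] .
  obtain U2 where 2: "small U2" "\<forall>u\<in>U2. act V u w = w"
    using smooth_rep_fixed[OF assms(4)] .
  obtain U X where "small U" "U \<subseteq> U1 \<inter> U2" "right_invariant U \<Theta>" "right_invariant U \<Psi>"
    "transversal U X" "covers U X {g. \<Theta> g \<noteq> \<zero>\<^bsub>F\<^esub>}" "covers U X {g. \<Psi> g \<noteq> \<zero>\<^bsub>F\<^esub>}"
    using hecke_common_transversal[OF assms(1,2) small_Int[OF 1(1) 2(1)]] .
  with 1(2) 2(2) that show ?thesis
    by blast
qed

lemma integrated_closed:
  assumes "\<Theta> \<in> carrier Hecke" "v \<in> carrier V"
  shows "act (integrated_rep G haar V) \<Theta> v \<in> carrier V"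
proof -
  obtain U X where U: "small U" "right_invariant U \<Theta>" "\<forall>u\<in>U. act V u v = v"
    "transversal U X" "covers U X {g. \<Theta> g \<noteq> \<zero>\<^bsub>F\<^esub>}"
    using integrated_data[OF assms(1,1,2,2)] by metis
  have "x \<in> carrier G" if "x \<in> X" for x
    using U(4) that by (auto simp: transversal_def)
  then show ?thesis
    unfolding integrated_act_eq[OF assms U]
    using assms U(1) smooth_rep_closed by (intro V.M.finsum_closed) auto
qed

lemma integrated_linear:
  assumes \<Theta>: "\<Theta> \<in> carrier Hecke"
  shows "linear_map F V V (act (integrated_rep G haar V) \<Theta>)"
  unfolding linear_map_def
proof (intro conjI ballI funcsetI integrated_closed[OF \<Theta>])
  fix v w assume v: "v \<in> carrier V" and w: "w \<in> carrier V"
  obtain U X where U: "small U" "right_invariant U \<Theta>"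
    "\<forall>u\<in>U. act V u v = v" "\<forall>u\<in>U. act V u w = w"
    and X: "transversal U X" "covers U X {g. \<Theta> g \<noteq> \<zero>\<^bsub>F\<^esub>}"
    using integrated_data[OF \<Theta> \<Theta> v w] by metis
  have XG: "x \<in> carrier G" if "x \<in> X" for x
    using X(1) that by (auto simp: transversal_def)
  have "\<forall>u\<in>U. act V u (v \<oplus>\<^bsub>V\<^esub> w) = v \<oplus>\<^bsub>V\<^esub> w"
    using linear_mapD(2)[OF smooth_rep_linear[OF small_mem[OF U(1)]] v w] U(3,4) by simp
  then have "act (integrated_rep G haar V) \<Theta> (v \<oplus>\<^bsub>V\<^esub> w) =
      (\<Oplus>\<^bsub>V\<^esub>x\<in>X. (haar U \<otimes>\<^bsub>F\<^esub> \<Theta> x) \<odot>\<^bsub>V\<^esub> act V x (v \<oplus>\<^bsub>V\<^esub> w))"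
    using v w by (intro integrated_act_eq[OF \<Theta> _ U(1,2) _ X]) auto
  also have "\<dots> = (\<Oplus>\<^bsub>V\<^esub>x\<in>X. (haar U \<otimes>\<^bsub>F\<^esub> \<Theta> x) \<odot>\<^bsub>V\<^esub> act V x v \<oplus>\<^bsub>V\<^esub> (haar U \<otimes>\<^bsub>F\<^esub> \<Theta> x) \<odot>\<^bsub>V\<^esub> act V x w)"
    using XG \<Theta> v w U(1) smooth_rep_closed linear_mapD(2)[OF smooth_rep_linear]
    by (intro V.M.finsum_cong') (auto simp: V.smult_r_distr)
  also have "\<dots> = act (integrated_rep G haar V) \<Theta> v \<oplus>\<^bsub>V\<^esub> act (integrated_rep G haar V) \<Theta> w"
    unfolding integrated_act_eq[OF \<Theta> v U(1-3) X] integrated_act_eq[OF \<Theta> w U(1,2,4) X]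
    using XG \<Theta> v w U(1) smooth_rep_closed by (intro V.M.finsum_addf) auto
  finally show "act (integrated_rep G haar V) \<Theta> (v \<oplus>\<^bsub>V\<^esub> w) =
      act (integrated_rep G haar V) \<Theta> v \<oplus>\<^bsub>V\<^esub> act (integrated_rep G haar V) \<Theta> w" .
next
  fix c v assume c: "c \<in> carrier F" and v: "v \<in> carrier V"
  obtain U X where U: "small U" "right_invariant U \<Theta>" "\<forall>u\<in>U. act V u v = v"
    and X: "transversal U X" "covers U X {g. \<Theta> g \<noteq> \<zero>\<^bsub>F\<^esub>}"
    using integrated_data[OF \<Theta> \<Theta> v v] by metis
  have XG: "x \<in> carrier G" if "x \<in> X" for x
    using X(1) that by (auto simp: transversal_def)
  have "\<forall>u\<in>U. act V u (c \<odot>\<^bsub>V\<^esub> v) = c \<odot>\<^bsub>V\<^esub> v"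
    using linear_mapD(3)[OF smooth_rep_linear[OF small_mem[OF U(1)]] v c] U(3) by simp
  then have "act (integrated_rep G haar V) \<Theta> (c \<odot>\<^bsub>V\<^esub> v) =
      (\<Oplus>\<^bsub>V\<^esub>x\<in>X. (haar U \<otimes>\<^bsub>F\<^esub> \<Theta> x) \<odot>\<^bsub>V\<^esub> act V x (c \<odot>\<^bsub>V\<^esub> v))"
    using v c by (intro integrated_act_eq[OF \<Theta> _ U(1,2) _ X]) auto
  also have "\<dots> = (\<Oplus>\<^bsub>V\<^esub>x\<in>X. c \<odot>\<^bsub>V\<^esub> ((haar U \<otimes>\<^bsub>F\<^esub> \<Theta> x) \<odot>\<^bsub>V\<^esub> act V x v))"
  proof (rule V.M.finsum_cong'[OF refl])
    fix x assume x: "x \<in> X"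
    show "(haar U \<otimes>\<^bsub>F\<^esub> \<Theta> x) \<odot>\<^bsub>V\<^esub> act V x (c \<odot>\<^bsub>V\<^esub> v) = c \<odot>\<^bsub>V\<^esub> ((haar U \<otimes>\<^bsub>F\<^esub> \<Theta> x) \<odot>\<^bsub>V\<^esub> act V x v)"
      using XG[OF x] \<Theta> v c U(1) smooth_rep_closed linear_mapD(3)[OF smooth_rep_linear]
        F.m_comm[of c "haar U \<otimes>\<^bsub>F\<^esub> \<Theta> x"] by (simp flip: V.smult_assoc1)
  qed (use XG \<Theta> v c U(1) smooth_rep_closed in auto)
  also have "\<dots> = c \<odot>\<^bsub>V\<^esub> act (integrated_rep G haar V) \<Theta> v"
    unfolding integrated_act_eq[OF \<Theta> v U X]
    using XG \<Theta> v c U(1) X(1) smooth_rep_closed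
    by (intro V.finsum_smult_ldistr[symmetric]) (auto simp: transversal_def)
  finally show "act (integrated_rep G haar V) \<Theta> (c \<odot>\<^bsub>V\<^esub> v) = c \<odot>\<^bsub>V\<^esub> act (integrated_rep G haar V) \<Theta> v" .
qed

lemma integrated_linear_hecke:
  assumes v: "v \<in> carrier V"
  shows "linear_map F Hecke V (\<lambda>\<Theta>. act (integrated_rep G haar V) \<Theta> v)"
  unfolding linear_map_def
proof (intro conjI ballI funcsetI integrated_closed[OF _ v])
  fix \<Theta> \<Psi> assume \<Theta>: "\<Theta> \<in> carrier Hecke" and \<Psi>: "\<Psi> \<in> carrier Hecke"
  obtain U X where U: "small U" "right_invariant U \<Theta>" "right_invariant U \<Psi>"
    "\<forall>u\<in>U. act V u v = v"
    and X: "transversal U X" "covers U X {g. \<Theta> g \<noteq> \<zero>\<^bsub>F\<^esub>}" "covers U X {g. \<Psi> g \<noteq> \<zero>\<^bsub>F\<^esub>}"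
    using integrated_data[OF \<Theta> \<Psi> v v] by metis
  have XG: "x \<in> carrier G" if "x \<in> X" for x
    using X(1) that by (auto simp: transversal_def)
  have "right_invariant U (\<Theta> \<oplus>\<^bsub>Hecke\<^esub> \<Psi>)"
    using U(1-3) small_mem by (auto simp: right_invariant_def)
  moreover have "covers U X {g. (\<Theta> \<oplus>\<^bsub>Hecke\<^esub> \<Psi>) g \<noteq> \<zero>\<^bsub>F\<^esub>}"
    unfolding covers_def
  proof
    fix g assume g: "g \<in> carrier G \<inter> {g. (\<Theta> \<oplus>\<^bsub>Hecke\<^esub> \<Psi>) g \<noteq> \<zero>\<^bsub>F\<^esub>}"
    then have "\<Theta> g \<noteq> \<zero>\<^bsub>F\<^esub> \<or> \<Psi> g \<noteq> \<zero>\<^bsub>F\<^esub>"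
      by auto
    with g X show "\<exists>x\<in>X. inv x \<otimes> g \<in> U"
      by (auto simp: covers_def)
  qed
  ultimately have "act (integrated_rep G haar V) (\<Theta> \<oplus>\<^bsub>Hecke\<^esub> \<Psi>) v =
      (\<Oplus>\<^bsub>V\<^esub>x\<in>X. (haar U \<otimes>\<^bsub>F\<^esub> (\<Theta> \<oplus>\<^bsub>Hecke\<^esub> \<Psi>) x) \<odot>\<^bsub>V\<^esub> act V x v)"
    using U X(1) by (intro integrated_act_eq[OF hecke_add_closed[OF \<Theta> \<Psi>] v]) auto
  also have "\<dots> = (\<Oplus>\<^bsub>V\<^esub>x\<in>X. (haar U \<otimes>\<^bsub>F\<^esub> \<Theta> x) \<odot>\<^bsub>V\<^esub> act V x v \<oplus>\<^bsub>V\<^esub> (haar U \<otimes>\<^bsub>F\<^esub> \<Psi> x) \<odot>\<^bsub>V\<^esub> act V x v)"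
    using XG \<Theta> \<Psi> v U(1) smooth_rep_closed
    by (intro V.M.finsum_cong') (auto simp: V.smult_l_distr F.r_distr)
  also have "\<dots> = act (integrated_rep G haar V) \<Theta> v \<oplus>\<^bsub>V\<^esub> act (integrated_rep G haar V) \<Psi> v"
    unfolding integrated_act_eq[OF \<Theta> v U(1,2,4) X(1,2)] integrated_act_eq[OF \<Psi> v U(1,3,4) X(1,3)]
    using XG \<Theta> \<Psi> v U(1) smooth_rep_closed by (intro V.M.finsum_addf) auto
  finally show "act (integrated_rep G haar V) (\<Theta> \<oplus>\<^bsub>Hecke\<^esub> \<Psi>) v =
      act (integrated_rep G haar V) \<Theta> v \<oplus>\<^bsub>V\<^esub> act (integrated_rep G haar V) \<Psi> v" .
next
  fix c \<Theta> assume c: "c \<in> carrier F" and \<Theta>: "\<Theta> \<in> carrier Hecke"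
  obtain U X where U: "small U" "right_invariant U \<Theta>" "\<forall>u\<in>U. act V u v = v"
    and X: "transversal U X" "covers U X {g. \<Theta> g \<noteq> \<zero>\<^bsub>F\<^esub>}"
    using integrated_data[OF \<Theta> \<Theta> v v] by metis
  have XG: "x \<in> carrier G" if "x \<in> X" for x
    using X(1) that by (auto simp: transversal_def)
  have "right_invariant U (c \<odot>\<^bsub>Hecke\<^esub> \<Theta>)"
    using U(1,2) small_mem by (auto simp: right_invariant_def)
  moreover have "covers U X {g. (c \<odot>\<^bsub>Hecke\<^esub> \<Theta>) g \<noteq> \<zero>\<^bsub>F\<^esub>}"
    by (rule covers_mono[OF X(2)]) (use c in auto)
  ultimately have "act (integrated_rep G haar V) (c \<odot>\<^bsub>Hecke\<^esub> \<Theta>) v =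
      (\<Oplus>\<^bsub>V\<^esub>x\<in>X. (haar U \<otimes>\<^bsub>F\<^esub> (c \<odot>\<^bsub>Hecke\<^esub> \<Theta>) x) \<odot>\<^bsub>V\<^esub> act V x v)"
    using U X(1) by (intro integrated_act_eq[OF hecke_smult_closed[OF c \<Theta>] v]) auto
  also have "\<dots> = (\<Oplus>\<^bsub>V\<^esub>x\<in>X. c \<odot>\<^bsub>V\<^esub> ((haar U \<otimes>\<^bsub>F\<^esub> \<Theta> x) \<odot>\<^bsub>V\<^esub> act V x v))"
  proof (rule V.M.finsum_cong'[OF refl])
    fix x assume x: "x \<in> X"
    show "(haar U \<otimes>\<^bsub>F\<^esub> (c \<odot>\<^bsub>Hecke\<^esub> \<Theta>) x) \<odot>\<^bsub>V\<^esub> act V x v = c \<odot>\<^bsub>V\<^esub> ((haar U \<otimes>\<^bsub>F\<^esub> \<Theta> x) \<odot>\<^bsub>V\<^esub> act V x v)"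
      using XG[OF x] \<Theta> v c U(1) smooth_rep_closed
        F.m_lcomm[of c "haar U" "\<Theta> x"] by (simp flip: V.smult_assoc1)
  qed (use XG \<Theta> v c U(1) smooth_rep_closed in auto)
  also have "\<dots> = c \<odot>\<^bsub>V\<^esub> act (integrated_rep G haar V) \<Theta> v"
    unfolding integrated_act_eq[OF \<Theta> v U X]
    using XG \<Theta> v c U(1) X(1) smooth_rep_closed
    by (intro V.finsum_smult_ldistr[symmetric]) (auto simp: transversal_def)
  finally show "act (integrated_rep G haar V) (c \<odot>\<^bsub>Hecke\<^esub> \<Theta>) v = c \<odot>\<^bsub>V\<^esub> act (integrated_rep G haar V) \<Theta> v" .
qed

text \<open>A substitution in the integral, obtained by linearity: \<open>\<Theta>\<close> is
  expanded in indicators of cosets xU, translation by g moves them to the cosets of g \<otimes> x,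
  and these act on v as g \<otimes> x.\<close>

lemma integrated_left_translate:
  assumes \<Theta>: "\<Theta> \<in> carrier Hecke" and v: "v \<in> carrier V" and g: "g \<in> carrier G"
  shows "act (integrated_rep G haar V) (left_translate g \<Theta>) v = act V g (act (integrated_rep G haar V) \<Theta> v)"
proof -
  obtain U X where U: "small U" "right_invariant U \<Theta>" "\<forall>u\<in>U. act V u v = v"
    and X: "transversal U X" "covers U X {g. \<Theta> g \<noteq> \<zero>\<^bsub>F\<^esub>}"
    using integrated_data[OF \<Theta> \<Theta> v v] by metis
  have XG: "x \<in> carrier G" if "x \<in> X" for x
    using X(1) that by (auto simp: transversal_def)
  let ?S = "\<Oplus>\<^bsub>Hecke\<^esub>x\<in>X. (haar U \<otimes>\<^bsub>F\<^esub> \<Theta> x) \<odot>\<^bsub>Hecke\<^esub> coset_delta x U"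
  have lin: "linear_map F Hecke Hecke (left_translate g)"
    unfolding linear_map_def
  proof (intro conjI ballI funcsetI left_translate_closed[OF g])
    show "left_translate g (\<Phi> \<oplus>\<^bsub>Hecke\<^esub> \<Psi>) = left_translate g \<Phi> \<oplus>\<^bsub>Hecke\<^esub> left_translate g \<Psi>" for \<Phi> \<Psi>
      unfolding left_translate_def hecke_simps by (rule restrict_ext) (use g in simp)
    show "left_translate g (c \<odot>\<^bsub>Hecke\<^esub> \<Phi>) = c \<odot>\<^bsub>Hecke\<^esub> left_translate g \<Phi>" for c \<Phi>
      unfolding left_translate_def hecke_simps by (rule restrict_ext) (use g in simp)
  qed
  have "left_translate g \<Theta> = (\<Oplus>\<^bsub>Hecke\<^esub>x\<in>X. left_translate g ((haar U \<otimes>\<^bsub>F\<^esub> \<Theta> x) \<odot>\<^bsub>Hecke\<^esub> coset_delta x U))"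
    using linear_map_finsum[OF module_hecke module_hecke lin,
        of "\<lambda>x. (haar U \<otimes>\<^bsub>F\<^esub> \<Theta> x) \<odot>\<^bsub>Hecke\<^esub> coset_delta x U" X]
      hecke_expand[OF \<Theta> U(1,2) X] XG U(1) \<Theta> H.smult_closed coset_delta_closed
    by (simp add: Pi_iff del: hecke_simps)
  also have "\<dots> = (\<Oplus>\<^bsub>Hecke\<^esub>x\<in>X. (haar U \<otimes>\<^bsub>F\<^esub> \<Theta> x) \<odot>\<^bsub>Hecke\<^esub> coset_delta (g \<otimes> x) U)"
    using XG U(1) \<Theta> g linear_mapD(3)[OF lin] left_translate_coset_delta[OF g]
      H.smult_closed coset_delta_closed
    by (intro H.M.finsum_cong') (auto simp del: hecke_simps)
  finally have "act (integrated_rep G haar V) (left_translate g \<Theta>) v =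
      (\<Oplus>\<^bsub>V\<^esub>x\<in>X. act (integrated_rep G haar V) ((haar U \<otimes>\<^bsub>F\<^esub> \<Theta> x) \<odot>\<^bsub>Hecke\<^esub> coset_delta (g \<otimes> x) U) v)"
    using linear_map_finsum[OF module_hecke smooth_rep_module integrated_linear_hecke[OF v],
        of "\<lambda>x. (haar U \<otimes>\<^bsub>F\<^esub> \<Theta> x) \<odot>\<^bsub>Hecke\<^esub> coset_delta (g \<otimes> x) U" X] XG U(1) \<Theta> g
        H.smult_closed coset_delta_closed
    by (simp add: Pi_iff del: hecke_simps)
  also have "\<dots> = (\<Oplus>\<^bsub>V\<^esub>x\<in>X. act V g ((haar U \<otimes>\<^bsub>F\<^esub> \<Theta> x) \<odot>\<^bsub>V\<^esub> act V x v))"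
  proof (rule V.M.finsum_cong'[OF refl])
    fix x assume x: "x \<in> X"
    show "act (integrated_rep G haar V) ((haar U \<otimes>\<^bsub>F\<^esub> \<Theta> x) \<odot>\<^bsub>Hecke\<^esub> coset_delta (g \<otimes> x) U) v =
        act V g ((haar U \<otimes>\<^bsub>F\<^esub> \<Theta> x) \<odot>\<^bsub>V\<^esub> act V x v)"
      using XG[OF x] \<Theta> v g U(1) smooth_rep_closed linear_mapD(3)[OF integrated_linear_hecke[OF v]]
        integrated_coset_delta[OF v U(1,3), of "g \<otimes> x"] smooth_rep_mult
        linear_mapD(3)[OF smooth_rep_linear[OF g], of "act V x v"]
      by (simp del: hecke_simps)
  qed (use XG \<Theta> v g U(1) smooth_rep_closed in auto)
  also have "\<dots> = act V g (act (integrated_rep G haar V) \<Theta> v)"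
    unfolding integrated_act_eq[OF \<Theta> v U X]
    using XG \<Theta> v U(1) smooth_rep_closed
    by (intro linear_map_finsum[OF smooth_rep_module smooth_rep_module smooth_rep_linear[OF g], symmetric]) auto
  finally show ?thesis .
qed

text \<open>In place of an interchange of integrals, the product is expanded in left translates of
  \<open>\<Psi>\<close>, which act as x applied to the vector w that \<open>\<Psi>\<close> makes of
  v. The resulting sum is the integral of \<open>\<Theta>\<close> at w, provided that U fixes w;
  this follows from left U-invariance of \<open>\<Psi>\<close>.\<close>

lemma integrated_mult:
  assumes \<Theta>: "\<Theta> \<in> carrier Hecke" and \<Psi>: "\<Psi> \<in> carrier Hecke" and v: "v \<in> carrier V"
  shows "act (integrated_rep G haar V) (\<Theta> \<otimes>\<^bsub>Hecke\<^esub> \<Psi>) v =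
    act (integrated_rep G haar V) \<Theta> (act (integrated_rep G haar V) \<Psi> v)"
proof -
  obtain W where W: "small W" "left_invariant W \<Psi>"
    using hecke_left_invariant[OF \<Psi>] .
  obtain U X where U: "small U" "U \<subseteq> W" "right_invariant U \<Theta>"
    and X: "transversal U X" "covers U X {g. \<Theta> g \<noteq> \<zero>\<^bsub>F\<^esub>}"
    using hecke_common_transversal[OF \<Theta> \<Theta> W(1)] by metis
  have XG: "x \<in> carrier G" if "x \<in> X" for x
    using X(1) that by (auto simp: transversal_def)
  define w where "w = act (integrated_rep G haar V) \<Psi> v"
  have w: "w \<in> carrier V"
    using integrated_closed[OF \<Psi> v] by (simp add: w_def)
  have Uw: "\<forall>u\<in>U. act V u w = w"
  proof
    fix u assume u: "u \<in> U"
    have uG: "u \<in> carrier G"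
      using U(1) u small_mem by blast
    have "left_translate u \<Psi> = \<Psi>"
    proof (rule hecke_ext[OF left_translate_closed[OF uG \<Psi>] \<Psi>])
      fix x assume x: "x \<in> carrier G"
      have "inv u \<in> W"
        using U u small_inv by blast
      then show "left_translate u \<Psi> x = \<Psi> x"
        using W(2) x by (simp add: left_translate_def left_invariant_def)
    qed
    then show "act V u w = w"
      using integrated_left_translate[OF \<Psi> v uG] by (simp add: w_def)
  qed
  have "act (integrated_rep G haar V) (\<Theta> \<otimes>\<^bsub>Hecke\<^esub> \<Psi>) v =
      (\<Oplus>\<^bsub>V\<^esub>x\<in>X. act (integrated_rep G haar V) ((haar U \<otimes>\<^bsub>F\<^esub> \<Theta> x) \<odot>\<^bsub>Hecke\<^esub> left_translate x \<Psi>) v)"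
    unfolding convolution_expand[OF \<Theta> \<Psi> U(1,3) left_invariant_mono[OF W(2) U(2)] X]
    using XG U(1) \<Theta> \<Psi> H.smult_closed left_translate_closed
    by (intro linear_map_finsum[OF module_hecke smooth_rep_module integrated_linear_hecke[OF v]])
      (auto simp del: hecke_simps)
  also have "\<dots> = (\<Oplus>\<^bsub>V\<^esub>x\<in>X. (haar U \<otimes>\<^bsub>F\<^esub> \<Theta> x) \<odot>\<^bsub>V\<^esub> act V x w)"
  proof (rule V.M.finsum_cong'[OF refl])
    fix x assume x: "x \<in> X"
    show "act (integrated_rep G haar V) ((haar U \<otimes>\<^bsub>F\<^esub> \<Theta> x) \<odot>\<^bsub>Hecke\<^esub> left_translate x \<Psi>) v =
        (haar U \<otimes>\<^bsub>F\<^esub> \<Theta> x) \<odot>\<^bsub>V\<^esub> act V x w"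
      using XG[OF x] \<Theta> \<Psi> v U(1) linear_mapD(3)[OF integrated_linear_hecke[OF v]]
        integrated_left_translate[OF \<Psi> v XG[OF x]]
      by (simp add: w_def del: hecke_simps)
  qed (use XG \<Theta> w U(1) smooth_rep_closed in auto)
  also have "\<dots> = act (integrated_rep G haar V) \<Theta> w"
    using integrated_act_eq[OF \<Theta> w U(1,3) Uw X] by simp
  finally show ?thesis
    by (simp add: w_def)
qed

lemma integrated_smooth_module: "smooth_module F Hecke (integrated_rep G haar V)"
proof -
  let ?I = "integrated_rep G haar V"
  have m: "Module.module F ?I"
    by (rule module_cong[OF smooth_rep_module]) simp_all
  have "algebra_module F Hecke ?I"
    unfolding algebra_module_def
  proof (intro conjI ballI m)
    show "linear_map F ?I ?I (act ?I \<Theta>)" if "\<Theta> \<in> carrier Hecke" for \<Theta>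
      using integrated_linear[OF that] by (simp add: linear_map_def)
  qed (use integrated_mult linear_mapD(2,3)[OF integrated_linear_hecke] in \<open>auto simp del: hecke_simps\<close>)
  moreover have "submodule_span F ?I {act ?I h v |h v. h \<in> carrier Hecke \<and> v \<in> carrier ?I} = carrier ?I"
  proof -
    \<comment> \<open>Each vector is itself a value of the action: the idempotent of a U that fixes
      v reproduces v.\<close>
    have "v \<in> {act ?I h v |h v. h \<in> carrier Hecke \<and> v \<in> carrier ?I}" if v: "v \<in> carrier V" for v
    proof -
      obtain U where U: "small U" "\<forall>u\<in>U. act V u v = v"
        using smooth_rep_fixed[OF v] .
      have "act ?I (coset_delta \<one> U) v = v"
        using integrated_coset_delta[OF v U one_closed] smooth_rep_one[OF v] by simp
      moreover have "coset_delta \<one> U \<in> carrier Hecke"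
        using U(1) by simp
      ultimately show ?thesis
        using v by (intro CollectI exI[of _ "coset_delta \<one> U"] exI[of _ v]) simp
    qed
    moreover have "{act ?I h v |h v. h \<in> carrier Hecke \<and> v \<in> carrier ?I} \<subseteq> carrier ?I"
      using integrated_closed by auto
    ultimately show ?thesis
      by (subst submodule_span_eq_carrier_iff[OF m]) auto
  qed
  ultimately show ?thesis
    by (simp add: smooth_module_def)
qed

end

text \<open>A subgroup that fixes v also fixes f v, so the same U and X compute both integrals and f
  passes through the finite sum.\<close>

lemma integrated_equivariant:
  assumes V: "smooth_representation G T F V" and W: "smooth_representation G T F W"
    and f: "f \<in> equivariant_maps (carrier G) F V W"
  shows "f \<in> equivariant_maps (carrier Hecke) F (integrated_rep G haar V) (integrated_rep G haar W)"
proof -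
  have lin: "linear_map F V W f" and eq: "\<And>g v. g \<in> carrier G \<Longrightarrow> v \<in> carrier V \<Longrightarrow> f (act V g v) = act W g (f v)"
    using f by (auto simp: equivariant_maps_def)
  interpret W: Module.module F W
    by (rule smooth_rep_module[OF W])
  interpret V: Module.module F V
    by (rule smooth_rep_module[OF V])
  have "f (act (integrated_rep G haar V) \<Theta> v) = act (integrated_rep G haar W) \<Theta> (f v)"
    if \<Theta>: "\<Theta> \<in> carrier Hecke" and v: "v \<in> carrier V" for \<Theta> v
  proof -
    obtain U X where U: "small U" "right_invariant U \<Theta>" "\<forall>u\<in>U. act V u v = v"
      and X: "transversal U X" "covers U X {g. \<Theta> g \<noteq> \<zero>\<^bsub>F\<^esub>}"
      using integrated_data[OF V \<Theta> \<Theta> v v] by metis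
    have XG: "x \<in> carrier G" if "x \<in> X" for x
      using X(1) that by (auto simp: transversal_def)
    have fv: "f v \<in> carrier W"
      using linear_mapD(1)[OF lin v] .
    have Uf: "\<forall>u\<in>U. act W u (f v) = f v"
      using eq[OF small_mem[OF U(1)] v] U(3) by simp
    have "f (act (integrated_rep G haar V) \<Theta> v) = (\<Oplus>\<^bsub>W\<^esub>x\<in>X. f ((haar U \<otimes>\<^bsub>F\<^esub> \<Theta> x) \<odot>\<^bsub>V\<^esub> act V x v))"
      unfolding integrated_act_eq[OF V \<Theta> v U X]
      using XG U(1) \<Theta> v smooth_rep_closed[OF V]
      by (intro linear_map_finsum[OF V.module_axioms W.module_axioms lin]) auto
    also have "\<dots> = (\<Oplus>\<^bsub>W\<^esub>x\<in>X. (haar U \<otimes>\<^bsub>F\<^esub> \<Theta> x) \<odot>\<^bsub>W\<^esub> act W x (f v))"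
      using XG U(1) \<Theta> v fv smooth_rep_closed[OF V] smooth_rep_closed[OF W] linear_mapD(3)[OF lin] eq
      by (intro W.M.finsum_cong') auto
    also have "\<dots> = act (integrated_rep G haar W) \<Theta> (f v)"
      using integrated_act_eq[OF W \<Theta> fv U(1,2) Uf X] by simp
    finally show ?thesis .
  qed
  then show ?thesis
    using f by (auto simp: equivariant_maps_def linear_map_def)
qed

section \<open>The representation of G on a smooth Hecke module\<close>

text \<open>Inverse of the integration functor: \<open>g\<close> acts on \<open>m\<close> as the normalised indicator of \<open>gU\<close>, for any
  small \<open>U\<close> whose idempotent fixes \<open>m\<close>.\<close>

definition derived_act :: "('g \<Rightarrow> 'f, 'f, 'v) acted \<Rightarrow> 'g \<Rightarrow> 'v \<Rightarrow> 'v" where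
  "derived_act M g m =
     act M (coset_delta g (SOME U. small U \<and> act M (coset_delta \<one> U) m = m)) m"

definition derived_rep :: "('g \<Rightarrow> 'f, 'f, 'v) acted \<Rightarrow> ('g, 'f, 'v) acted" where
  "derived_rep M =
     \<lparr>carrier = carrier M, monoid.mult = monoid.mult M, one = one M, zero = zero M, add = add M,
      smult = smult M, act = derived_act M\<rparr>"

lemma derived_rep_simps [simp]:
  "carrier (derived_rep M) = carrier M" "zero (derived_rep M) = zero M"
  "add (derived_rep M) = add M" "smult (derived_rep M) = smult M"
  "act (derived_rep M) = derived_act M"
  by (simp_all add: derived_rep_def)

context
  fixes M :: "('g \<Rightarrow> 'f, 'f, 'v) acted"
  assumes smooth: "smooth_module F Hecke M"
begin

lemma smooth_module_module: "Module.module F M"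
  using smooth by (simp add: smooth_module_def algebra_module_def)

lemma smooth_module_linear: "h \<in> carrier Hecke \<Longrightarrow> linear_map F M M (act M h)"
  using smooth by (simp add: smooth_module_def algebra_module_def)

lemmas smooth_module_closed = linear_mapD(1)[OF smooth_module_linear]

lemma smooth_module_linear_hecke: "m \<in> carrier M \<Longrightarrow> linear_map F Hecke M (\<lambda>h. act M h m)"
  using smooth smooth_module_closed
  by (auto simp: smooth_module_def algebra_module_def linear_map_def simp del: hecke_simps)

lemma smooth_module_mult:
  "h \<in> carrier Hecke \<Longrightarrow> k \<in> carrier Hecke \<Longrightarrow> m \<in> carrier M \<Longrightarrow>
    act M (h \<otimes>\<^bsub>Hecke\<^esub> k) m = act M h (act M k m)"
  using smooth by (simp add: smooth_module_def algebra_module_def del: hecke_simps)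

interpretation M: Module.module F M
  by (rule smooth_module_module)

text \<open>Associativity turns \<open>coset_delta_mult\<close> into a rule for operators.
  Independence of U, existence of fixing idempotents and multiplicativity of
  \<open>derived_act\<close> all follow from it.\<close>

lemma act_coset_delta_mult:
  assumes "small U" "g \<in> carrier G" "h \<in> carrier Hecke" "left_invariant U h" "m \<in> carrier M"
  shows "act M (coset_delta g U) (act M h m) = act M (left_translate g h) m"
  using smooth_module_mult[OF coset_delta_closed[OF assms(1,2)] assms(3,5)]
    coset_delta_mult[OF assms(1-4)] by simp

text \<open>Replace m by the idempotent of U applied to m. That idempotent is left invariant under V
  \<subseteq> U, so \<open>coset_delta g V\<close> merely translates it by g, which gives
  \<open>coset_delta g U\<close>.\<close>

lemma act_coset_delta_refine:
  assumes "small U" "small V" "V \<subseteq> U" "g \<in> carrier G" "m \<in> carrier M"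
    and "act M (coset_delta \<one> U) m = m"
  shows "act M (coset_delta g V) m = act M (coset_delta g U) m"
  using act_coset_delta_mult[OF assms(2,4) coset_delta_closed[OF assms(1) one_closed]
      left_invariant_mono[OF coset_delta_left_invariant[OF assms(1)] assms(3)] assms(5)]
    left_translate_coset_delta[OF assms(4) one_closed] assms(4,6) by simp

text \<open>The chosen subgroup and the given one are both compared with their intersection.\<close>

lemma derived_act_eq:
  assumes U: "small U" "act M (coset_delta \<one> U) m = m" and g: "g \<in> carrier G" and m: "m \<in> carrier M"
  shows "derived_act M g m = act M (coset_delta g U) m"
proof -
  define V where "V = (SOME U. small U \<and> act M (coset_delta \<one> U) m = m)"
  have V: "small V \<and> act M (coset_delta \<one> V) m = m"
    unfolding V_def by (rule someI[of _ U]) (use U in simp)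
  then have "act M (coset_delta g V) m = act M (coset_delta g (U \<inter> V)) m"
    using act_coset_delta_refine[of V "U \<inter> V" g m] small_Int U g m by simp
  also have "\<dots> = act M (coset_delta g U) m"
    using act_coset_delta_refine[of U "U \<inter> V" g m] small_Int U V g m by simp
  finally show ?thesis
    by (simp add: derived_act_def V_def)
qed

lemma ex_common_unit:
  assumes "small U" "act M (coset_delta \<one> U) m = m" "m \<in> carrier M"
    and "small V" "act M (coset_delta \<one> V) n = n" "n \<in> carrier M"
  shows "small (U \<inter> V)" "act M (coset_delta \<one> (U \<inter> V)) m = m" "act M (coset_delta \<one> (U \<inter> V)) n = n"
  using assms small_Int act_coset_delta_refine[of U "U \<inter> V" \<one> m]
    act_coset_delta_refine[of V "U \<inter> V" \<one> n] by simp_all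

text \<open>The vectors fixed by some idempotent form a submodule, closed under sums because two
  idempotents can be replaced by that of the intersection. It contains every
  \<open>act M h m\<close>: h is left invariant under some U, and the idempotent of U then leaves h
  unchanged. Smoothness makes it the whole module.\<close>

lemma ex_unit:
  assumes "m \<in> carrier M"
  obtains U where "small U" "act M (coset_delta \<one> U) m = m"
proof -
  define W where "W = {m \<in> carrier M. \<exists>U. small U \<and> act M (coset_delta \<one> U) m = m}"
  have lin: "linear_map F M M (act M (coset_delta \<one> U))" if "small U" for U
    using smooth_module_linear[OF coset_delta_closed[OF that one_closed]] .
  have "Module.submodule W F M"
  proof (rule M.submoduleI)
    show "\<zero>\<^bsub>M\<^esub> \<in> W"
      using linear_map_zero[OF smooth_module_module smooth_module_module lin[OF small_K]] small_K
      by (auto simp: W_def)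
    show "\<ominus>\<^bsub>M\<^esub> a \<in> W" if a: "a \<in> W" for a
    proof -
      obtain U where U: "small U" "act M (coset_delta \<one> U) a = a" "a \<in> carrier M"
        using a by (auto simp: W_def)
      then show ?thesis
        using linear_map_uminus[OF smooth_module_module smooth_module_module lin[OF U(1)] U(3)]
        by (auto simp: W_def)
    qed
    show "a \<oplus>\<^bsub>M\<^esub> b \<in> W" if a: "a \<in> W" and b: "b \<in> W" for a b
    proof -
      obtain U where U: "small U" "act M (coset_delta \<one> U) a = a" "a \<in> carrier M"
        using a by (auto simp: W_def)
      obtain V where V: "small V" "act M (coset_delta \<one> V) b = b" "b \<in> carrier M"
        using b by (auto simp: W_def)
      note UV = ex_common_unit[OF U V]
      show ?thesis
        using linear_mapD(2)[OF lin[OF UV(1)] U(3) V(3)] UV U(3) V(3) by (auto simp: W_def)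
    qed
    show "c \<odot>\<^bsub>M\<^esub> a \<in> W" if c: "c \<in> carrier F" and a: "a \<in> W" for c a
    proof -
      obtain U where U: "small U" "act M (coset_delta \<one> U) a = a" "a \<in> carrier M"
        using a by (auto simp: W_def)
      then show ?thesis
        using linear_mapD(3)[OF lin[OF U(1)] U(3) c] c by (auto simp: W_def)
    qed
  qed (auto simp: W_def)
  moreover have "{act M h m |h m. h \<in> carrier Hecke \<and> m \<in> carrier M} \<subseteq> W"
  proof -
    have "act M h m \<in> W" if h: "h \<in> carrier Hecke" and m: "m \<in> carrier M" for h m
    proof -
      obtain U where U: "small U" "left_invariant U h"
        using hecke_left_invariant[OF h] .
      have "left_translate \<one> h = h"
        by (rule hecke_ext[OF left_translate_closed[OF one_closed h] h]) (simp add: left_translate_def)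
      then have "act M (coset_delta \<one> U) (act M h m) = act M h m"
        using act_coset_delta_mult[OF U(1) one_closed h U(2) m] by simp
      then show ?thesis
        using U(1) smooth_module_closed[OF h m] by (auto simp: W_def)
    qed
    then show ?thesis
      by blast
  qed
  moreover have "submodule_span F M {act M h m |h m. h \<in> carrier Hecke \<and> m \<in> carrier M} = carrier M"
    using smooth by (simp add: smooth_module_def)
  ultimately have "carrier M \<subseteq> W"
    unfolding submodule_span_def by blast
  with assms that show ?thesis
    by (auto simp: W_def)
qed

lemma derived_smooth_rep: "smooth_representation G T F (derived_rep M)"
proof -
  have m: "Module.module F (derived_rep M)"
    by (rule module_cong[OF smooth_module_module]) simp_all
  have closed: "derived_act M g a \<in> carrier M" if g: "g \<in> carrier G" and a: "a \<in> carrier M" for g a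
  proof -
    obtain U where U: "small U" "act M (coset_delta \<one> U) a = a"
      using ex_unit[OF a] .
    then show ?thesis
      using derived_act_eq[OF U g a] smooth_module_closed[OF coset_delta_closed[OF U(1) g] a] by simp
  qed
  have lin: "linear_map F (derived_rep M) (derived_rep M) (act (derived_rep M) g)"
    if g: "g \<in> carrier G" for g
    unfolding linear_map_def derived_rep_simps
  proof (intro conjI ballI funcsetI closed[OF g])
    fix a b assume a: "a \<in> carrier M" and b: "b \<in> carrier M"
    obtain U where U: "small U" "act M (coset_delta \<one> U) a = a"
      using ex_unit[OF a] .
    obtain V where V: "small V" "act M (coset_delta \<one> V) b = b"
      using ex_unit[OF b] .
    note UV = ex_common_unit[OF U a V b]
    have "act M (coset_delta \<one> (U \<inter> V)) (a \<oplus>\<^bsub>M\<^esub> b) = a \<oplus>\<^bsub>M\<^esub> b"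
      using linear_mapD(2)[OF smooth_module_linear[OF coset_delta_closed[OF UV(1) one_closed]] a b] UV
      by simp
    then show "derived_act M g (a \<oplus>\<^bsub>M\<^esub> b) = derived_act M g a \<oplus>\<^bsub>M\<^esub> derived_act M g b"
      using linear_mapD(2)[OF smooth_module_linear[OF coset_delta_closed[OF UV(1) g]] a b]
        derived_act_eq[OF UV(1) _ g] UV(2,3) a b by simp
  next
    fix c a assume c: "c \<in> carrier F" and a: "a \<in> carrier M"
    obtain U where U: "small U" "act M (coset_delta \<one> U) a = a"
      using ex_unit[OF a] .
    have "act M (coset_delta \<one> U) (c \<odot>\<^bsub>M\<^esub> a) = c \<odot>\<^bsub>M\<^esub> a"
      using linear_mapD(3)[OF smooth_module_linear[OF coset_delta_closed[OF U(1) one_closed]] a c] U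
      by simp
    then show "derived_act M g (c \<odot>\<^bsub>M\<^esub> a) = c \<odot>\<^bsub>M\<^esub> derived_act M g a"
      using linear_mapD(3)[OF smooth_module_linear[OF coset_delta_closed[OF U(1) g]] a c]
        derived_act_eq[OF U(1) _ g] U(2) a c by simp
  qed
  have one: "derived_act M \<one> a = a" if a: "a \<in> carrier M" for a
  proof -
    obtain U where U: "small U" "act M (coset_delta \<one> U) a = a"
      using ex_unit[OF a] .
    then show ?thesis
      using derived_act_eq[OF U one_closed a] by simp
  qed
  have mult: "derived_act M (g \<otimes> h) a = derived_act M g (derived_act M h a)"
    if g: "g \<in> carrier G" and h: "h \<in> carrier G" and a: "a \<in> carrier M" for g h a
  proof -
    obtain U where U: "small U" "act M (coset_delta \<one> U) a = a"
      using ex_unit[OF a] .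
    have d: "coset_delta h U \<in> carrier Hecke"
      using U(1) h by simp
    \<comment> \<open>The idempotent of U need not fix b, so the subgroup for b comes from left
      invariance of \<open>coset_delta h U\<close>. Then \<open>coset_delta k W\<close> sends b to
      \<open>coset_delta (k \<otimes> h) U\<close> applied to a: k = \<one> shows that the
      idempotent of W fixes b, and k = g gives the product.\<close>
    obtain W where W: "small W" "left_invariant W (coset_delta h U)"
      using hecke_left_invariant[OF d] .
    define b where "b = act M (coset_delta h U) a"
    have b: "b \<in> carrier M"
      using smooth_module_closed[OF d a] by (simp add: b_def)
    have W_act: "act M (coset_delta k W) b = act M (coset_delta (k \<otimes> h) U) a" if "k \<in> carrier G" for k
      using act_coset_delta_mult[OF W(1) that d W(2) a] left_translate_coset_delta[OF that h]
      by (simp add: b_def)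
    have "act M (coset_delta \<one> W) b = b"
      using W_act[OF one_closed] h by (simp add: b_def)
    then have "derived_act M g b = act M (coset_delta (g \<otimes> h) U) a"
      using derived_act_eq[OF W(1) _ g b] W_act[OF g] by simp
    then show ?thesis
      using derived_act_eq[OF U _ a] g h by (simp add: b_def)
  qed
  have "representation G F (derived_rep M)"
    unfolding representation_def using m lin one mult by simp
  moreover have "\<exists>U. compact_open_subgroup G T U \<and> (\<forall>g\<in>U. derived_act M g a = a)"
    if a: "a \<in> carrier M" for a
  proof -
    obtain U where U: "small U" "act M (coset_delta \<one> U) a = a"
      using ex_unit[OF a] .
    have "derived_act M g a = a" if "g \<in> U" for g
      using derived_act_eq[OF U small_mem[OF U(1) that] a] coset_delta_in_subgroup[OF U(1) that] U(2)
      by simp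
    then show ?thesis
      using small_compact_open[OF U(1)] by blast
  qed
  ultimately show ?thesis
    by (simp add: smooth_representation_def)
qed

text \<open>For U small enough the integral is a sum over X in which x acts on a as
  \<open>coset_delta x U\<close>. By linearity in the algebra, \<open>hecke_expand\<close>
  reassembles these indicators into \<open>\<Theta>\<close>.\<close>

lemma integrated_derived:
  assumes \<Theta>: "\<Theta> \<in> carrier Hecke" and a: "a \<in> carrier M"
  shows "act (integrated_rep G haar (derived_rep M)) \<Theta> a = act M \<Theta> a"
proof -
  obtain V where V: "small V" "act M (coset_delta \<one> V) a = a"
    using ex_unit[OF a] .
  obtain U X where U: "small U" "U \<subseteq> V" "right_invariant U \<Theta>"
    and X: "transversal U X" "covers U X {g. \<Theta> g \<noteq> \<zero>\<^bsub>F\<^esub>}"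
    using hecke_common_transversal[OF \<Theta> \<Theta> V(1)] by metis
  have XG: "x \<in> carrier G" if "x \<in> X" for x
    using X(1) that by (auto simp: transversal_def)
  have Ua: "act M (coset_delta \<one> U) a = a"
    using act_coset_delta_refine[OF V(1) U(1,2) one_closed a V(2)] V(2) by simp
  have fixed: "\<forall>u\<in>U. act (derived_rep M) u a = a"
    using derived_act_eq[OF U(1) Ua small_mem[OF U(1)] a] coset_delta_in_subgroup[OF U(1)] Ua by simp
  have h: "(\<lambda>x. (haar U \<otimes>\<^bsub>F\<^esub> \<Theta> x) \<odot>\<^bsub>Hecke\<^esub> coset_delta x U) \<in> X \<rightarrow> carrier Hecke"
    using XG U(1) \<Theta> by (intro Pi_I H.smult_closed coset_delta_closed) auto
  have "act (integrated_rep G haar (derived_rep M)) \<Theta> a =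
      (\<Oplus>\<^bsub>derived_rep M\<^esub>x\<in>X. (haar U \<otimes>\<^bsub>F\<^esub> \<Theta> x) \<odot>\<^bsub>M\<^esub> derived_act M x a)"
    using integrated_act_eq[OF derived_smooth_rep \<Theta> _ U(1,3) fixed X] a by simp
  \<comment> \<open>Finite sums depend on carrier, zero and addition, which the two records
    share.\<close>
  also have "\<dots> = (\<Oplus>\<^bsub>M\<^esub>x\<in>X. (haar U \<otimes>\<^bsub>F\<^esub> \<Theta> x) \<odot>\<^bsub>M\<^esub> derived_act M x a)"
    by (simp add: finsum_def finprod_def)
  also have "\<dots> = (\<Oplus>\<^bsub>M\<^esub>x\<in>X. act M ((haar U \<otimes>\<^bsub>F\<^esub> \<Theta> x) \<odot>\<^bsub>Hecke\<^esub> coset_delta x U) a)"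
  proof (rule M.M.finsum_cong'[OF refl])
    fix x assume x: "x \<in> X"
    show "(haar U \<otimes>\<^bsub>F\<^esub> \<Theta> x) \<odot>\<^bsub>M\<^esub> derived_act M x a =
        act M ((haar U \<otimes>\<^bsub>F\<^esub> \<Theta> x) \<odot>\<^bsub>Hecke\<^esub> coset_delta x U) a"
      using derived_act_eq[OF U(1) Ua XG[OF x] a] linear_mapD(3)[OF smooth_module_linear_hecke[OF a]]
        XG[OF x] U(1) \<Theta> by (simp del: hecke_simps)
  qed (use h smooth_module_closed a in blast)
  also have "\<dots> = act M \<Theta> a"
    using linear_map_finsum[OF module_hecke smooth_module_module smooth_module_linear_hecke[OF a] h]
      hecke_expand[OF \<Theta> U(1,3) X] by simp
  finally show ?thesis .
qed

end

section \<open>Comparison of the two constructions and the equivalence\<close>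

lemma derived_integrated:
  assumes V: "smooth_representation G T F V" and g: "g \<in> carrier G" and v: "v \<in> carrier V"
  shows "derived_act (integrated_rep G haar V) g v = act V g v"
proof -
  obtain U where U: "small U" "\<forall>u\<in>U. act V u v = v"
    using smooth_rep_fixed[OF V v] .
  \<comment> \<open>The idempotent of a subgroup that fixes v fixes v too, so
    \<open>derived_act\<close> may be evaluated with this U.\<close>
  have "act (integrated_rep G haar V) (coset_delta \<one> U) v = v"
    using integrated_coset_delta[OF V v U one_closed] smooth_rep_one[OF V v] by simp
  then show ?thesis
    using derived_act_eq[OF integrated_smooth_module[OF V] U(1) _ g] v
      integrated_coset_delta[OF V v U g] by simp
qed

text \<open>If the idempotent of U fixes m, it also fixes f m by equivariance, so g acts through the
  same indicator on both sides.\<close>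

lemma derived_equivariant:
  assumes M: "smooth_module F Hecke M" and N: "smooth_module F Hecke N"
    and f: "f \<in> equivariant_maps (carrier Hecke) F M N"
  shows "f \<in> equivariant_maps (carrier G) F (derived_rep M) (derived_rep N)"
proof -
  have eq: "f (act M h m) = act N h (f m)" if "h \<in> carrier Hecke" "m \<in> carrier M" for h m
    using f that by (auto simp: equivariant_maps_def)
  have "f (derived_act M g m) = derived_act N g (f m)" if g: "g \<in> carrier G" and m: "m \<in> carrier M" for g m
  proof -
    obtain U where U: "small U" "act M (coset_delta \<one> U) m = m"
      using ex_unit[OF M m] .
    have "act N (coset_delta \<one> U) (f m) = f m"
      using eq[of "coset_delta \<one> U" m] U m by simp
    then show ?thesis
      using derived_act_eq[OF M U g m] derived_act_eq[OF N U(1) _ g] eq[of "coset_delta g U" m]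
        equivariant_maps_closed[OF f m] U(1) g m by simp
  qed
  then show ?thesis
    using f by (auto simp: equivariant_maps_def linear_map_def)
qed

text \<open>The given isomorphism respects the Hecke action. By \<open>derived_equivariant\<close>
  it also respects the recovered action of G, and on the module of V this is the original action, so
  simple submodules correspond.\<close>

lemma derived_semisimple:
  assumes A: "A \<subseteq> carrier G" and M: "smooth_module F Hecke M"
    and V: "smooth_representation G T F V" "semisimple A F V"
    and iso: "isomorphic (smooth_modules F Hecke) M (integrated_rep G haar V)"
  shows "semisimple A F (derived_rep M)"
proof -
  let ?I = "integrated_rep G haar V"
  obtain f g where f: "f \<in> equivariant_maps (carrier Hecke) F M ?I"
    and g: "g \<in> equivariant_maps (carrier Hecke) F ?I M"
    and gf: "compose (carrier M) g f = (\<lambda>x\<in>carrier M. x)"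
    and fg: "compose (carrier V) f g = (\<lambda>x\<in>carrier V. x)"
    using iso by (auto simp: isomorphic_def isomorphism_def inverse_morphisms_def smooth_modules_def acted_cat_def)
  have V': "derived_act ?I s v = act V s v" if "s \<in> carrier G" "v \<in> carrier V" for s v
    using derived_integrated[OF V(1) that] .
  have "f \<in> equivariant_maps (carrier G) F (derived_rep M) (derived_rep ?I)"
    by (rule derived_equivariant[OF M integrated_smooth_module[OF V(1)] f])
  then have f': "f \<in> equivariant_maps (carrier G) F (derived_rep M) V"
    using V' by (auto simp: equivariant_maps_def linear_map_def Pi_iff)
  have "g \<in> equivariant_maps (carrier G) F (derived_rep ?I) (derived_rep M)"
    by (rule derived_equivariant[OF integrated_smooth_module[OF V(1)] M g])
  then have g': "g \<in> equivariant_maps (carrier G) F V (derived_rep M)"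
    using V' by (auto simp: equivariant_maps_def linear_map_def)
  show ?thesis
  proof (rule semisimple_transfer[OF _ smooth_rep_module[OF V(1)] f' g' _ _ A V(2)])
    show "Module.module F (derived_rep M)"
      by (rule module_cong[OF smooth_module_module[OF M]]) simp_all
    show "g (f x) = x" if "x \<in> carrier (derived_rep M)" for x
      using fun_cong[OF gf, of x] that by (simp add: compose_eq)
    show "f (g x) = x" if "x \<in> carrier V" for x
      using fun_cong[OF fg, of x] that by (simp add: compose_eq)
  qed
qed

lemma semisimple_categories_equivalent:
  assumes A: "A \<subseteq> carrier G"
  shows "equivalent_categories
    (semisimple_smooth_reps G T F A :: (('g, 'f, 'v) acted, 'v \<Rightarrow> 'v) cat)
    (semisimple_smooth_modules G T F haar A :: (('g \<Rightarrow> 'f, 'f, 'v) acted, 'v \<Rightarrow> 'v) cat)"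
  unfolding semisimple_smooth_reps_def semisimple_smooth_modules_def smooth_reps_def smooth_modules_def
    acted_subcat_simps
proof (rule equivalent_acted_cats[where \<phi> = "integrated_rep G haar" and \<psi> = derived_rep])
  \<comment> \<open>Membership in the target category means being isomorphic to the module of a
    semisimple representation; for such a module itself this is reflexivity. The trivial condition
    below presents the whole category as a full subcategory.\<close>
  have iso_refl: "isomorphic (acted_cat (carrier Hecke) F (smooth_module F Hecke)) M M"
    if "smooth_module F Hecke M" for M :: "('g \<Rightarrow> 'f, 'f, 'v) acted"
  proof -
    have "isomorphism (full_subcat (acted_cat (carrier Hecke) F (smooth_module F Hecke)) (\<lambda>_. True)) M M
        (\<lambda>x\<in>carrier M. x)"
      using smooth_module_module smooth_module_linear that same_action_refl
      by (intro isomorphism_same_action) blast+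
    moreover have "full_subcat (acted_cat (carrier Hecke) F (smooth_module F Hecke)) (\<lambda>_. True) =
        (acted_cat (carrier Hecke) F (smooth_module F Hecke) :: (('g \<Rightarrow> 'f, 'f, 'v) acted, 'v \<Rightarrow> 'v) cat)"
      by (simp add: full_subcat_def acted_cat_def)
    ultimately show ?thesis
      by (auto simp: isomorphic_def)
  qed
  fix V :: "('g, 'f, 'v) acted"
  assume V: "smooth_representation G T F V" "semisimple A F V"
  show "smooth_module F Hecke (integrated_rep G haar V) \<and>
      (\<exists>W\<in>{V. smooth_representation G T F V \<and> semisimple A F V}.
        isomorphic (acted_cat (carrier Hecke) F (smooth_module F Hecke))
          (integrated_rep G haar V) (integrated_rep G haar W))"
    using V integrated_smooth_module[OF V(1)] iso_refl by blast
next
  fix M :: "('g \<Rightarrow> 'f, 'f, 'v) acted"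
  assume M: "smooth_module F Hecke M"
    and ex: "\<exists>W\<in>{V. smooth_representation G T F V \<and> semisimple A F V}.
        isomorphic (acted_cat (carrier Hecke) F (smooth_module F Hecke)) M (integrated_rep G haar W)"
  show "smooth_representation G T F (derived_rep M) \<and> semisimple A F (derived_rep M)"
    using derived_smooth_rep[OF M] derived_semisimple[OF A M] ex by (auto simp: smooth_modules_def)
next
  show "same_action (carrier G) V (derived_rep (integrated_rep G haar V))"
    if "smooth_representation G T F V" for V :: "('g, 'f, 'v) acted"
    using derived_integrated[OF that] by (simp add: same_action_def)
  show "same_action (carrier Hecke) (integrated_rep G haar (derived_rep M)) M"
    if "smooth_module F Hecke M" for M :: "('g \<Rightarrow> 'f, 'f, 'v) acted"
    using integrated_derived[OF that] by (simp add: same_action_def)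
qed (simp_all add: smooth_rep_module smooth_rep_linear smooth_module_module smooth_module_linear
    integrated_equivariant derived_equivariant)

end

theorem proposition2p5:
  fixes G :: "('g, 'a) monoid_scheme" and T :: "'g topology"
    and F :: "('f, 'b) ring_scheme" and A K :: "'g set"
  assumes "topological_group G T"
    and "locally_compact_space T"
    and "totally_disconnected_space T"
    and "central_subgroup A G"
    and "closedin T A"
    and "Ring.field F"
    and "compact_open_subgroup G T K"
    and "ordinary F (G\<lparr>carrier := K\<rparr>) (subtopology T K)"
  shows "equivalent_categories
    (semisimple_smooth_reps G T F A :: (('g, 'f, 'v) acted, 'v \<Rightarrow> 'v) cat)
    (semisimple_smooth_modules G T F (normalised_haar G T F K) A
       :: (('g \<Rightarrow> 'f, 'f, 'v) acted, 'v \<Rightarrow> 'v) cat)"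
proof -
  interpret group G
    using assms(1) by (simp add: topological_group_def)
  interpret F: field F
    by fact
  interpret ordinary_td_group G T K F
    using assms by unfold_locales
  have "A \<subseteq> carrier G"
    using assms(4) subgroup.subset by (auto simp: central_subgroup_def)
  then show ?thesis
    by (rule semisimple_categories_equivalent)
qed

end
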